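(* Let $q\in(-1,1]$ and let $\mathbf{X}=(X_\tau)_{\tau\ge0}$ be a $q$-Wiener process. Then: (i) For all $\tau>\sigma>0$, almost surely, $$\mathbb{E}\left((X_\tau-X_\sigma)^2|\mathcal{F}^X_{\le\sigma}\right)=\tau-\sigma,$$ $$\mathbb{E}\left((X_\tau-X_\sigma)^3|\mathcal{F}^X_{\le\sigma}\right)=-(1-q)(\tau-\sigma)X_\sigma,$$ $$\mathbb{E}\left((X_\tau-X_\sigma)^4|\mathcal{F}^X_{\le\sigma}\right)=(\tau-\sigma)\left(X_\sigma^2(1-q)^2+(2+q)(\tau-\sigma)+\sigma(1-q^2)\right).$$ Hence $\langle X\rangle_\tau=\tau$ (that is, $X_\tau^2-\tau$ is a martingale), and moreover, if $|q|<1$, $\mathbf{X}$ does not have independent increments. (ii) Almost every path of (a separable version of) $\mathbf{X}$ has left- and right-hand limits at every point; thus $\mathbf{X}$ can be modified to have càdlàg trajectories. (iii) $\mathbf{X}$ is a Feller-continuous process and has the strong Markov property.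
   Context: **Densities.** Let $(a)_\infty=\prod_{i\ge0}(1-aq^i)$, $(a,b)_\infty=(a)_\infty(b)_\infty$, $0^0=1$, $I_A$ the indicator function of $A$; $S(q)=[-2/\sqrt{1-q},2/\sqrt{1-q}]$ for $|q|<1$ and $S(1)=\mathbb{R}$. For $|q|<1$, $|\rho|<1$, $y\in S(q)$: $$f_N(x|q)=\frac{\sqrt{1-q}\,(q)_\infty}{2\pi\sqrt{4-(1-q)x^2}}\prod_{k=0}^\infty\left((1+q^k)^2-(1-q)x^2q^k\right)I_{S(q)}(x),$$ $$f_{CN}(x|y,\rho,q)=\frac{\sqrt{1-q}\,(\rho^2,q)_\infty}{2\pi\sqrt{4-(1-q)x^2}}\prod_{k=0}^\infty\frac{(1+q^k)^2-(1-q)x^2q^k}{(1-\rho^2q^{2k})^2-(1-q)\rho q^k(1+\rho^2q^{2k})xy+(1-q)\rho^2(x^2+y^2)q^{2k}}\,I_{S(q)}(x);$$ for $q=1$, $f_N(x|1)$ is the $N(0,1)$ density and $f_{CN}(x|y,\rho,1)$ is the $N(\rho y,1-\rho^2)$ density. **Processes.** For $q\in(-1,1]$, $\alpha>0$, an $(\alpha,q)$-OU process is a stationary Markov process $(Y_t)_{t\in\mathbb{R}}$ with state space $S(q)$, marginal density $f_N(x|q)$, and such that for $s>t$ the conditional distribution of $Y_s$ given $Y_t=y$ has density $f_{CN}(x|y,e^{-\alpha(s-t)},q)$. A $q$-Wiener process is the process $X_0=0$, $X_\tau=\sqrt\tau\,Y_{(\log\tau)/(2\alpha)}$ for $\tau>0$,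 where $(Y_t)$ is an $(\alpha,q)$-OU process (for some $\alpha>0$). $\mathcal{F}^X_{\le\sigma}=\sigma(X_u:0\le u\le\sigma)$. **Feller and strong Markov.** $\mathbf{X}$ is a (time-inhomogeneous) Markov process taking values in $\sqrt\sigma S(q)$ at time $\sigma$, with transition operators $(P_{\sigma,\tau}f)(y)=\mathbb{E}(f(X_\tau)|X_\sigma=y)$, $0\le\sigma<\tau$, i.e. for $\sigma>0$, $(P_{\sigma,\tau}f)(y)=\int f(\sqrt\tau x)f_{CN}(x|y/\sqrt\sigma,\sqrt{\sigma/\tau},q)dx$, and $(P_{0,\tau}f)(0)=\int f(\sqrt\tau x)f_N(x|q)dx$. Feller-continuity means that each $P_{\sigma,\tau}$ maps bounded continuous functions to bounded continuous functions. The strong Markov property (for the càdlàg modification) means that for every a.s. finite stopping time $T$ of the natural filtration, every $u>0$ and bounded measurable $f$, $\mathbb{E}(f(X_{T+u})|\mathcal{F}^X_T)=(P_{T,T+u}f)(X_T)$ a.s. *)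

theory Defs
  imports "HOL-Probability.Probability"
begin

section \<open>Densities\<close>

definition qpoch :: "real \<Rightarrow> real \<Rightarrow> real" where
  "qpoch a q = (\<Prod>i. 1 - a * q ^ i)"

definition S_q :: "real \<Rightarrow> real set" where
  "S_q q = (if q = 1 then UNIV else {- 2 / sqrt (1 - q) .. 2 / sqrt (1 - q)})"

text \<open>For \<open>q < 1\<close> both densities take the value \<open>0\<close> at the endpoints of \<open>S_q q\<close>, because
  there the quotient has denominator \<open>0\<close>.\<close>

definition f_N :: "real \<Rightarrow> real \<Rightarrow> real" where
  "f_N q x =
    (if q = 1 then std_normal_density x
     else sqrt (1 - q) * qpoch q q / (2 * pi * sqrt (4 - (1 - q) * x\<^sup>2))
          * (\<Prod>k. (1 + q ^ k)\<^sup>2 - (1 - q) * x\<^sup>2 * q ^ k)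
          * indicator (S_q q) x)"

text \<open>\<open>f_CN q \<rho> y x\<close> is the density in \<open>x\<close>, given \<open>y\<close>. The second parameter of
  \<^const>\<open>normal_density\<close> is the standard deviation.\<close>

definition f_CN :: "real \<Rightarrow> real \<Rightarrow> real \<Rightarrow> real \<Rightarrow> real" where
  "f_CN q \<rho> y x =
    (if q = 1 then normal_density (\<rho> * y) (sqrt (1 - \<rho>\<^sup>2)) x
     else sqrt (1 - q) * (qpoch (\<rho>\<^sup>2) q * qpoch q q) / (2 * pi * sqrt (4 - (1 - q) * x\<^sup>2))
          * (\<Prod>k. ((1 + q ^ k)\<^sup>2 - (1 - q) * x\<^sup>2 * q ^ k)
                 / ((1 - \<rho>\<^sup>2 * q ^ (2 * k))\<^sup>2
                    - (1 - q) * \<rho> * q ^ k * (1 + \<rho>\<^sup>2 * q ^ (2 * k)) * x * y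
                    + (1 - q) * \<rho>\<^sup>2 * (x\<^sup>2 + y\<^sup>2) * q ^ (2 * k)))
          * indicator (S_q q) x)"

section \<open>Conditioning\<close>

definition gen_sigma :: "'a measure \<Rightarrow> ('i \<Rightarrow> 'a \<Rightarrow> real) \<Rightarrow> 'i set \<Rightarrow> 'a measure" where
  "gen_sigma M Z I = sigma (space M) (\<Union>i\<in>I. {Z i -` A \<inter> space M | A. A \<in> sets borel})"

text \<open>The integrability requirement matters: \<^const>\<open>real_cond_exp\<close> is total, and its
  values are meaningless for functions that are not integrable.\<close>

definition has_cond_exp ::
    "'a measure \<Rightarrow> 'a measure \<Rightarrow> ('a \<Rightarrow> real) \<Rightarrow> ('a \<Rightarrow> real) \<Rightarrow> bool" where
  "has_cond_exp M F Z W \<longleftrightarrow> integrable M Z \<and> (AE \<omega> in M. real_cond_exp M F Z \<omega> = W \<omega>)"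

section \<open>Ornstein--Uhlenbeck and Wiener processes with parameter q\<close>

definition stationary :: "'a measure \<Rightarrow> (real \<Rightarrow> 'a \<Rightarrow> real) \<Rightarrow> bool" where
  "stationary M Y \<longleftrightarrow>
    (\<forall>J h. finite J \<longrightarrow>
       distr M (\<Pi>\<^sub>M t\<in>J. borel) (\<lambda>\<omega>. \<lambda>t\<in>J. Y (t + h) \<omega>)
         = distr M (\<Pi>\<^sub>M t\<in>J. borel) (\<lambda>\<omega>. \<lambda>t\<in>J. Y t \<omega>))"

definition markov :: "'a measure \<Rightarrow> (real \<Rightarrow> 'a \<Rightarrow> real) \<Rightarrow> bool" where
  "markov M Y \<longleftrightarrow>
    (\<forall>t s. t < s \<longrightarrow> (\<forall>A\<in>sets borel. AE \<omega> in M.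
       real_cond_exp M (gen_sigma M Y {..t}) (\<lambda>\<omega>. indicator A (Y s \<omega>)) \<omega>
         = real_cond_exp M (gen_sigma M Y {t}) (\<lambda>\<omega>. indicator A (Y s \<omega>)) \<omega>))"

definition ou_process :: "'a measure \<Rightarrow> real \<Rightarrow> real \<Rightarrow> (real \<Rightarrow> 'a \<Rightarrow> real) \<Rightarrow> bool" where
  "ou_process M \<alpha> q Y \<longleftrightarrow>
     (\<forall>t. Y t \<in> borel_measurable M) \<and>
     (\<forall>t. \<forall>\<omega>\<in>space M. Y t \<omega> \<in> S_q q) \<and>
     stationary M Y \<and>
     markov M Y \<and>
     (\<forall>t. distributed M lborel (Y t) (\<lambda>x. ennreal (f_N q x))) \<and>
     (\<forall>t s. t < s \<longrightarrow> (\<forall>A\<in>sets borel. AE \<omega> in M.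
        real_cond_exp M (gen_sigma M Y {t}) (\<lambda>\<omega>. indicator A (Y s \<omega>)) \<omega>
          = (LINT x:A|lborel. f_CN q (exp (- \<alpha> * (s - t))) (Y t \<omega>) x)))"

text \<open>Processes indexed by \<open>[0,\<infinity>)\<close> are functions on \<^typ>\<open>real\<close> whose values at
  negative times are irrelevant.\<close>

definition q_wiener :: "'a measure \<Rightarrow> real \<Rightarrow> (real \<Rightarrow> 'a \<Rightarrow> real) \<Rightarrow> bool" where
  "q_wiener M q X \<longleftrightarrow>
     (\<exists>\<alpha> Y. \<alpha> > 0 \<and> ou_process M \<alpha> q Y \<and>
        (\<forall>\<omega>\<in>space M. X 0 \<omega> = 0) \<and>
        (\<forall>\<tau>>0. \<forall>\<omega>\<in>space M. X \<tau> \<omega> = sqrt \<tau> * Y (ln \<tau> / (2 * \<alpha>)) \<omega>))"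

section \<open>Martingales, increments, paths\<close>

definition is_martingale ::
    "'a measure \<Rightarrow> (real \<Rightarrow> 'a measure) \<Rightarrow> (real \<Rightarrow> 'a \<Rightarrow> real) \<Rightarrow> bool" where
  "is_martingale M F Z \<longleftrightarrow>
     (\<forall>t\<ge>0. integrable M (Z t) \<and> Z t \<in> borel_measurable (F t)) \<and>
     (\<forall>s t. 0 \<le> s \<and> s < t \<longrightarrow> has_cond_exp M (F s) (Z t) (Z s))"

definition independent_increments :: "'a measure \<Rightarrow> (real \<Rightarrow> 'a \<Rightarrow> real) \<Rightarrow> bool" where
  "independent_increments M X \<longleftrightarrow>
     (\<forall>n (t :: nat \<Rightarrow> real). 0 \<le> t 0 \<and> strict_mono_on {..n} t \<longrightarrow>
        prob_space.indep_vars M (\<lambda>_. borel) (\<lambda>i \<omega>. X (t (Suc i)) \<omega> - X (t i) \<omega>) {..<n})"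

definition modification ::
    "'a measure \<Rightarrow> (real \<Rightarrow> 'a \<Rightarrow> real) \<Rightarrow> (real \<Rightarrow> 'a \<Rightarrow> real) \<Rightarrow> bool" where
  "modification M X Z \<longleftrightarrow>
     (\<forall>t\<ge>0. Z t \<in> borel_measurable M \<and> (AE \<omega> in M. Z t \<omega> = X t \<omega>))"

text \<open>Separability in the sense of Doob, relative to the class of closed sets.\<close>

definition separable_process :: "'a measure \<Rightarrow> (real \<Rightarrow> 'a \<Rightarrow> real) \<Rightarrow> bool" where
  "separable_process M Z \<longleftrightarrow>
     (\<exists>D. countable D \<and> D \<subseteq> {0..} \<and> {0..} \<subseteq> closure D \<and>
        (AE \<omega> in M. \<forall>I K. open I \<and> closed K \<and> (\<forall>t\<in>D \<inter> I. Z t \<omega> \<in> K)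
            \<longrightarrow> (\<forall>t\<in>{0..} \<inter> I. Z t \<omega> \<in> K)))"

definition has_one_sided_limits :: "(real \<Rightarrow> real) \<Rightarrow> bool" where
  "has_one_sided_limits g \<longleftrightarrow>
     (\<forall>t\<ge>0. \<exists>l. (g \<longlongrightarrow> l) (at_right t)) \<and> (\<forall>t>0. \<exists>l. (g \<longlongrightarrow> l) (at_left t))"

definition cadlag :: "(real \<Rightarrow> real) \<Rightarrow> bool" where
  "cadlag g \<longleftrightarrow>
     (\<forall>t\<ge>0. (g \<longlongrightarrow> g t) (at_right t)) \<and> (\<forall>t>0. \<exists>l. (g \<longlongrightarrow> l) (at_left t))"

section \<open>Transition operators, Feller continuity, strong Markov property\<close>

definition q_trans :: "real \<Rightarrow> real \<Rightarrow> real \<Rightarrow> (real \<Rightarrow> real) \<Rightarrow> real \<Rightarrow> real" where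
  "q_trans q \<sigma> \<tau> f y =
     (if \<sigma> = 0 then LINT x|lborel. f (sqrt \<tau> * x) * f_N q x
      else LINT x|lborel. f (sqrt \<tau> * x) * f_CN q (sqrt (\<sigma> / \<tau>)) (y / sqrt \<sigma>) x)"

definition state_space :: "real \<Rightarrow> real \<Rightarrow> real set" where
  "state_space q \<tau> = (\<lambda>x. sqrt \<tau> * x) ` S_q q"

definition markov_with_transitions ::
    "'a measure \<Rightarrow> (real \<Rightarrow> 'a \<Rightarrow> real)
      \<Rightarrow> (real \<Rightarrow> real \<Rightarrow> (real \<Rightarrow> real) \<Rightarrow> real \<Rightarrow> real) \<Rightarrow> bool" where
  "markov_with_transitions M X P \<longleftrightarrow>
     (\<forall>\<sigma> \<tau>. 0 \<le> \<sigma> \<and> \<sigma> < \<tau> \<longrightarrow>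
        (\<forall>f\<in>borel_measurable borel. bounded (range f) \<longrightarrow>
           has_cond_exp M (gen_sigma M X {0..\<sigma>}) (\<lambda>\<omega>. f (X \<tau> \<omega>)) (\<lambda>\<omega>. P \<sigma> \<tau> f (X \<sigma> \<omega>))))"

definition feller_continuous ::
    "(real \<Rightarrow> real set) \<Rightarrow> (real \<Rightarrow> real \<Rightarrow> (real \<Rightarrow> real) \<Rightarrow> real \<Rightarrow> real) \<Rightarrow> bool" where
  "feller_continuous E P \<longleftrightarrow>
     (\<forall>\<sigma> \<tau>. 0 \<le> \<sigma> \<and> \<sigma> < \<tau> \<longrightarrow>
        (\<forall>f. continuous_on (E \<tau>) f \<and> bounded (f ` E \<tau>) \<longrightarrow>
           continuous_on (E \<sigma>) (P \<sigma> \<tau> f) \<and> bounded (P \<sigma> \<tau> f ` E \<sigma>)))"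

text \<open>The natural filtration is indexed by \<open>[0,\<infinity>]\<close>, so that stopping times may take the
  value \<open>\<infinity>\<close>; at \<open>\<infinity>\<close> it is generated by the whole process. It is neither completed nor made
  right-continuous.\<close>

definition nat_filtration ::
    "'a measure \<Rightarrow> (real \<Rightarrow> 'a \<Rightarrow> real) \<Rightarrow> ennreal \<Rightarrow> 'a measure" where
  "nat_filtration M X t = gen_sigma M X {u. 0 \<le> u \<and> ennreal u \<le> t}"

lemma filtration_nat_filtration: "filtration (space M) (nat_filtration M X)"
proof -
  have "(\<Union>i\<in>I. {X i -` A \<inter> space M | A. A \<in> sets borel}) \<subseteq> Pow (space M)" for I
    by auto
  then show ?thesis
    unfolding nat_filtration_def gen_sigma_def
    by unfold_locales (auto intro!: sigma_sets_mono' intro: order_trans)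
qed

definition strong_markov ::
    "'a measure \<Rightarrow> (real \<Rightarrow> 'a \<Rightarrow> real)
      \<Rightarrow> (real \<Rightarrow> real \<Rightarrow> (real \<Rightarrow> real) \<Rightarrow> real \<Rightarrow> real) \<Rightarrow> bool" where
  "strong_markov M X P \<longleftrightarrow>
     (\<forall>T u f. stopping_time (nat_filtration M X) T \<and> (AE \<omega> in M. T \<omega> < \<infinity>) \<and> u > 0 \<and>
        f \<in> borel_measurable borel \<and> bounded (range f) \<longrightarrow>
        has_cond_exp M (filtration.pre_sigma (space M) (nat_filtration M X) T)
          (\<lambda>\<omega>. f (X (enn2real (T \<omega>) + u) \<omega>))
          (\<lambda>\<omega>. P (enn2real (T \<omega>)) (enn2real (T \<omega>) + u) f (X (enn2real (T \<omega>)) \<omega>)))"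

end

theory Submission
  imports Defs
begin

text \<open>For \<open>\<bar>q\<bar> < 1\<close> the conditional moments are found without the \<open>q\<close>-Hermite polynomials. Dividing the
  density by the first factor of its product turns \<open>\<rho>\<close> into \<open>\<rho> * q\<close>; integrating powers of \<open>x\<close> against
  this identity expresses the moment of order \<open>k + 2\<close> through lower ones, once the orders 0, 1 and 2 are known.
  Order 0 holds because a conditional density has total mass 1. Integrated over the stationary law, the recursion
  with \<open>k = 0\<close> gives the covariance in terms of the variance, the limit \<open>\<rho> \<rightarrow> 0\<close> gives the variance, and by
  reversibility the mean square distance between the conditional mean and \<open>\<rho> * y\<close> vanishes.

  So \<open>X\<close> is a square integrable martingale with \<open>E (X\<^sub>\<tau> - X\<^sub>\<sigma>)\<^sup>2 = \<tau> - \<sigma>\<close>, and the upcrossing inequality on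
  dyadic grids yields a cadlag modification. Increments are dependent because
  \<open>E (X\<^sub>1 * (X\<^sub>2 - X\<^sub>1) ^ 3) = - (1 - q)\<close>, while \<open>E X\<^sub>1 = 0\<close>. The kernel depends continuously
  on all its parameters, which gives the Feller property; approximating a stopping time from above by dyadic times
  and using right-continuity then gives the strong Markov property.\<close>

section \<open>The Mehler kernel\<close>

text \<open>No analytic fact about the densities is imported from the theory of special functions.
  Normalisation and consistency of the transitions are read off from the existence of the process,
  through its conditional probabilities. The price is that total mass 1 and every moment identity
  hold only for almost every starting value. At a random time this is too little; there the
  continuity of the kernel recovers total mass 1.

  The recursion with \<open>k = 0\<close> ties the orders 0, 1 and 2 together, so one further
  equation for the conditional mean is missing. Covariance and reversibility supply it. All
  relations contain the factor \<open>1 - q\<close> and become void at \<open>q = 1\<close>; in that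
  case the kernel is Gaussian and the moments are the classical ones.

  The filtration is neither completed nor right-continuous. An event of a modification therefore
  matches an event of \<open>X\<close> only up to null sets, and stopping times are discretised by
  cells that are open on the right.\<close>

text \<open>For \<open>p = \<rho>\<^sup>2\<close> and \<open>s = \<rho> * y\<close>, \<open>mehler_den q p s x k\<close> is the \<open>k\<close>-th denominator of
  \<open>f_CN q \<rho> y x\<close> and \<open>kern q p s x\<close> is \<open>f_CN q \<rho> y x\<close> itself. For the Wiener process
  \<open>p = \<sigma> / \<tau>\<close> and \<open>s = X\<^sub>\<sigma> / sqrt \<tau>\<close>, which makes sense also at \<open>\<sigma> = 0\<close>.\<close>

definition mehler_den :: "real \<Rightarrow> real \<Rightarrow> real \<Rightarrow> real \<Rightarrow> nat \<Rightarrow> real" where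
  "mehler_den q p s x k = (1 - p * q ^ (2 * k))\<^sup>2 - (1 - q) * q ^ k * (1 + p * q ^ (2 * k)) * x * s
     + (1 - q) * (p * x\<^sup>2 + s\<^sup>2) * q ^ (2 * k)"

text \<open>For \<open>p = \<rho>\<^sup>2\<close> and \<open>s = \<rho> * y\<close> the last
  condition is \<open>(1 - q) * y\<^sup>2 \<le> 4\<close> multiplied by \<open>p\<close>, so for
  \<open>p > 0\<close> it puts \<open>y\<close> into \<open>S_q q\<close>. Free of divisions it
  still makes sense at \<open>p = 0\<close>, where it forces \<open>s = 0\<close> if
  \<open>q < 1\<close>.\<close>

definition mehler_dom :: "real \<Rightarrow> real \<Rightarrow> real \<Rightarrow> bool" where
  "mehler_dom q p s \<longleftrightarrow> 0 \<le> p \<and> p < 1 \<and> (1 - q) * s\<^sup>2 \<le> 4 * p"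

text \<open>One summand of the logarithm of \<open>kern / f_N\<close>: \<open>qpoch p q\<close>
  supplies the factors \<open>1 - p * q ^ k\<close>, the quotients in \<open>f_CN\<close> supply the
  denominators. As a series with a geometric majorant it can be bounded, shifted and passed to the
  limit termwise.\<close>

definition mehler_ln :: "real \<Rightarrow> real \<Rightarrow> real \<Rightarrow> real \<Rightarrow> nat \<Rightarrow> real" where
  "mehler_ln q p s x k = ln (1 - p * q ^ k) - ln (mehler_den q p s x k)"

definition kern :: "real \<Rightarrow> real \<Rightarrow> real \<Rightarrow> real \<Rightarrow> real" where
  "kern q p s x =
    (if q = 1 then normal_density s (sqrt (1 - p)) x
     else if mehler_dom q p s \<and> (1 - q) * x\<^sup>2 \<le> 4
       then f_N q x * exp (\<Sum>k. mehler_ln q p s x k) else 0)"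

lemma S_q_iff: "q < 1 \<Longrightarrow> x \<in> S_q q \<longleftrightarrow> (1 - q) * x\<^sup>2 \<le> 4"
proof -
  assume q: "q < 1"
  have "x \<in> S_q q \<longleftrightarrow> \<bar>x\<bar> \<le> 2 / sqrt (1 - q)"
    using q by (auto simp: S_q_def)
  also have "\<dots> \<longleftrightarrow> \<bar>x\<bar> * sqrt (1 - q) \<le> 2"
    using q by (simp add: pos_le_divide_eq)
  also have "\<dots> \<longleftrightarrow> (\<bar>x\<bar> * sqrt (1 - q))\<^sup>2 \<le> 2\<^sup>2"
    using q by (intro power_mono_iff[symmetric]) auto
  also have "\<dots> \<longleftrightarrow> (1 - q) * x\<^sup>2 \<le> 4"
    using q by (simp add: power_mult_distrib mult.commute)
  finally show ?thesis .
qed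

text \<open>With \<open>a = cos u\<close> and \<open>b = cos v\<close> the polynomial factors into
  \<open>1 - 2 r cos (u \<plusminus> v) + r\<^sup>2\<close>.\<close>

lemma mehler_poly_lower:
  fixes r a b :: real
  assumes "\<bar>r\<bar> \<le> R" "R < 1" "\<bar>a\<bar> \<le> 1" "\<bar>b\<bar> \<le> 1"
  shows "(1 - R) ^ 4 \<le> (1 - r\<^sup>2)\<^sup>2 - 4 * r * (1 + r\<^sup>2) * a * b + 4 * r\<^sup>2 * (a\<^sup>2 + b\<^sup>2)"
proof -
  define u v where "u = arccos a" and "v = arccos b"
  have ab: "a = cos u" "b = cos v"
    using assms by (auto simp: u_def v_def abs_le_iff)
  have lo: "(1 - R)\<^sup>2 \<le> 1 - 2 * r * cos w + r\<^sup>2" for w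
  proof -
    have "r * cos w \<le> \<bar>r\<bar>"
      using mult_left_le[OF abs_cos_le_one[of w] abs_ge_zero[of r]] abs_ge_self[of "r * cos w"]
      by (simp add: abs_mult)
    moreover have "(1 - R)\<^sup>2 \<le> (1 - \<bar>r\<bar>)\<^sup>2"
      using assms by (intro power_mono) auto
    moreover have "(1 - \<bar>r\<bar>)\<^sup>2 = 1 - 2 * \<bar>r\<bar> + r\<^sup>2"
      by (simp add: power2_diff)
    ultimately show ?thesis by linarith
  qed
  have "(1 - R) ^ 4 = (1 - R)\<^sup>2 * (1 - R)\<^sup>2"
    by (simp add: power4_eq_xxxx power2_eq_square)
  also have "\<dots> \<le> (1 - 2 * r * cos (u + v) + r\<^sup>2) * (1 - 2 * r * cos (u - v) + r\<^sup>2)"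
    by (rule mult_mono[OF lo lo order_trans[OF zero_le_power2 lo]]) simp
  also have "\<dots> = (1 - r\<^sup>2)\<^sup>2 - 4 * r * (1 + r\<^sup>2) * a * b + 4 * r\<^sup>2 * (a\<^sup>2 + b\<^sup>2)"
  proof -
    have s: "sin u ^ 2 = 1 - a\<^sup>2" "sin v ^ 2 = 1 - b\<^sup>2"
      using ab by (simp_all add: sin_squared_eq)
    have "(sin u * sin v)\<^sup>2 = (1 - a\<^sup>2) * (1 - b\<^sup>2)"
      using s by (simp add: power_mult_distrib)
    then have "cos (u + v) * cos (u - v) = a\<^sup>2 * b\<^sup>2 - (1 - a\<^sup>2) * (1 - b\<^sup>2)"
      unfolding cos_add cos_diff ab[symmetric] by (simp add: algebra_simps power2_eq_square)
    then have prod: "cos (u + v) * cos (u - v) = a\<^sup>2 + b\<^sup>2 - 1"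
      by (simp add: algebra_simps)
    have sum: "cos (u + v) + cos (u - v) = 2 * a * b"
      unfolding cos_add cos_diff ab[symmetric] by simp
    have "(1 - 2 * r * cos (u + v) + r\<^sup>2) * (1 - 2 * r * cos (u - v) + r\<^sup>2)
      = (1 + r\<^sup>2)\<^sup>2 - 2 * r * (1 + r\<^sup>2) * (cos (u + v) + cos (u - v)) + 4 * r\<^sup>2 * (cos (u + v) * cos (u - v))"
      by (simp add: algebra_simps power2_eq_square)
    then show ?thesis
      unfolding prod sum by (simp add: algebra_simps power2_eq_square)
  qed
  finally show ?thesis .
qed

section \<open>Logarithms of the Mehler products for |q| < 1\<close>

context
  fixes q :: real
  assumes q: "\<bar>q\<bar> < 1"
begin

lemma q_lt_1: "q < 1" "0 < 1 - q" "q \<noteq> 1"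
  using q by auto

lemma q_pow: "\<bar>q ^ k\<bar> \<le> 1" "\<bar>q ^ k\<bar> = \<bar>q\<bar> ^ k"
  using q by (simp_all add: power_abs power_le_one)

text \<open>With \<open>x = 2 * a / sqrt (1 - q)\<close>,
  \<open>s = 2 * sqrt p * b / sqrt (1 - q)\<close> and \<open>r = sqrt p * q ^ k\<close> the
  denominator is the polynomial of \<open>mehler_poly_lower\<close>. Since
  \<open>\<bar>r\<bar> \<le> sqrt p\<close>, the bound is the same for all \<open>k\<close>.\<close>

lemma mehler_den_lower:
  assumes "mehler_dom q p s" "(1 - q) * x\<^sup>2 \<le> 4"
  shows "(1 - sqrt p) ^ 4 \<le> mehler_den q p s x k"
proof -
  note d = assms(1)[unfolded mehler_dom_def]
  define r where "r = sqrt p * q ^ k"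
  define a where "a = sqrt (1 - q) * x / 2"
  \<comment> \<open>At \<open>p = 0\<close> the domain condition gives \<open>s = 0\<close>, so
    \<open>2 * sqrt p * b = sqrt (1 - q) * s\<close> holds with \<open>b = 0\<close> too.\<close>
  define b where "b = (if p = 0 then 0 else sqrt (1 - q) * s / (2 * sqrt p))"
  have sp: "(sqrt p)\<^sup>2 = p" and sq: "(sqrt (1 - q))\<^sup>2 = 1 - q"
    using d q_lt_1 by auto
  have a2: "a\<^sup>2 = (1 - q) * x\<^sup>2 / 4"
    using sq by (simp add: a_def power_mult_distrib power_divide)
  have pb: "2 * sqrt p * b = sqrt (1 - q) * s"
    using d q_lt_1 by (auto simp: b_def mult_le_0_iff zero_le_mult_iff dest!: antisym[of "s\<^sup>2" 0])
  have "4 * p * b\<^sup>2 = (1 - q) * s\<^sup>2"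
  proof -
    have "(2 * sqrt p * b)\<^sup>2 = (sqrt (1 - q) * s)\<^sup>2" using pb by simp
    then show ?thesis using sp sq by (simp add: power_mult_distrib)
  qed
  note pb2 = this
  have "b\<^sup>2 \<le> 1"
  proof (cases "p = 0")
    case False
    then have "p > 0" using d by simp
    moreover have "4 * p * b\<^sup>2 \<le> 4 * p * 1" using pb2 d by simp
    ultimately show ?thesis by simp
  qed (simp add: b_def)
  then have b1: "\<bar>b\<bar> \<le> 1"
    by (simp add: abs_square_le_1)
  have a1: "\<bar>a\<bar> \<le> 1"
    using assms(2) a2 by (simp add: abs_square_le_1[symmetric])
  have r: "\<bar>r\<bar> \<le> sqrt p"
    unfolding r_def abs_mult using q_pow[of k] d by (simp add: mult_left_le)
  have "(1 - sqrt p) ^ 4 \<le> (1 - r\<^sup>2)\<^sup>2 - 4 * r * (1 + r\<^sup>2) * a * b + 4 * r\<^sup>2 * (a\<^sup>2 + b\<^sup>2)"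
    using r d a1 b1 by (intro mehler_poly_lower) auto
  also have "\<dots> = mehler_den q p s x k"
  proof -
    have r2: "r\<^sup>2 = p * q ^ (2 * k)"
      using sp by (simp add: r_def power_mult_distrib power_mult mult.commute)
    have "4 * r * a * b = q ^ k * (2 * a) * (2 * sqrt p * b)"
      by (simp add: r_def)
    also have "\<dots> = q ^ k * sqrt (1 - q) * x * (sqrt (1 - q) * s)"
      unfolding pb by (simp add: a_def)
    also have "\<dots> = (1 - q) * q ^ k * x * s"
      using sq by (simp add: power2_eq_square)
    finally have 1: "4 * r * a * b = (1 - q) * q ^ k * x * s" .
    have "4 * r\<^sup>2 * (a\<^sup>2 + b\<^sup>2) = q ^ (2 * k) * (p * (4 * a\<^sup>2) + 4 * p * b\<^sup>2)"
      unfolding r2 by (simp add: algebra_simps)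
    also have "\<dots> = (1 - q) * (p * x\<^sup>2 + s\<^sup>2) * q ^ (2 * k)"
      unfolding pb2 a2 by (simp add: field_simps)
    finally have 2: "4 * r\<^sup>2 * (a\<^sup>2 + b\<^sup>2) = (1 - q) * (p * x\<^sup>2 + s\<^sup>2) * q ^ (2 * k)" .
    have "4 * r * (1 + r\<^sup>2) * a * b = (1 + r\<^sup>2) * (4 * r * a * b)" by simp
    also have "\<dots> = (1 - q) * q ^ k * (1 + r\<^sup>2) * x * s" unfolding 1 by simp
    finally have 3: "4 * r * (1 + r\<^sup>2) * a * b = (1 - q) * q ^ k * (1 + r\<^sup>2) * x * s" .
    show ?thesis
      unfolding mehler_den_def 2 3 unfolding r2 ..
  qed
  finally show ?thesis .
qed

lemma mehler_den_pos:
  assumes "mehler_dom q p s" "(1 - q) * x\<^sup>2 \<le> 4"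
  shows "0 < mehler_den q p s x k"
proof -
  have "0 < (1 - sqrt p) ^ 4"
    using assms(1) by (auto simp: mehler_dom_def)
  then show ?thesis using mehler_den_lower[OF assms, of k] by linarith
qed

text \<open>The geometric mean of the two domain bounds for \<open>x\<close> and
  \<open>s\<close>.\<close>

lemma mehler_cross_le:
  assumes "mehler_dom q p s" "(1 - q) * x\<^sup>2 \<le> 4"
  shows "(1 - q) * \<bar>x * s\<bar> \<le> 4 * sqrt p"
proof (rule power2_le_imp_le)
  have p: "0 \<le> p" "(1 - q) * s\<^sup>2 \<le> 4 * p" using assms(1) by (auto simp: mehler_dom_def)
  have "((1 - q) * \<bar>x * s\<bar>)\<^sup>2 = ((1 - q) * x\<^sup>2) * ((1 - q) * s\<^sup>2)"
    by (simp add: power_mult_distrib power2_eq_square)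
  also have "\<dots> \<le> 4 * (4 * p)"
    by (rule mult_mono[OF assms(2) p(2)]) (use q_lt_1 in simp_all)
  also have "\<dots> = (4 * sqrt p)\<^sup>2"
    using p(1) by (simp add: power_mult_distrib)
  finally show "((1 - q) * \<bar>x * s\<bar>)\<^sup>2 \<le> (4 * sqrt p)\<^sup>2" .
  show "0 \<le> 4 * sqrt p" using p(1) by simp
qed

text \<open>Once the leading part of the cross term is removed, everything carries the factor
  \<open>q ^ (2 * k)\<close> and is of order \<open>p\<close>, hence quadratic in
  \<open>\<rho>\<close>. The constant adds up the bounds of the five summands in the bracket:
  \<open>2 + 1 + 4 + 4 + 4 = 15\<close>.\<close>

lemma mehler_den_diff:
  assumes "mehler_dom q p s" "(1 - q) * x\<^sup>2 \<le> 4"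
  shows "\<bar>mehler_den q p s x k - 1 + (1 - q) * q ^ k * x * s\<bar> \<le> 15 * p * \<bar>q\<bar> ^ k"
proof -
  note d = assms(1)[unfolded mehler_dom_def]
  define w where "w = q ^ k"
  have w: "\<bar>w\<bar> \<le> 1" "\<bar>w\<bar> = \<bar>q\<bar> ^ k" using q_pow by (auto simp: w_def)
  have ww: "q ^ (2 * k) = w\<^sup>2" by (simp add: w_def power_mult mult.commute)
  have w2: "w\<^sup>2 \<le> \<bar>w\<bar>"
    using w by (metis abs_ge_zero mult_left_le power2_abs power2_eq_square)
  have e: "mehler_den q p s x k - 1 + (1 - q) * q ^ k * x * s
     = w\<^sup>2 * (- 2 * p + p\<^sup>2 * w\<^sup>2 - p * w * ((1 - q) * (x * s)) + p * ((1 - q) * x\<^sup>2) + (1 - q) * s\<^sup>2)"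
    unfolding mehler_den_def ww w_def[symmetric] by (simp add: algebra_simps power2_eq_square)
  have p2: "p\<^sup>2 \<le> p" using d by (simp add: power2_eq_square mult_left_le)
  have "p\<^sup>2 * w\<^sup>2 \<le> p" using p2 w w2 d by (smt (verit) mult_left_le zero_le_power2)
  moreover have "0 \<le> p\<^sup>2 * w\<^sup>2" by simp
  moreover have "\<bar>p * w * ((1 - q) * (x * s))\<bar> \<le> p * 4"
  proof -
    have "(1 - q) * \<bar>x * s\<bar> \<le> 4 * 1"
      using mehler_cross_le[OF assms] d by (smt (verit) real_sqrt_le_1_iff)
    then have "\<bar>w\<bar> * ((1 - q) * \<bar>x * s\<bar>) \<le> 1 * 4"
      using w q_lt_1 by (intro mult_mono) auto
    then show ?thesis
      using d q_lt_1 by (simp add: abs_mult mult.assoc mult_left_mono)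
  qed
  moreover have "p * ((1 - q) * x\<^sup>2) \<le> p * 4" using assms d by (intro mult_left_mono) auto
  moreover have "0 \<le> p * ((1 - q) * x\<^sup>2)" "0 \<le> (1 - q) * s\<^sup>2" using d q_lt_1 by auto
  ultimately have "\<bar>- 2 * p + p\<^sup>2 * w\<^sup>2 - p * w * ((1 - q) * (x * s)) + p * ((1 - q) * x\<^sup>2) + (1 - q) * s\<^sup>2\<bar> \<le> 15 * p"
    using d by (intro abs_leI; linarith)
  then have "w\<^sup>2 * \<bar>- 2 * p + p\<^sup>2 * w\<^sup>2 - p * w * ((1 - q) * (x * s)) + p * ((1 - q) * x\<^sup>2) + (1 - q) * s\<^sup>2\<bar> \<le> \<bar>w\<bar> * (15 * p)"
    using w2 by (intro mult_mono) auto
  then show ?thesis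
    unfolding e abs_mult w(2)[symmetric] by (simp add: mult.commute)
qed

lemma abs_ln_le:
  fixes u d :: real
  assumes "0 < d" "d \<le> 1" "d \<le> u"
  shows "\<bar>ln u\<bar> \<le> \<bar>u - 1\<bar> / d"
proof -
  have u: "0 < u" using assms by linarith
  have "ln u \<le> u - 1" using u by (rule ln_le_minus_one)
  moreover have "u - 1 \<le> \<bar>u - 1\<bar> / d"
  proof -
    have "d * \<bar>u - 1\<bar> \<le> \<bar>u - 1\<bar>" using assms by (intro mult_left_le_one_le) auto
    then have "\<bar>u - 1\<bar> \<le> \<bar>u - 1\<bar> / d" using assms by (simp add: pos_le_divide_eq mult.commute)
    then show ?thesis by linarith
  qed
  moreover have "- ln u \<le> \<bar>u - 1\<bar> / d"
  proof -
    have "- ln u = ln (1 / u)" using u by (simp add: ln_div)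
    also have "\<dots> \<le> 1 / u - 1" using u by (intro ln_le_minus_one) auto
    also have "\<dots> = (1 - u) / u" using u by (simp add: field_simps)
    also have "\<dots> \<le> \<bar>u - 1\<bar> / u" using u by (intro divide_right_mono) auto
    also have "\<dots> \<le> \<bar>u - 1\<bar> / d" using assms by (intro divide_left_mono) auto
    finally show ?thesis .
  qed
  ultimately show ?thesis by linarith
qed

text \<open>The constant is \<open>15 + 4\<close> for the denominator, from
  \<open>mehler_den_diff\<close> and the cross term, plus 1 for \<open>ln (1 - p * q ^ k)\<close>.
  It is uniform over all \<open>p \<le> p0\<close>, so one geometric series dominates along a
  convergent sequence of parameters.\<close>

lemma mehler_ln_bound:
  assumes "mehler_dom q p s" "(1 - q) * x\<^sup>2 \<le> 4" "p \<le> p0" "p0 < 1"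
  shows "\<bar>mehler_ln q p s x k\<bar> \<le> 20 / (1 - sqrt p0) ^ 4 * \<bar>q\<bar> ^ k"
proof -
  note d = assms(1)[unfolded mehler_dom_def]
  let ?d = "(1 - sqrt p0) ^ 4"
  have p0: "0 \<le> p0" "0 \<le> sqrt p0" "sqrt p0 < 1" using d assms by auto
  have d0: "0 < ?d" "?d \<le> 1" using p0 by (auto intro!: power_le_one)
  have "?d \<le> (1 - sqrt p) ^ 4" using assms p0 by (intro power_mono) auto
  then have den: "?d \<le> mehler_den q p s x k" using mehler_den_lower[OF assms(1,2), of k] by linarith
  have "\<bar>mehler_den q p s x k - 1\<bar> \<le> 19 * \<bar>q\<bar> ^ k"
  proof -
    have "\<bar>(1 - q) * q ^ k * x * s\<bar> = \<bar>q\<bar> ^ k * ((1 - q) * \<bar>x * s\<bar>)"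
      using q_lt_1 by (simp add: abs_mult power_abs)
    also have "\<dots> \<le> \<bar>q\<bar> ^ k * 4"
      using mehler_cross_le[OF assms(1,2)] d by (intro mult_left_mono) (smt (verit) real_sqrt_le_1_iff, simp)
    finally have "\<bar>(1 - q) * q ^ k * x * s\<bar> \<le> 4 * \<bar>q\<bar> ^ k" by simp
    moreover have "15 * p * \<bar>q\<bar> ^ k \<le> 15 * 1 * \<bar>q\<bar> ^ k" using d by (intro mult_right_mono) auto
    ultimately show ?thesis using mehler_den_diff[OF assms(1,2), of k] by linarith
  qed
  then have 1: "\<bar>ln (mehler_den q p s x k)\<bar> \<le> 19 * \<bar>q\<bar> ^ k / ?d"
    using abs_ln_le[OF d0 den] d0 by (smt (verit) divide_right_mono)
  have "?d \<le> 1 - p * q ^ k"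
  proof -
    have "?d \<le> 1 - sqrt p0"
      using p0 power_decreasing[of 1 4 "1 - sqrt p0"] by simp
    also have "\<dots> \<le> 1 - p0" using p0 by (simp add: real_le_rsqrt power2_eq_square mult_left_le)
    also have "\<dots> \<le> 1 - p * q ^ k"
    proof -
      have "p * q ^ k \<le> p * 1" using q_pow[of k] d by (intro mult_left_mono) auto
      then show ?thesis using assms by simp
    qed
    finally show ?thesis .
  qed
  then have "\<bar>ln (1 - p * q ^ k)\<bar> \<le> \<bar>(1 - p * q ^ k) - 1\<bar> / ?d"
    by (intro abs_ln_le d0)
  also have "\<dots> \<le> 1 * \<bar>q\<bar> ^ k / ?d"
    using d d0 by (intro divide_right_mono) (auto simp: abs_mult power_abs intro!: mult_left_le_one_le)
  finally have 2: "\<bar>ln (1 - p * q ^ k)\<bar> \<le> 1 * \<bar>q\<bar> ^ k / ?d" .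
  have "\<bar>mehler_ln q p s x k\<bar> \<le> 1 * \<bar>q\<bar> ^ k / ?d + 19 * \<bar>q\<bar> ^ k / ?d"
    unfolding mehler_ln_def using 1 2 by linarith
  then show ?thesis by (simp add: add_divide_distrib[symmetric])
qed

lemma summable_q: "summable (\<lambda>k. C * \<bar>q\<bar> ^ k)"
  using q by (intro summable_mult summable_geometric) auto

lemma summable_mehler_ln:
  assumes "mehler_dom q p s" "(1 - q) * x\<^sup>2 \<le> 4"
  shows "summable (mehler_ln q p s x)"
proof (rule summable_comparison_test'[OF summable_q])
  show "norm (mehler_ln q p s x k) \<le> 20 / (1 - sqrt p) ^ 4 * \<bar>q\<bar> ^ k" for k
    using mehler_ln_bound[OF assms order_refl, of k] assms(1) by (simp add: mehler_dom_def)
qed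

lemma mehler_sum_bound:
  assumes "mehler_dom q p s" "(1 - q) * x\<^sup>2 \<le> 4" "p \<le> p0" "p0 < 1"
  shows "(\<Sum>k. mehler_ln q p s x k) \<le> 20 / (1 - sqrt p0) ^ 4 / (1 - \<bar>q\<bar>)"
proof -
  have "(\<Sum>k. mehler_ln q p s x k) \<le> (\<Sum>k. 20 / (1 - sqrt p0) ^ 4 * \<bar>q\<bar> ^ k)"
    using mehler_ln_bound[OF assms]
    by (intro suminf_le summable_mehler_ln[OF assms(1,2)] summable_q) (auto simp: abs_le_iff)
  also have "\<dots> = 20 / (1 - sqrt p0) ^ 4 / (1 - \<bar>q\<bar>)"
    using q by (subst suminf_mult) (auto simp: suminf_geometric summable_geometric)
  finally show ?thesis .
qed

lemma mehler_sum_tendsto: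
  assumes "\<And>n. mehler_dom q (p n) (s n)" "mehler_dom q p' s'" "(1 - q) * x\<^sup>2 \<le> 4"
    and "p \<longlonglongrightarrow> p'" "s \<longlonglongrightarrow> s'"
  shows "(\<lambda>n. \<Sum>k. mehler_ln q (p n) (s n) x k) \<longlonglongrightarrow> (\<Sum>k. mehler_ln q p' s' x k)"
proof -
  have p': "p' < 1" "0 \<le> p'" using assms(2) by (auto simp: mehler_dom_def)
  \<comment> \<open>A bound strictly between \<open>p'\<close> and 1, so that \<open>p n\<close>
    eventually stays below it and the majorant of \<open>mehler_ln_bound\<close> applies.\<close>
  define p0 where "p0 = (1 + p') / 2"
  have p0: "p' < p0" "p0 < 1" using p' by (auto simp: p0_def)
  have ev: "\<forall>\<^sub>F n in sequentially. p n < p0"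
    using order_tendstoD(2)[OF assms(4) p0(1)] .
  note T = tannerys_theorem[where M="\<lambda>k. 20 / (1 - sqrt p0) ^ 4 * \<bar>q\<bar> ^ k" and F=sequentially
    and a="\<lambda>k n. mehler_ln q (p n) (s n) x k" and b="mehler_ln q p' s' x", THEN conjunct2, THEN conjunct2]
  show ?thesis
  proof (rule T)
    fix k
    have "p' * q ^ k \<le> p' * 1" using q_pow[of k] p' by (intro mult_left_mono) auto
    then have 1: "(\<lambda>n. ln (1 - p n * q ^ k)) \<longlonglongrightarrow> ln (1 - p' * q ^ k)"
      using p' by (intro tendsto_intros assms) auto
    have 2: "(\<lambda>n. mehler_den q (p n) (s n) x k) \<longlonglongrightarrow> mehler_den q p' s' x k"
      unfolding mehler_den_def by (intro tendsto_intros assms)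
    show "(\<lambda>n. mehler_ln q (p n) (s n) x k) \<longlonglongrightarrow> mehler_ln q p' s' x k"
      unfolding mehler_ln_def using mehler_den_pos[OF assms(2,3), of k]
      by (intro tendsto_diff 1 tendsto_ln 2) auto
  next
    show "\<forall>\<^sub>F (k, n) in sequentially \<times>\<^sub>F sequentially.
       norm (mehler_ln q (p n) (s n) x k) \<le> 20 / (1 - sqrt p0) ^ 4 * \<bar>q\<bar> ^ k"
      unfolding case_prod_beta
      by (rule eventually_prod2[THEN iffD2, THEN eventually_mono, OF _ ev])
         (use mehler_ln_bound[OF assms(1,3) less_imp_le p0(2)] in auto)
  qed (rule summable_q, simp)
qed


section \<open>Infinite products as exponentials, and the given densities in terms of
  \<open>kern\<close>\<close>

lemma ln_fac_bound:
  assumes "0 \<le> p" "p < 1"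
  shows "\<bar>ln (1 - p * q ^ k)\<bar> \<le> p / (1 - p) * \<bar>q\<bar> ^ k" "0 < 1 - p * q ^ k"
proof -
  have "p * q ^ k \<le> p * 1" using q_pow[of k] assms by (intro mult_left_mono) auto
  then have *: "1 - p \<le> 1 - p * q ^ k" by simp
  then show "0 < 1 - p * q ^ k" using assms by simp
  have "\<bar>ln (1 - p * q ^ k)\<bar> \<le> \<bar>(1 - p * q ^ k) - 1\<bar> / (1 - p)"
    using assms * by (intro abs_ln_le) auto
  then show "\<bar>ln (1 - p * q ^ k)\<bar> \<le> p / (1 - p) * \<bar>q\<bar> ^ k"
    using assms by (simp add: abs_mult power_abs)
qed

lemma summable_ln_fac:
  assumes "0 \<le> p" "p < 1"
  shows "summable (\<lambda>k. ln (1 - p * q ^ k))"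
proof (rule summable_comparison_test'[OF summable_q])
  show "norm (ln (1 - p * q ^ k)) \<le> p / (1 - p) * \<bar>q\<bar> ^ k" for k
    using ln_fac_bound[OF assms, of k] by simp
qed

lemma summable_ln_den:
  assumes "mehler_dom q p s" "(1 - q) * x\<^sup>2 \<le> 4"
  shows "summable (\<lambda>k. ln (mehler_den q p s x k))"
  using summable_diff[OF summable_ln_fac summable_mehler_ln[OF assms], of p] assms(1)
  by (simp add: mehler_ln_def mehler_dom_def)

lemma has_prod_exp_ln:
  fixes f :: "nat \<Rightarrow> real"
  assumes "\<And>k. 0 < f k" "summable (\<lambda>k. ln (f k))"
  shows "f has_prod exp (\<Sum>k. ln (f k))"
  using sums_imp_has_prod_exp[OF summable_sums[OF assms(2)]] assms(1)
  by (simp add: has_prod_def)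

lemma qpoch_eq:
  assumes "0 \<le> p" "p < 1"
  shows "qpoch p q = exp (\<Sum>k. ln (1 - p * q ^ k))"
  unfolding qpoch_def
  using has_prod_exp_ln[OF ln_fac_bound(2)[OF assms] summable_ln_fac[OF assms]]
  by (rule has_prod_unique[symmetric])

lemma mehler_den_has_prod:
  assumes "mehler_dom q p s" "(1 - q) * x\<^sup>2 \<le> 4"
  shows "mehler_den q p s x has_prod exp (\<Sum>k. ln (mehler_den q p s x k))"
  by (intro has_prod_exp_ln mehler_den_pos summable_ln_den assms)

lemma mehler_num_convergent:
  assumes "(1 - q) * x\<^sup>2 \<le> 4"
  shows "convergent_prod (\<lambda>k. (1 + q ^ k)\<^sup>2 - (1 - q) * x\<^sup>2 * q ^ k)"
proof -
  have "norm ((1 + q ^ k)\<^sup>2 - (1 - q) * x\<^sup>2 * q ^ k - 1) \<le> 7 * \<bar>q\<bar> ^ k" for k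
  proof -
    have e: "(1 + q ^ k)\<^sup>2 - (1 - q) * x\<^sup>2 * q ^ k - 1 = q ^ k * (2 + q ^ k - (1 - q) * x\<^sup>2)"
      by (simp add: algebra_simps power2_eq_square)
    have "0 \<le> (1 - q) * x\<^sup>2" using q_lt_1 by simp
    then have "\<bar>2 + q ^ k - (1 - q) * x\<^sup>2\<bar> \<le> 7"
      using q_pow(1)[of k] assms by (intro abs_leI; linarith)
    then have "\<bar>q ^ k\<bar> * \<bar>2 + q ^ k - (1 - q) * x\<^sup>2\<bar> \<le> \<bar>q ^ k\<bar> * 7"
      by (intro mult_left_mono) auto
    then show ?thesis unfolding e real_norm_def abs_mult q_pow(2) by simp
  qed
  then have "summable (\<lambda>k. norm ((1 + q ^ k)\<^sup>2 - (1 - q) * x\<^sup>2 * q ^ k - 1))"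
    by (intro summable_comparison_test'[OF summable_q]) auto
  then show ?thesis
    by (intro abs_convergent_prod_imp_convergent_prod summable_imp_abs_convergent_prod)
qed

text \<open>The numerators may vanish (at an end point of the support the factor with
  \<open>k = 0\<close> does), so their product stays untouched inside \<open>f_N\<close>. The
  denominators are positive, so their product is an exponential and can be split off.\<close>

lemma f_CN_eq_kern_lt_1:
  assumes y: "y \<in> S_q q" and r: "\<bar>\<rho>\<bar> < 1"
  shows "mehler_dom q (\<rho>\<^sup>2) (\<rho> * y)" "f_CN q \<rho> y x = kern q (\<rho>\<^sup>2) (\<rho> * y) x"
proof -
  have r2: "0 \<le> \<rho>\<^sup>2" "\<rho>\<^sup>2 < 1" using r by (auto simp: abs_square_less_1)
  have "\<rho>\<^sup>2 * ((1 - q) * y\<^sup>2) \<le> \<rho>\<^sup>2 * 4"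
    using y q_lt_1 by (intro mult_left_mono) (auto simp: S_q_iff)
  then show d: "mehler_dom q (\<rho>\<^sup>2) (\<rho> * y)"
    using r2 by (simp add: mehler_dom_def power_mult_distrib mult_ac)
  show "f_CN q \<rho> y x = kern q (\<rho>\<^sup>2) (\<rho> * y) x"
  proof (cases "(1 - q) * x\<^sup>2 \<le> 4")
    case False
    then show ?thesis using q_lt_1 by (simp add: f_CN_def kern_def S_q_iff)
  next
    case x: True
    define N where "N = (\<lambda>k. (1 + q ^ k)\<^sup>2 - (1 - q) * x\<^sup>2 * q ^ k)"
    have N: "N has_prod prodinf N"
      unfolding N_def using mehler_num_convergent[OF x] by blast
    have den: "(1 - \<rho>\<^sup>2 * q ^ (2 * k))\<^sup>2
        - (1 - q) * \<rho> * q ^ k * (1 + \<rho>\<^sup>2 * q ^ (2 * k)) * x * y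
        + (1 - q) * \<rho>\<^sup>2 * (x\<^sup>2 + y\<^sup>2) * q ^ (2 * k) = mehler_den q (\<rho>\<^sup>2) (\<rho> * y) x k" for k
      unfolding mehler_den_def by (simp add: algebra_simps power_mult_distrib)
    have "(\<lambda>k. N k / mehler_den q (\<rho>\<^sup>2) (\<rho> * y) x k) has_prod
       (prodinf N / exp (\<Sum>k. ln (mehler_den q (\<rho>\<^sup>2) (\<rho> * y) x k)))"
      by (intro has_prod_divide N mehler_den_has_prod d x)
    then have 1: "(\<Prod>k. N k / mehler_den q (\<rho>\<^sup>2) (\<rho> * y) x k)
       = prodinf N / exp (\<Sum>k. ln (mehler_den q (\<rho>\<^sup>2) (\<rho> * y) x k))"
      by (rule has_prod_unique[symmetric])
    have 2: "exp (\<Sum>k. mehler_ln q (\<rho>\<^sup>2) (\<rho> * y) x k)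
      = qpoch (\<rho>\<^sup>2) q / exp (\<Sum>k. ln (mehler_den q (\<rho>\<^sup>2) (\<rho> * y) x k))"
      unfolding mehler_ln_def qpoch_eq[OF r2] exp_diff[symmetric]
      by (subst suminf_diff[OF summable_ln_fac[OF r2] summable_ln_den[OF d x]]) simp
    show ?thesis
      using q_lt_1 x d unfolding f_CN_def kern_def f_N_def den N_def[symmetric] 2
      by (simp add: S_q_iff 1[unfolded N_def] N_def)
  qed
qed

lemma mehler_ln_0: "mehler_ln q 0 0 x = (\<lambda>_. 0)"
  by (simp add: mehler_ln_def mehler_den_def fun_eq_iff)

lemma f_N_eq_kern_lt_1: "f_N q x = kern q 0 0 x"
  using q_lt_1 by (simp add: kern_def mehler_ln_0 mehler_dom_def f_N_def S_q_iff)

section \<open>Sign, reflection, shift and small-correlation expansion of the densities\<close>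

lemma f_N_nonneg: "0 \<le> f_N q x"
proof (cases "(1 - q) * x\<^sup>2 \<le> 4")
  case x: True
  have "0 \<le> qpoch q q"
  proof -
    have "norm (1 - q * q ^ k - 1) \<le> 1 * \<bar>q\<bar> ^ k" for k
      using q by (simp add: abs_mult power_abs mult_left_le_one_le)
    then have "summable (\<lambda>k. norm (1 - q * q ^ k - 1))"
      by (intro summable_comparison_test'[OF summable_q[of 1]]) auto
    then have "convergent_prod (\<lambda>k. 1 - q * q ^ k)"
      by (intro abs_convergent_prod_imp_convergent_prod summable_imp_abs_convergent_prod)
    then have "(\<lambda>k. 1 - q * q ^ k) has_prod qpoch q q"
      unfolding qpoch_def by blast
    moreover have "0 \<le> 1 - q * q ^ k" for k
      using q_pow(1)[of "Suc k"] by (simp add: abs_le_iff)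
    ultimately show ?thesis by (rule has_prod_nonneg)
  qed
  moreover have "0 \<le> (\<Prod>k. (1 + q ^ k)\<^sup>2 - (1 - q) * x\<^sup>2 * q ^ k)"
  proof (rule has_prod_nonneg)
    show "(\<lambda>k. (1 + q ^ k)\<^sup>2 - (1 - q) * x\<^sup>2 * q ^ k) has_prod
       (\<Prod>k. (1 + q ^ k)\<^sup>2 - (1 - q) * x\<^sup>2 * q ^ k)"
      using mehler_num_convergent[OF x] by blast
    show "0 \<le> (1 + q ^ k)\<^sup>2 - (1 - q) * x\<^sup>2 * q ^ k" for k
    \<comment> \<open>By \<open>(1 - q) * x\<^sup>2 \<le> 4\<close> the factor is at least
      \<open>(1 - q ^ k)\<^sup>2\<close> for \<open>q ^ k \<ge> 0\<close>; otherwise it is at least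
      \<open>(1 + q ^ k)\<^sup>2\<close>.\<close>
    proof (cases "q ^ k \<ge> 0")
      case True
      then have "(1 - q) * x\<^sup>2 * q ^ k \<le> 4 * q ^ k" using x by (intro mult_right_mono) auto
      moreover have "(1 + q ^ k)\<^sup>2 - 4 * q ^ k = (1 - q ^ k)\<^sup>2" by (simp add: power2_eq_square algebra_simps)
      moreover have "0 \<le> (1 - q ^ k)\<^sup>2" by simp
      ultimately show ?thesis by linarith
    next
      case False
      then have "(1 - q) * x\<^sup>2 * q ^ k \<le> 0" using q_lt_1 by (simp add: mult_nonneg_nonpos)
      then show ?thesis by (smt (verit) zero_le_power2)
    qed
  qed
  moreover have "0 \<le> sqrt (4 - (1 - q) * x\<^sup>2)" using x by simp
  ultimately show ?thesis
    using q_lt_1 by (simp add: f_N_def indicator_def)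
qed (use q_lt_1 in \<open>simp add: f_N_def S_q_iff\<close>)

lemma f_N_outside: "\<not> (1 - q) * x\<^sup>2 \<le> 4 \<Longrightarrow> f_N q x = 0"
  using q_lt_1 by (simp add: f_N_def S_q_iff)

lemma f_N_even: "f_N q (- x) = f_N q x"
proof -
  have "- x \<in> S_q q \<longleftrightarrow> x \<in> S_q q" using q_lt_1 by (simp add: S_q_iff)
  then show ?thesis using q_lt_1 by (simp add: f_N_def indicator_def)
qed

text \<open>The recursion replaces \<open>\<rho>\<close> by \<open>\<rho> * q\<close>, which is
  negative for \<open>q < 0\<close>, whereas the process provides positive correlations only.
  Reflection reduces negative ones to these.\<close>

lemma kern_minus: "kern q p (- s) x = kern q p s (- x)"
proof -
  have "mehler_ln q p (- s) x = mehler_ln q p s (- x)"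
    by (simp add: mehler_ln_def mehler_den_def fun_eq_iff)
  then show ?thesis using q_lt_1 by (simp add: kern_def f_N_even mehler_dom_def)
qed

text \<open>Replacing \<open>\<rho>\<close> by \<open>\<rho> * q\<close> shifts the index of the infinite product.\<close>

lemma kern_shift:
  assumes d: "mehler_dom q p s"
  shows "mehler_dom q (p * q\<^sup>2) (s * q)"
    "kern q p s x * mehler_den q p s x 0 = (1 - p) * (1 - p * q) * kern q (p * q\<^sup>2) (s * q) x"
proof -
  have p: "0 \<le> p" "p < 1" using d by (auto simp: mehler_dom_def)
  have q2: "q\<^sup>2 \<le> 1" using q by (simp add: abs_square_le_1 less_imp_le)
  show d': "mehler_dom q (p * q\<^sup>2) (s * q)"
  proof -
    have "p * q\<^sup>2 \<le> p" using p q2 by (simp add: mult_left_le)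
    moreover have "q\<^sup>2 * ((1 - q) * s\<^sup>2) \<le> q\<^sup>2 * (4 * p)"
      using d by (intro mult_left_mono) (auto simp: mehler_dom_def)
    ultimately show ?thesis using p unfolding mehler_dom_def by (simp add: power_mult_distrib mult_ac)
  qed
  show "kern q p s x * mehler_den q p s x 0 = (1 - p) * (1 - p * q) * kern q (p * q\<^sup>2) (s * q) x"
  proof (cases "(1 - q) * x\<^sup>2 \<le> 4")
    case x: True
    let ?a = "\<lambda>k. ln (1 - p * q ^ k)" and ?b = "\<lambda>k. ln (mehler_den q p s x k)"
    have sa: "summable ?a" and sb: "summable ?b"
      using summable_ln_fac[OF p] summable_ln_den[OF d x] by auto
    \<comment> \<open>The denominators move by one index, the factors \<open>1 - p * q ^ k\<close>
      by two, because \<open>p\<close> gains the factor \<open>q\<^sup>2\<close> and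
      \<open>s\<close> only \<open>q\<close>. The initial terms lost in this way are the prefactors
      of the claim.\<close>
    have "mehler_ln q (p * q\<^sup>2) (s * q) x k = ?a (k + 2) - ?b (k + 1)" for k
      unfolding mehler_ln_def mehler_den_def
      by (simp add: power_add power_mult power_mult_distrib power2_eq_square algebra_simps)
    then have "(\<Sum>k. mehler_ln q (p * q\<^sup>2) (s * q) x k) = (\<Sum>k. ?a (k + 2) - ?b (k + 1))"
      by simp
    also have "\<dots> = (\<Sum>k. ?a (k + 2)) - (\<Sum>k. ?b (k + 1))"
      using summable_ignore_initial_segment[OF sa] summable_ignore_initial_segment[OF sb]
      by (intro suminf_diff[symmetric])
    also have "\<dots> = (suminf ?a - ?a 0 - ?a 1) - (suminf ?b - ?b 0)"
      using suminf_split_initial_segment[OF sa, of 2] suminf_split_initial_segment[OF sb, of 1]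
      by (simp add: numeral_2_eq_2)
    also have "\<dots> = (\<Sum>k. mehler_ln q p s x k) - ?a 0 - ?a 1 + ?b 0"
      using suminf_diff[OF sa sb] by (simp add: mehler_ln_def)
    finally have e: "(\<Sum>k. mehler_ln q (p * q\<^sup>2) (s * q) x k) = (\<Sum>k. mehler_ln q p s x k) - ?a 0 - ?a 1 + ?b 0" .
    have "exp (\<Sum>k. mehler_ln q (p * q\<^sup>2) (s * q) x k)
       = exp (\<Sum>k. mehler_ln q p s x k) / (1 - p) / (1 - p * q) * mehler_den q p s x 0"
      unfolding e exp_diff exp_add
      using ln_fac_bound(2)[OF p, of 0] ln_fac_bound(2)[OF p, of 1] mehler_den_pos[OF d x, of 0]
      by (simp add: exp_ln)
    moreover have "1 - p \<noteq> 0" "1 - p * q \<noteq> 0"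
      using ln_fac_bound(2)[OF p, of 0] ln_fac_bound(2)[OF p, of 1] by auto
    ultimately show ?thesis
      using d d' x q_lt_1 by (simp add: kern_def)
  qed (use q_lt_1 in \<open>simp add: kern_def\<close>)
qed

text \<open>To first order the logarithm is the sum of the cross terms,
  \<open>\<rho> * x * y * (1 - q) * (\<Sum>k. q ^ k) = \<rho> * x * y\<close>. The remaining terms
  are of order \<open>\<rho>\<^sup>2\<close>, uniformly on the support.\<close>

lemma mehler_expansion:
  obtains C \<epsilon> where "0 < \<epsilon>" "\<epsilon> < 1"
    "\<And>\<rho> x y. 0 < \<rho> \<Longrightarrow> \<rho> < \<epsilon> \<Longrightarrow> (1 - q) * x\<^sup>2 \<le> 4 \<Longrightarrow> (1 - q) * y\<^sup>2 \<le> 4 \<Longrightarrow>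
       \<bar>exp (\<Sum>k. mehler_ln q (\<rho>\<^sup>2) (\<rho> * y) x k) - 1 - \<rho> * x * y\<bar> \<le> C * \<rho>\<^sup>2"
proof -
  \<comment> \<open>Here \<open>739 = 15 + 2 * 19\<^sup>2 + 2\<close>: the remainder of
    \<open>mehler_den_diff\<close>, the quadratic error of the logarithm for
    \<open>\<bar>u\<bar> \<le> 19 * \<rho> * w\<close>, and
    \<open>ln (1 - \<rho>\<^sup>2 * q ^ k)\<close>. The geometric series contributes
    \<open>1 / (1 - \<bar>q\<bar>)\<close>.\<close>
  define K where "K = 739 / (1 - \<bar>q\<bar>)"
  define A where "A = 4 / (1 - q)"
  have KA: "0 \<le> K" "0 < A" using q q_lt_1 by (auto simp: K_def A_def)
  \<comment> \<open>Small enough for both expansions: \<open>\<epsilon> \<le> 1 / 38\<close> gives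
    \<open>\<bar>u\<bar> \<le> 1 / 2\<close> for the logarithm, and
    \<open>\<epsilon> * (A + K) \<le> 1 / 2\<close> gives \<open>\<bar>Z\<bar> \<le> 1 / 2\<close>
    for the exponential. The number \<open>A\<close> bounds
    \<open>\<bar>x * y\<bar>\<close>.\<close>
  define \<epsilon> where "\<epsilon> = 1 / (2 * (A + K) + 38)"
  have e: "0 < \<epsilon>" "\<epsilon> \<le> 1 / 38" "\<epsilon> * (A + K) \<le> 1 / 2"
    using KA by (auto simp: \<epsilon>_def field_simps)
  have main: "\<bar>exp (\<Sum>k. mehler_ln q (\<rho>\<^sup>2) (\<rho> * y) x k) - 1 - \<rho> * x * y\<bar> \<le> (2 * (A + K)\<^sup>2 + K) * \<rho>\<^sup>2"
    if r: "0 < \<rho>" "\<rho> < \<epsilon>" and x: "(1 - q) * x\<^sup>2 \<le> 4" and y: "(1 - q) * y\<^sup>2 \<le> 4" for \<rho> x y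
  proof -
    define Z where "Z = (\<Sum>k. mehler_ln q (\<rho>\<^sup>2) (\<rho> * y) x k)"
    have r1: "\<rho> \<le> 1 / 38" using r e by linarith
    have rr: "\<rho>\<^sup>2 \<le> \<rho>" "\<rho>\<^sup>2 \<le> 1/2"
    proof -
      show *: "\<rho>\<^sup>2 \<le> \<rho>" using r r1 by (simp add: power2_eq_square mult_left_le)
      show "\<rho>\<^sup>2 \<le> 1/2" using * r1 by linarith
    qed
    have d: "mehler_dom q (\<rho>\<^sup>2) (\<rho> * y)"
      using f_CN_eq_kern_lt_1(1)[of y \<rho>] y r r1 q_lt_1 by (simp add: S_q_iff)
    have xy: "(1 - q) * \<bar>x * (\<rho> * y)\<bar> \<le> 4 * \<rho>"
      using mehler_cross_le[OF d x] r by simp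
    have ln_term: "\<bar>mehler_ln q (\<rho>\<^sup>2) (\<rho> * y) x k - (1 - q) * (\<rho> * x * y) * q ^ k\<bar> \<le> 739 * \<rho>\<^sup>2 * \<bar>q\<bar> ^ k" for k
    proof -
      define u where "u = mehler_den q (\<rho>\<^sup>2) (\<rho> * y) x k - 1"
      define w where "w = \<bar>q\<bar> ^ k"
      have w: "0 \<le> w" "w \<le> 1" using q by (auto simp: w_def power_le_one)
      have u1: "\<bar>u + (1 - q) * (\<rho> * x * y) * q ^ k\<bar> \<le> 15 * \<rho>\<^sup>2 * w"
        using mehler_den_diff[OF d x, of k] by (simp add: u_def w_def mult_ac)
      have "\<bar>(1 - q) * (\<rho> * x * y) * q ^ k\<bar> = (1 - q) * \<bar>x * (\<rho> * y)\<bar> * w"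
        using q_lt_1 by (simp add: abs_mult power_abs w_def)
      also have "\<dots> \<le> 4 * \<rho> * w" using xy w by (intro mult_right_mono) auto
      finally have "\<bar>u\<bar> \<le> 4 * \<rho> * w + 15 * \<rho>\<^sup>2 * w" using u1 by linarith
      also have "\<dots> \<le> 4 * \<rho> * w + 15 * \<rho> * w" using rr w by (intro add_left_mono mult_right_mono) auto
      finally have u2: "\<bar>u\<bar> \<le> 19 * \<rho> * w" by simp
      also have "\<dots> \<le> 1 / 2"
        using mult_mono[of \<rho> "1/38" w 1] r r1 w by simp
      finally have "\<bar>ln (1 + u) - u\<bar> \<le> 2 * u\<^sup>2" by (rule abs_ln_one_plus_x_minus_x_bound)
      also have "u\<^sup>2 \<le> (19 * \<rho> * w)\<^sup>2" using u2 by (metis abs_ge_zero power2_abs power_mono)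
      also have "(19 * \<rho> * w)\<^sup>2 = 361 * \<rho>\<^sup>2 * (w * w)" by (simp add: power2_eq_square)
      also have "\<dots> \<le> 361 * \<rho>\<^sup>2 * w" using w by (intro mult_left_mono) (auto simp: mult_left_le)
      finally have u3: "\<bar>ln (1 + u) - u\<bar> \<le> 722 * \<rho>\<^sup>2 * w" by simp
      have "\<bar>ln (1 - \<rho>\<^sup>2 * q ^ k)\<bar> \<le> \<rho>\<^sup>2 / (1 - \<rho>\<^sup>2) * w"
        using ln_fac_bound(1)[of "\<rho>\<^sup>2" k] rr by (simp add: w_def)
      also have "\<dots> \<le> 2 * \<rho>\<^sup>2 * w"
      proof (rule mult_right_mono)
        have "\<rho>\<^sup>2 * (1 - \<rho>\<^sup>2) * 2 \<ge> \<rho>\<^sup>2 * (1/2) * 2" using rr by (intro mult_right_mono mult_left_mono) auto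
        then show "\<rho>\<^sup>2 / (1 - \<rho>\<^sup>2) \<le> 2 * \<rho>\<^sup>2" using rr by (simp add: pos_divide_le_eq mult_ac)
      qed (rule w)
      finally have "\<bar>ln (1 - \<rho>\<^sup>2 * q ^ k)\<bar> \<le> 2 * \<rho>\<^sup>2 * w" .
      then have "\<bar>mehler_ln q (\<rho>\<^sup>2) (\<rho> * y) x k - (1 - q) * (\<rho> * x * y) * q ^ k\<bar> \<le> 739 * \<rho>\<^sup>2 * w"
        using u1 u3 unfolding mehler_ln_def u_def by (simp add: abs_le_iff)
      then show ?thesis by (simp add: w_def)
    qed
    have "(\<lambda>k. (1 - q) * (\<rho> * x * y) * q ^ k) sums ((1 - q) * (\<rho> * x * y) * (1 / (1 - q)))"
      using q by (intro sums_mult geometric_sums) auto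
    then have s2: "(\<lambda>k. (1 - q) * (\<rho> * x * y) * q ^ k) sums (\<rho> * x * y)"
      using q_lt_1 by simp
    have s3: "(\<lambda>k. 739 * \<rho>\<^sup>2 * \<bar>q\<bar> ^ k) sums (739 * \<rho>\<^sup>2 * (1 / (1 - \<bar>q\<bar>)))"
      using q by (intro sums_mult geometric_sums) auto
    have s1: "(\<lambda>k. mehler_ln q (\<rho>\<^sup>2) (\<rho> * y) x k - (1 - q) * (\<rho> * x * y) * q ^ k) sums (Z - \<rho> * x * y)"
      unfolding Z_def by (intro sums_diff summable_sums summable_mehler_ln d x s2)
    have "\<bar>Z - \<rho> * x * y\<bar> \<le> 739 * \<rho>\<^sup>2 * (1 / (1 - \<bar>q\<bar>))"
      using norm_sums_le[OF s1 s3] ln_term by simp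
    then have Z1: "\<bar>Z - \<rho> * x * y\<bar> \<le> K * \<rho>\<^sup>2" by (simp add: K_def)
    have "\<bar>\<rho> * x * y\<bar> \<le> A * \<rho>"
      using xy q_lt_1 by (simp add: A_def abs_mult pos_le_divide_eq mult_ac)
    then have "\<bar>Z\<bar> \<le> A * \<rho> + K * \<rho>\<^sup>2" using Z1 by linarith
    also have "\<dots> \<le> A * \<rho> + K * \<rho>" using rr KA by (intro add_left_mono mult_left_mono) auto
    finally have Z2: "\<bar>Z\<bar> \<le> (A + K) * \<rho>" by (simp add: algebra_simps)
    also have "\<dots> \<le> (A + K) * \<epsilon>" using r KA by (intro mult_left_mono) auto
    finally have Z3: "\<bar>Z\<bar> \<le> 1 / 2" using e by (simp add: mult.commute)
    have "exp Z \<le> 1 / (1 - Z)"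
    proof -
      have "1 - Z \<le> exp (- Z)" using exp_ge_add_one_self[of "- Z"] by simp
      then show ?thesis using Z3 by (simp add: exp_minus field_simps)
    qed
    moreover have "1 / (1 - Z) = 1 + Z + Z\<^sup>2 / (1 - Z)" using Z3 by (simp add: field_simps power2_eq_square)
    moreover have "Z\<^sup>2 / (1 - Z) \<le> 2 * Z\<^sup>2"
    proof -
      have "Z\<^sup>2 * (1 - Z) * 2 \<ge> Z\<^sup>2 * (1/2) * 2" using Z3 by (intro mult_right_mono mult_left_mono) auto
      then show ?thesis using Z3 by (simp add: pos_divide_le_eq mult_ac)
    qed
    moreover have "1 + Z \<le> exp Z" by (rule exp_ge_add_one_self)
    moreover have "Z\<^sup>2 \<le> (A + K)\<^sup>2 * \<rho>\<^sup>2"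
      using Z2 power_mono[of "\<bar>Z\<bar>" "(A + K) * \<rho>" 2] by (simp add: power_mult_distrib)
    ultimately have "\<bar>exp Z - 1 - \<rho> * x * y\<bar> \<le> 2 * ((A + K)\<^sup>2 * \<rho>\<^sup>2) + K * \<rho>\<^sup>2"
      using Z1 by (intro abs_leI; linarith)
    then show ?thesis unfolding Z_def by (simp add: algebra_simps)
  qed
  show ?thesis
    by (rule that[OF _ _ main]) (use e in auto)
qed

lemma f_N_measurable [measurable]: "f_N q \<in> borel_measurable borel"
proof (rule borel_measurable_LIMSEQ_real)
  define u where "u = (\<lambda>n x. if (1 - q) * x\<^sup>2 \<le> 4 then sqrt (1 - q) * qpoch q q / (2 * pi * sqrt (4 - (1 - q) * x\<^sup>2))
      * (\<Prod>k\<le>n. (1 + q ^ k)\<^sup>2 - (1 - q) * x\<^sup>2 * q ^ k) else 0)"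
  show "(\<lambda>n. u n x) \<longlonglongrightarrow> f_N q x" for x
  proof (cases "(1 - q) * x\<^sup>2 \<le> 4")
    case True
    let ?c = "sqrt (1 - q) * qpoch q q / (2 * pi * sqrt (4 - (1 - q) * x\<^sup>2))"
    have "(\<lambda>n. ?c * (\<Prod>k\<le>n. (1 + q ^ k)\<^sup>2 - (1 - q) * x\<^sup>2 * q ^ k))
      \<longlonglongrightarrow> ?c * (\<Prod>k. (1 + q ^ k)\<^sup>2 - (1 - q) * x\<^sup>2 * q ^ k)"
      by (intro tendsto_mult tendsto_const convergent_prod_LIMSEQ mehler_num_convergent True)
    then show ?thesis
      using q_lt_1 True by (simp add: u_def f_N_def S_q_iff)
  qed (simp add: u_def f_N_outside)
  show "u n \<in> borel_measurable borel" for n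
    unfolding u_def by measurable
qed

end

text \<open>Later the parameters are random. For \<open>q < 1\<close> the case distinction in
  \<open>kern\<close> returns 0 outside the domain, so measurability holds with no condition on
  their values.\<close>

lemma kern_measurable [measurable (raw)]:
  assumes q: "-1 < q" "q \<le> 1"
    and [measurable]: "p \<in> borel_measurable M" "s \<in> borel_measurable M" "x \<in> borel_measurable M"
  shows "(\<lambda>\<omega>. kern q (p \<omega>) (s \<omega>) (x \<omega>)) \<in> borel_measurable M"
proof (cases "q = 1")
  case True
  then show ?thesis unfolding kern_def normal_density_def by simp
next
  case False
  then have q': "\<bar>q\<bar> < 1" using q by auto
  note f_N_measurable[OF q', measurable]
  show ?thesis using False unfolding kern_def mehler_dom_def mehler_ln_def mehler_den_def by simp measurable
qed

lemma kern_nonneg: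
  assumes q: "-1 < q" "q \<le> 1"
  shows "0 \<le> kern q p s x"
  using f_N_nonneg[of q x] q by (cases "q = 1") (auto simp: kern_def)

lemma support_bound_nonneg:
  fixes q :: real and \<phi> :: "real \<Rightarrow> real"
  assumes "\<And>x. (1 - q) * x\<^sup>2 \<le> 4 \<Longrightarrow> \<bar>\<phi> x\<bar> \<le> B"
  shows "0 \<le> B"
  using assms[of 0] by (simp add: order_trans[OF abs_ge_zero])

text \<open>This is the integrable majorant behind every limit and the Fubini step for |q| < 1. The
  function \<open>f_N\<close> itself is integrable because it is the density of
  \<open>Y t\<close>.\<close>

lemma kern_bound:
  assumes q: "\<bar>q\<bar> < 1" and d: "mehler_dom q p s" "p \<le> p0" "p0 < 1"
  shows "kern q p s x \<le> exp (20 / (1 - sqrt p0) ^ 4 / (1 - \<bar>q\<bar>)) * f_N q x"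
proof (cases "(1 - q) * x\<^sup>2 \<le> 4")
  case True
  have "exp (\<Sum>k. mehler_ln q p s x k) \<le> exp (20 / (1 - sqrt p0) ^ 4 / (1 - \<bar>q\<bar>))"
    using mehler_sum_bound[OF q d(1) True d(2,3)] by simp
  from mult_left_mono[OF this f_N_nonneg[OF q, of x]] show ?thesis
    using q_lt_1(3)[OF q] d True by (simp add: kern_def mult.commute)
next
  case False
  then show ?thesis using q_lt_1(3)[OF q] by (simp add: kern_def f_N_nonneg q)
qed

lemma kern_outside: "\<bar>q\<bar> < 1 \<Longrightarrow> \<not> (1 - q) * x\<^sup>2 \<le> 4 \<Longrightarrow> kern q p s x = 0"
  by (auto simp: kern_def)

lemma kern_section_measurable: "-1 < q \<Longrightarrow> q \<le> 1 \<Longrightarrow> (\<lambda>x. kern q p s x) \<in> borel_measurable borel"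
  by (rule kern_measurable) auto

lemma f_N_eq_kern: "-1 < q \<Longrightarrow> q \<le> 1 \<Longrightarrow> f_N q x = kern q 0 0 x"
  using f_N_eq_kern_lt_1[of q x] by (cases "q = 1") (auto simp: f_N_def kern_def)

lemma f_CN_eq_kern:
  assumes "-1 < q" "q \<le> 1" "y \<in> S_q q" "\<bar>\<rho>\<bar> < 1"
  shows "mehler_dom q (\<rho>\<^sup>2) (\<rho> * y)" "f_CN q \<rho> y x = kern q (\<rho>\<^sup>2) (\<rho> * y) x"
proof -
  have r2: "\<rho>\<^sup>2 < 1" using assms by (simp add: abs_square_less_1)
  show "mehler_dom q (\<rho>\<^sup>2) (\<rho> * y)"
    using f_CN_eq_kern_lt_1(1)[of q y \<rho>] assms r2 by (cases "q = 1") (auto simp: mehler_dom_def)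
  show "f_CN q \<rho> y x = kern q (\<rho>\<^sup>2) (\<rho> * y) x"
    using f_CN_eq_kern_lt_1(2)[of q y \<rho> x] assms by (cases "q = 1") (auto simp: f_CN_def kern_def)
qed

text \<open>Boundedness of \<open>\<phi>\<close> is demanded on the support only. For
  \<open>q = 1\<close> the condition \<open>(1 - q) * x\<^sup>2 \<le> 4\<close> always holds, so
  both cases share one hypothesis.\<close>

lemma kern_integrable:
  assumes q: "-1 < q" "q \<le> 1" and fN: "integrable lborel (f_N q)"
    and d: "mehler_dom q p s" and \<phi>[measurable]: "\<phi> \<in> borel_measurable borel"
    and B: "\<And>x. (1 - q) * x\<^sup>2 \<le> 4 \<Longrightarrow> \<bar>\<phi> x\<bar> \<le> B"
  shows "integrable lborel (\<lambda>x. \<phi> x * kern q p s x)"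
proof -
  note km[measurable] = kern_section_measurable[OF q]
  have B0: "0 \<le> B" by (rule support_bound_nonneg[OF B])
  show ?thesis
  proof (cases "q = 1")
    case True
    have p: "0 < sqrt (1 - p)" using d by (simp add: mehler_dom_def)
    show ?thesis
    proof (rule Bochner_Integration.integrable_bound)
      show "integrable lborel (\<lambda>x. B * normal_density s (sqrt (1 - p)) x)"
        using p by (intro integrable_mult_right integrable_normal_density)
      show "AE x in lborel. norm (\<phi> x * kern q p s x) \<le> norm (B * normal_density s (sqrt (1 - p)) x)"
        using B B0 True by (intro AE_I2) (auto simp: abs_mult kern_def intro!: mult_right_mono)
    qed simp
  next
    case False
    then have q': "\<bar>q\<bar> < 1" using q by auto
    define K where "K = exp (20 / (1 - sqrt p) ^ 4 / (1 - \<bar>q\<bar>))"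
    show ?thesis
    proof (rule Bochner_Integration.integrable_bound)
      show "integrable lborel (\<lambda>x. B * K * f_N q x)" using fN by simp
      show "AE x in lborel. norm (\<phi> x * kern q p s x) \<le> norm (B * K * f_N q x)"
      proof (rule AE_I2)
        fix x
        show "norm (\<phi> x * kern q p s x) \<le> norm (B * K * f_N q x)"
        proof (cases "(1 - q) * x\<^sup>2 \<le> 4")
          case True
          have "kern q p s x \<le> K * f_N q x"
            unfolding K_def using d by (intro kern_bound q') (auto simp: mehler_dom_def)
          then have "\<bar>\<phi> x\<bar> * kern q p s x \<le> B * (K * f_N q x)"
            using B[OF True] B0 kern_nonneg[OF q] by (intro mult_mono) auto
          then show ?thesis
            using kern_nonneg[OF q, of p s x] f_N_nonneg[OF q', of x] B0 by (simp add: abs_mult K_def mult.assoc)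
        qed (simp add: kern_outside q')
      qed
    qed simp
  qed
qed

lemma normal_density_substitution:
  fixes \<phi> :: "real \<Rightarrow> real"
  assumes "0 < \<sigma>"
  shows "(\<integral>x. \<phi> x * normal_density \<mu> \<sigma> x \<partial>lborel) = (\<integral>z. \<phi> (\<mu> + \<sigma> * z) * std_normal_density z \<partial>lborel)"
proof -
  have "\<sigma> * normal_density \<mu> \<sigma> (\<mu> + \<sigma> * z) = std_normal_density z" for z
    using assms unfolding normal_density_def by (simp add: real_sqrt_mult power_mult_distrib field_simps)
  then have e: "\<phi> (\<mu> + \<sigma> * z) * std_normal_density z = \<sigma> * (\<phi> (\<mu> + \<sigma> * z) * normal_density \<mu> \<sigma> (\<mu> + \<sigma> * z))" for z
    by (metis mult.assoc mult.left_commute)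
  show ?thesis
    unfolding e using assms by (subst lborel_integral_real_affine[where c=\<sigma> and t=\<mu>]) auto
qed

text \<open>For \<open>q = 1\<close> an affine substitution moves the parameters from the density
  into the argument of \<open>\<phi>\<close>, hence the continuity of \<open>\<phi>\<close>. For |q|
  < 1 the densities converge pointwise under a common majorant, and a bounded \<open>\<phi>\<close>
  is enough.\<close>

lemma kern_tendsto:
  assumes q: "-1 < q" "q \<le> 1" and fN: "integrable lborel (f_N q)"
    and d: "\<And>n. mehler_dom q (p n) (s n)" "mehler_dom q p' s'"
    and lim: "p \<longlonglongrightarrow> p'" "s \<longlonglongrightarrow> s'"
    and \<phi>[measurable]: "\<phi> \<in> borel_measurable borel"
    and B: "\<And>x. (1 - q) * x\<^sup>2 \<le> 4 \<Longrightarrow> \<bar>\<phi> x\<bar> \<le> B"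
    and cont: "q = 1 \<Longrightarrow> continuous_on UNIV \<phi>"
  shows "(\<lambda>n. \<integral>x. \<phi> x * kern q (p n) (s n) x \<partial>lborel) \<longlonglongrightarrow> (\<integral>x. \<phi> x * kern q p' s' x \<partial>lborel)"
proof (cases "q = 1")
  case True
  have p: "0 < sqrt (1 - p n)" "0 < sqrt (1 - p')" for n using d by (auto simp: mehler_dom_def)
  have Bx: "\<bar>\<phi> x\<bar> \<le> B" for x using B[of x] True by simp
  have "(\<lambda>n. \<integral>z. \<phi> (s n + sqrt (1 - p n) * z) * std_normal_density z \<partial>lborel)
      \<longlonglongrightarrow> (\<integral>z. \<phi> (s' + sqrt (1 - p') * z) * std_normal_density z \<partial>lborel)"
  proof (rule integral_dominated_convergence[where w="\<lambda>z. B * std_normal_density z"])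
    show "AE z in lborel. (\<lambda>n. \<phi> (s n + sqrt (1 - p n) * z) * std_normal_density z)
       \<longlonglongrightarrow> \<phi> (s' + sqrt (1 - p') * z) * std_normal_density z"
    proof (intro AE_I2 tendsto_mult tendsto_const)
      fix z
      have "(\<lambda>n. s n + sqrt (1 - p n) * z) \<longlonglongrightarrow> s' + sqrt (1 - p') * z"
        by (intro tendsto_intros lim)
      moreover have "isCont \<phi> (s' + sqrt (1 - p') * z)"
        using cont[OF True] by (simp add: continuous_on_eq_continuous_at)
      ultimately show "(\<lambda>n. \<phi> (s n + sqrt (1 - p n) * z)) \<longlonglongrightarrow> \<phi> (s' + sqrt (1 - p') * z)"
        by (rule isCont_tendsto_compose[rotated])
    qed
    show "AE z in lborel. norm (\<phi> (s n + sqrt (1 - p n) * z) * std_normal_density z) \<le> B * std_normal_density z" for n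
      using Bx by (intro AE_I2) (auto simp: abs_mult intro!: mult_right_mono)
  qed (auto intro!: integrable_mult_right)
  then show ?thesis
    unfolding kern_def using True normal_density_substitution[OF p(1)] normal_density_substitution[OF p(2)] by simp
next
  case False
  then have q': "\<bar>q\<bar> < 1" using q by auto
  note km[measurable] = kern_section_measurable[OF q]
  have B0: "0 \<le> B" by (rule support_bound_nonneg[OF B])
  have p': "p' < 1" "0 \<le> p'" using d(2) by (auto simp: mehler_dom_def)
  define p0 where "p0 = (1 + p') / 2"
  have p0: "p' < p0" "p0 < 1" using p' by (auto simp: p0_def)
  have "\<forall>\<^sub>F n in sequentially. p n < p0" using order_tendstoD(2)[OF lim(1) p0(1)] .
  then obtain N where N: "\<And>n. N \<le> n \<Longrightarrow> p n < p0" by (auto simp: eventually_sequentially)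
  define K where "K = exp (20 / (1 - sqrt p0) ^ 4 / (1 - \<bar>q\<bar>))"
  \<comment> \<open>The majorant needs \<open>p n < p0\<close>, which is known from index
    \<open>N\<close> on; hence the shifted sequence.\<close>
  have "(\<lambda>n. \<integral>x. \<phi> x * kern q (p (n + N)) (s (n + N)) x \<partial>lborel) \<longlonglongrightarrow> (\<integral>x. \<phi> x * kern q p' s' x \<partial>lborel)"
  proof (rule integral_dominated_convergence[where w="\<lambda>x. B * K * f_N q x"])
    show "AE x in lborel. (\<lambda>n. \<phi> x * kern q (p (n + N)) (s (n + N)) x) \<longlonglongrightarrow> \<phi> x * kern q p' s' x"
    proof (intro AE_I2 tendsto_mult tendsto_const)
      fix x
      show "(\<lambda>n. kern q (p (n + N)) (s (n + N)) x) \<longlonglongrightarrow> kern q p' s' x"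
      proof (cases "(1 - q) * x\<^sup>2 \<le> 4")
        case True
        have "(\<lambda>n. \<Sum>k. mehler_ln q (p (n + N)) (s (n + N)) x k) \<longlonglongrightarrow> (\<Sum>k. mehler_ln q p' s' x k)"
          by (rule mehler_sum_tendsto[OF q' d True]) (intro LIMSEQ_ignore_initial_segment lim)+
        then have "(\<lambda>n. f_N q x * exp (\<Sum>k. mehler_ln q (p (n + N)) (s (n + N)) x k))
           \<longlonglongrightarrow> f_N q x * exp (\<Sum>k. mehler_ln q p' s' x k)"
          by (intro tendsto_intros)
        then show ?thesis using d True False by (simp add: kern_def)
      qed (simp add: kern_outside q')
    qed
    show "AE x in lborel. norm (\<phi> x * kern q (p (n + N)) (s (n + N)) x) \<le> B * K * f_N q x" for n
    proof (rule AE_I2)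
      fix x
      show "norm (\<phi> x * kern q (p (n + N)) (s (n + N)) x) \<le> B * K * f_N q x"
      proof (cases "(1 - q) * x\<^sup>2 \<le> 4")
        case True
        have "kern q (p (n + N)) (s (n + N)) x \<le> K * f_N q x"
          unfolding K_def using N[of "n + N"] p0 by (intro kern_bound q' d) auto
        then have "\<bar>\<phi> x\<bar> * kern q (p (n + N)) (s (n + N)) x \<le> B * (K * f_N q x)"
          using B[OF True] B0 kern_nonneg[OF q] by (intro mult_mono) auto
        then show ?thesis
          using kern_nonneg[OF q, of "p (n + N)" "s (n + N)" x] by (simp add: abs_mult mult.assoc)
      qed (simp add: kern_outside q' f_N_nonneg B0 K_def)
    qed
  qed (use fN in auto)
  then show ?thesis by (rule LIMSEQ_offset)
qed

section \<open>Conditional densities\<close>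

lemma (in prob_space) sigma_finite_subalgebraI:
  "subalgebra M F \<Longrightarrow> sigma_finite_subalgebra M F"
  by (intro finite_measure_subalgebra_is_sigma_finite finite_measure_subalgebra.intro)
     (unfold_locales, auto simp: finite_measure_subalgebra_axioms_def)

text \<open>The section \<open>g (\<omega>, _)\<close> is a density of the conditional law of
  \<open>W\<close> given \<open>F\<close>. The identity is demanded on half-lines and the mass bound
  almost everywhere, because this is what the process and the approximation by continuous functions
  deliver. Integrability holds for every \<open>\<omega>\<close>, so that inner integrals of bounded
  functions are genuine.\<close>

locale cond_density = prob_space M for M :: "'a measure" +
  fixes F :: "'a measure" and W :: "'a \<Rightarrow> real" and g :: "'a \<times> real \<Rightarrow> real"
  assumes subalg: "subalgebra M F"
    and W[measurable]: "W \<in> borel_measurable M"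
    and g[measurable]: "g \<in> borel_measurable (F \<Otimes>\<^sub>M borel)"
    and g_nonneg: "\<And>z. 0 \<le> g z"
    and g_int: "\<And>\<omega>. \<omega> \<in> space M \<Longrightarrow> integrable lborel (\<lambda>x. g (\<omega>, x))"
    and g_le: "AE \<omega> in M. (\<integral>x. g (\<omega>, x) \<partial>lborel) \<le> 1"
    and eq_halfline: "\<And>B a. B \<in> sets F \<Longrightarrow>
      (\<integral>\<omega>. indicator B \<omega> * indicator {a<..} (W \<omega>) \<partial>M)
        = (\<integral>\<omega>. indicator B \<omega> * (\<integral>x. indicator {a<..} x * g (\<omega>, x) \<partial>lborel) \<partial>M)"
begin

lemma space_F: "space F = space M" and sets_F: "sets F \<subseteq> sets M"
  using subalg by (auto simp: subalgebra_def)

lemma meas_F [measurable_dest]: "h \<in> measurable F N \<Longrightarrow> h \<in> measurable M N"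
  using measurable_from_subalg[OF subalg] .

lemma g_meas_F: "(\<lambda>(\<omega>, x). h (\<omega>, x) * g (\<omega>, x)) \<in> borel_measurable (F \<Otimes>\<^sub>M lborel)"
  if "h \<in> borel_measurable (F \<Otimes>\<^sub>M borel)"
proof -
  have "(\<lambda>z. h z * g z) \<in> borel_measurable (F \<Otimes>\<^sub>M borel)" using that by simp
  then show ?thesis by (simp add: case_prod_beta)
qed

text \<open>\<open>P1\<close> is the joint law of \<open>\<omega>\<close> and
  \<open>W \<omega>\<close> on the product of \<open>F\<close> with the Borel sets, and
  \<open>P2\<close> has density \<open>g\<close> there. \<open>R\<close> is \<open>M\<close> cut
  down to \<open>F\<close>, the sigma-algebra with respect to which \<open>g\<close> is
  measurable.\<close>

definition "R = restr_to_subalg M F"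
definition "P1 = distr M (F \<Otimes>\<^sub>M borel) (\<lambda>\<omega>. (\<omega>, W \<omega>))"
definition "P2 = density (R \<Otimes>\<^sub>M lborel) (\<lambda>z. ennreal (g z))"

lemma sets_R [measurable_cong]: "sets R = sets F" and space_R: "space R = space M"
  unfolding R_def by (rule sets_restr_to_subalg[OF subalg], rule space_restr_to_subalg)

lemma id_F: "(\<lambda>\<omega>. \<omega>) \<in> M \<rightarrow>\<^sub>M F"
  using meas_F[OF measurable_ident] by (simp add: id_def)

lemma graph_meas: "(\<lambda>\<omega>. (\<omega>, W \<omega>)) \<in> M \<rightarrow>\<^sub>M F \<Otimes>\<^sub>M borel"
  by (intro measurable_Pair id_F) simp

lemma prob_R: "prob_space R"
  unfolding R_def by (intro prob_space_restr_to_subalg subalg prob_space_axioms)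

lemma pair_sf: "pair_sigma_finite R lborel"
  by (intro pair_sigma_finite.intro prob_space_imp_sigma_finite prob_R lborel.sigma_finite_measure_axioms)

lemma nn_R: "f \<in> borel_measurable F \<Longrightarrow> (\<integral>\<^sup>+\<omega>. f \<omega> \<partial>R) = (\<integral>\<^sup>+\<omega>. f \<omega> \<partial>M)"
  unfolding R_def by (rule nn_integral_subalgebra2[OF subalg])

lemma P2_rect:
  assumes B: "B \<in> sets F" and A: "A \<in> sets borel"
  shows "emeasure P2 (B \<times> A) = (\<integral>\<^sup>+\<omega>. indicator B \<omega> * (\<integral>\<^sup>+x. indicator A x * g (\<omega>, x) \<partial>lborel) \<partial>M)"
proof -
  have BA[measurable]: "B \<times> A \<in> sets (F \<Otimes>\<^sub>M borel)" using A B by auto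
  have s: "sets (R \<Otimes>\<^sub>M lborel) = sets (F \<Otimes>\<^sub>M borel)"
    by (intro sets_pair_measure_cong sets_R) simp
  have m: "(\<lambda>z. ennreal (g z)) \<in> borel_measurable (R \<Otimes>\<^sub>M lborel)"
    "(\<lambda>z. ennreal (g z) * indicator (B \<times> A) z) \<in> borel_measurable (R \<Otimes>\<^sub>M lborel)"
    unfolding measurable_cong_sets[OF s refl] by measurable
  have "emeasure P2 (B \<times> A) = (\<integral>\<^sup>+z. ennreal (g z) * indicator (B \<times> A) z \<partial>(R \<Otimes>\<^sub>M lborel))"
    unfolding P2_def by (rule emeasure_density[OF m(1)]) (unfold s, rule BA)
  also have "\<dots> = (\<integral>\<^sup>+\<omega>. \<integral>\<^sup>+x. ennreal (g (\<omega>, x)) * indicator (B \<times> A) (\<omega>, x) \<partial>lborel \<partial>R)"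
    using m(2) by (rule lborel.nn_integral_fst[symmetric])
  also have "\<dots> = (\<integral>\<^sup>+\<omega>. indicator B \<omega> * (\<integral>\<^sup>+x. indicator A x * g (\<omega>, x) \<partial>lborel) \<partial>R)"
  proof (rule nn_integral_cong)
    fix \<omega>
    have "ennreal (g (\<omega>, x)) * indicator (B \<times> A) (\<omega>, x) = indicator B \<omega> * ennreal (indicator A x * g (\<omega>, x))" for x
      by (cases "\<omega> \<in> B"; cases "x \<in> A") simp_all
    then show "(\<integral>\<^sup>+x. ennreal (g (\<omega>, x)) * indicator (B \<times> A) (\<omega>, x) \<partial>lborel)
      = indicator B \<omega> * (\<integral>\<^sup>+x. indicator A x * g (\<omega>, x) \<partial>lborel)"
      by (cases "\<omega> \<in> B") simp_all
  qed
  also have "\<dots> = (\<integral>\<^sup>+\<omega>. indicator B \<omega> * (\<integral>\<^sup>+x. indicator A x * g (\<omega>, x) \<partial>lborel) \<partial>M)"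
  proof (rule nn_R)
    have "(\<lambda>z. ennreal (indicator A (snd z) * g z)) \<in> borel_measurable (F \<Otimes>\<^sub>M borel)" using A by measurable
    moreover have "(\<lambda>z. ennreal (indicator A (snd z) * g z)) = (\<lambda>(\<omega>, x). ennreal (indicator A x * g (\<omega>, x)))"
      by (simp add: fun_eq_iff)
    ultimately have "(\<lambda>(\<omega>, x). ennreal (indicator A x * g (\<omega>, x))) \<in> borel_measurable (F \<Otimes>\<^sub>M lborel)"
      unfolding measurable_cong_sets[OF sets_pair_measure_cong[OF refl sets_lborel] refl] by (simp only:)
    from lborel.borel_measurable_nn_integral[OF this]
    show "(\<lambda>\<omega>. indicator B \<omega> * (\<integral>\<^sup>+x. indicator A x * g (\<omega>, x) \<partial>lborel)) \<in> borel_measurable F"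
      using B by simp
  qed
  finally show ?thesis .
qed

text \<open>Two uniqueness arguments. For fixed \<open>B\<close> the half-lines determine a finite
  measure on the line, which gives equality on rectangles; rectangles then determine a finite
  measure on the product.\<close>

lemma P_eq: "P1 = P2"
proof -
  have s: "sets (R \<Otimes>\<^sub>M lborel) = sets (F \<Otimes>\<^sub>M borel)"
    by (intro sets_pair_measure_cong sets_R) simp
  have P1_rect: "emeasure P1 (B \<times> A) = emeasure M (B \<inter> (W -` A \<inter> space M))"
    if "B \<in> sets F" "A \<in> sets borel" for A B
    unfolding P1_def using that sets_F sets.sets_into_space[of B F] space_F
    by (subst emeasure_distr[OF graph_meas]) (auto intro!: arg_cong[where f="emeasure M"])
  have half: "emeasure P1 (B \<times> {a<..}) = emeasure P2 (B \<times> {a<..})" if B: "B \<in> sets F" for B a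
  proof -
    have BM[measurable]: "B \<in> sets M" using B sets_F by auto
    have i1: "integrable M (\<lambda>\<omega>. indicator B \<omega> * indicator {a<..} (W \<omega>) :: real)"
      by (intro integrable_const_bound[of _ 1]) (auto simp: indicator_def)
    let ?I = "\<lambda>\<omega>. \<integral>x. indicator {a<..} x * g (\<omega>, x) \<partial>lborel"
    have I: "0 \<le> ?I \<omega>" "\<bar>?I \<omega>\<bar> = ?I \<omega>" for \<omega>
    proof -
      show "0 \<le> ?I \<omega>" by (rule integral_nonneg_AE) (simp add: g_nonneg)
      then show "\<bar>?I \<omega>\<bar> = ?I \<omega>" by simp
    qed
    have intI: "integrable lborel (\<lambda>x. indicator {a<..} x * g (\<omega>, x))" if "\<omega> \<in> space M" for \<omega>
      using integrable_real_mult_indicator[OF _ g_int[OF that], of "{a<..}"] by (simp add: mult.commute)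
    have Im: "(\<lambda>\<omega>. ?I \<omega>) \<in> borel_measurable M"
      by (rule meas_F) (use g_meas_F[of "\<lambda>z. indicator {a<..} (snd z)"] in
        \<open>intro lborel.borel_measurable_lebesgue_integral; simp\<close>)
    \<comment> \<open>The mass bound makes the right-hand side integrable, so that the Bochner
      identity \<open>eq_halfline\<close> can be turned into one between nonnegative
      integrals.\<close>
    have Ile: "AE \<omega> in M. ?I \<omega> \<le> 1"
      using g_le AE_space
    proof eventually_elim
      case (elim \<omega>)
      have "?I \<omega> \<le> (\<integral>x. g (\<omega>, x) \<partial>lborel)"
        using elim by (intro integral_mono intI g_int) (auto simp: indicator_def g_nonneg)
      then show ?case using elim by simp
    qed
    have i2: "integrable M (\<lambda>\<omega>. indicator B \<omega> * ?I \<omega>)"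
    proof (rule integrable_const_bound[of _ 1])
      show "AE \<omega> in M. norm (indicator B \<omega> * ?I \<omega>) \<le> 1"
        using Ile by eventually_elim (simp only: real_norm_def abs_mult I(2), auto simp: indicator_def[of B])
    qed (use Im in measurable)
    have "emeasure M (B \<inter> (W -` {a<..} \<inter> space M)) = (\<integral>\<^sup>+\<omega>. indicator (B \<inter> (W -` {a<..} \<inter> space M)) \<omega> \<partial>M)"
      by (rule nn_integral_indicator[symmetric]) measurable
    also have "\<dots> = (\<integral>\<^sup>+\<omega>. ennreal (indicator B \<omega> * indicator {a<..} (W \<omega>)) \<partial>M)"
      by (intro nn_integral_cong) (auto split: split_indicator)
    also have "\<dots> = ennreal (\<integral>\<omega>. indicator B \<omega> * indicator {a<..} (W \<omega>) \<partial>M)"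
      by (rule nn_integral_eq_integral[OF i1]) (rule AE_I2, simp)
    also have "\<dots> = ennreal (\<integral>\<omega>. indicator B \<omega> * ?I \<omega> \<partial>M)"
      using eq_halfline[OF B] by simp
    also have "\<dots> = (\<integral>\<^sup>+\<omega>. ennreal (indicator B \<omega> * ?I \<omega>) \<partial>M)"
      by (rule nn_integral_eq_integral[OF i2, symmetric]) (rule AE_I2, simp add: I)
    also have "\<dots> = (\<integral>\<^sup>+\<omega>. indicator B \<omega> * (\<integral>\<^sup>+x. indicator {a<..} x * g (\<omega>, x) \<partial>lborel) \<partial>M)"
    proof (rule nn_integral_cong)
      fix \<omega> assume w: "\<omega> \<in> space M"
      have e: "ennreal (?I \<omega>) = (\<integral>\<^sup>+x. indicator {a<..} x * g (\<omega>, x) \<partial>lborel)"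
        by (rule nn_integral_eq_integral[OF intI[OF w], symmetric]) (rule AE_I2, simp add: g_nonneg)
      show "ennreal (indicator B \<omega> * ?I \<omega>) = indicator B \<omega> * (\<integral>\<^sup>+x. indicator {a<..} x * g (\<omega>, x) \<partial>lborel)"
        unfolding e[symmetric] by (cases "\<omega> \<in> B") simp_all
    qed
    finally show ?thesis using P2_rect[OF B] P1_rect[OF B] by simp
  qed
  have P1_le: "emeasure P1 C < \<infinity>" for C
  proof -
    interpret P1: prob_space P1 unfolding P1_def by (rule prob_space_distr[OF graph_meas])
    show ?thesis using P1.emeasure_finite[of C] by (simp add: less_top[symmetric])
  qed
  have rect: "emeasure P1 (B \<times> A) = emeasure P2 (B \<times> A)" if B: "B \<in> sets F" and A: "A \<in> sets borel" for B A
  proof -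
    have sP: "sets P1 = sets (F \<Otimes>\<^sub>M borel)" "sets P2 = sets (F \<Otimes>\<^sub>M borel)"
      unfolding P1_def P2_def sets_density sets_distr by (rule refl, rule s)
    \<comment> \<open>Restricting to \<open>B\<close> and projecting to the second coordinate turns
      rectangles over \<open>B\<close> into Borel sets of the line, where half-lines
      suffice.\<close>
    define ind where "ind = (\<lambda>z. indicator (B \<times> (UNIV::real set)) z :: ennreal)"
    have BU: "B \<times> (UNIV::real set) \<in> sets (F \<Otimes>\<^sub>M borel)" by (rule pair_measureI[OF B]) simp
    have em: "emeasure (distr (density P ind) borel snd) C = emeasure P (B \<times> C)"
      if P: "sets P = sets (F \<Otimes>\<^sub>M borel)" and C: "C \<in> sets borel" for P and C :: "real set"
    proof -
      have sp: "space P = space F \<times> UNIV" using sets_eq_imp_space_eq[OF P] by (simp add: space_pair_measure)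
      have s1: "snd \<in> density P ind \<rightarrow>\<^sub>M borel"
        unfolding measurable_density_eq1 measurable_cong_sets[OF P refl] by (rule measurable_snd)
      have eq: "snd -` C \<inter> space (density P ind) = space F \<times> C" by (auto simp: sp)
      have FC: "space F \<times> C \<in> sets P" unfolding P by (rule pair_measureI[OF sets.top C])
      have "emeasure (distr (density P ind) borel snd) C = emeasure (density P ind) (space F \<times> C)"
        unfolding emeasure_distr[OF s1 C] eq ..
      also have "\<dots> = (\<integral>\<^sup>+z. indicator (B \<times> UNIV) z * indicator (space F \<times> C) z \<partial>P)"
        unfolding ind_def by (rule emeasure_density[OF _ FC]) (use BU P in \<open>simp add: borel_measurable_indicator\<close>)
      also have "\<dots> = (\<integral>\<^sup>+z. indicator (B \<times> C) z \<partial>P)"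
        using sets.sets_into_space[OF B] by (intro nn_integral_cong) (auto simp: indicator_def)
      also have "\<dots> = emeasure P (B \<times> C)" by (rule nn_integral_indicator) (simp add: P pair_measureI[OF B C])
      finally show ?thesis .
    qed
    have "distr (density P1 ind) borel snd = distr (density P2 ind) borel snd"
    proof (rule measure_eqI_lessThan)
      fix a :: real
      show "emeasure (distr (density P1 ind) borel snd) {a<..} < \<infinity>"
        using em[OF sP(1), of "{a<..}"] P1_le by simp
      show "emeasure (distr (density P1 ind) borel snd) {a<..} = emeasure (distr (density P2 ind) borel snd) {a<..}"
        using em[OF sP(1), of "{a<..}"] em[OF sP(2), of "{a<..}"] half[OF B] by simp
    qed simp_all
    then show ?thesis using em[OF sP(1) A] em[OF sP(2) A] by simp
  qed
  show ?thesis
  proof (rule measure_eqI_generator_eq[OF Int_stable_pair_measure_generator[of F borel],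
        where \<Omega>="space F \<times> space borel" and A="\<lambda>_. space F \<times> space borel"])
    show "{a \<times> b |a b. a \<in> sets F \<and> b \<in> sets borel} \<subseteq> Pow (space F \<times> space borel)"
      by (rule pair_measure_closed)
    show "sets P1 = sigma_sets (space F \<times> space borel) {a \<times> b |a b. a \<in> sets F \<and> b \<in> sets borel}"
      unfolding P1_def sets_distr by (rule sets_pair_measure)
    show "sets P2 = sigma_sets (space F \<times> space borel) {a \<times> b |a b. a \<in> sets F \<and> b \<in> sets borel}"
      unfolding P2_def sets_density s by (rule sets_pair_measure)
    show "emeasure P1 (space F \<times> space borel) \<noteq> \<infinity>" for i :: nat
      by (rule less_imp_neq[OF P1_le])
    show "range (\<lambda>_. space F \<times> space borel) \<subseteq> {a \<times> b |a b. a \<in> sets F \<and> b \<in> sets borel}"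
      using sets.top[of F] sets.top[of "borel::real measure"] by blast
    show "emeasure P1 X = emeasure P2 X" if "X \<in> {a \<times> b |a b. a \<in> sets F \<and> b \<in> sets borel}" for X
      using that rect by blast
    show "(\<Union>i::nat. space F \<times> space borel) = space F \<times> space (borel :: real measure)" by simp
  qed
qed

text \<open>Since \<open>f\<close> sees \<open>\<omega>\<close> too, this covers increments and
  products in which one factor is known to \<open>F\<close>. Every clause is the equality
  \<open>P1 = P2\<close> integrated against \<open>f\<close>, or against \<open>f\<close> cut off by
  an event of \<open>F\<close>.\<close>

theorem cond_exp_density:
  fixes f :: "'a \<times> real \<Rightarrow> real"
  assumes f[measurable]: "f \<in> borel_measurable (F \<Otimes>\<^sub>M borel)"
    and int: "integrable M (\<lambda>\<omega>. f (\<omega>, W \<omega>))"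
  shows "integrable M (\<lambda>\<omega>. \<integral>x. f (\<omega>, x) * g (\<omega>, x) \<partial>lborel)"
    and "AE \<omega> in M. real_cond_exp M F (\<lambda>\<omega>. f (\<omega>, W \<omega>)) \<omega> = (\<integral>x. f (\<omega>, x) * g (\<omega>, x) \<partial>lborel)"
    and "B \<in> sets F \<Longrightarrow> (\<integral>\<omega>. indicator B \<omega> * f (\<omega>, W \<omega>) \<partial>M)
      = (\<integral>\<omega>. indicator B \<omega> * (\<integral>x. f (\<omega>, x) * g (\<omega>, x) \<partial>lborel) \<partial>M)"
    and "(\<integral>\<omega>. f (\<omega>, W \<omega>) \<partial>M) = (\<integral>\<omega>. (\<integral>x. f (\<omega>, x) * g (\<omega>, x) \<partial>lborel) \<partial>M)"
proof -
  interpret PS: pair_sigma_finite R lborel by (rule pair_sf)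
  have s: "sets (R \<Otimes>\<^sub>M lborel) = sets (F \<Otimes>\<^sub>M borel)"
    by (intro sets_pair_measure_cong sets_R) simp
  note cg = measurable_cong_sets[OF s refl]
  have gm: "g \<in> borel_measurable (R \<Otimes>\<^sub>M lborel)" unfolding cg by simp
  have Hm: "(\<lambda>\<omega>. \<integral>x. h (\<omega>, x) * g (\<omega>, x) \<partial>lborel) \<in> borel_measurable F"
    if "h \<in> borel_measurable (F \<Otimes>\<^sub>M borel)" for h
    using g_meas_F[OF that] by (rule lborel.borel_measurable_lebesgue_integral)
  have key: "integrable M (\<lambda>\<omega>. \<integral>x. h (\<omega>, x) * g (\<omega>, x) \<partial>lborel)"
    "(\<integral>\<omega>. h (\<omega>, W \<omega>) \<partial>M) = (\<integral>\<omega>. (\<integral>x. h (\<omega>, x) * g (\<omega>, x) \<partial>lborel) \<partial>M)"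
    if h: "h \<in> borel_measurable (F \<Otimes>\<^sub>M borel)" and i: "integrable M (\<lambda>\<omega>. h (\<omega>, W \<omega>))" for h :: "'a \<times> real \<Rightarrow> real"
  proof -
    have hm: "h \<in> borel_measurable (R \<Otimes>\<^sub>M lborel)" unfolding cg by (rule h)
    have "integrable P1 h" unfolding P1_def using i by (subst integrable_distr_eq[OF graph_meas h])
    then have "integrable P2 h" by (simp add: P_eq)
    then have i2: "integrable (R \<Otimes>\<^sub>M lborel) (\<lambda>z. h z * g z)"
      unfolding P2_def using integrable_real_density[OF gm _ hm] by (simp add: g_nonneg mult.commute)
    have m: "(\<lambda>\<omega>. \<integral>x. h (\<omega>, x) * g (\<omega>, x) \<partial>lborel) \<in> borel_measurable F" by (rule Hm[OF h])
    have "integrable R (\<lambda>\<omega>. \<integral>x. h (\<omega>, x) * g (\<omega>, x) \<partial>lborel)"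
      using PS.integrable_fst'[OF i2] .
    then show "integrable M (\<lambda>\<omega>. \<integral>x. h (\<omega>, x) * g (\<omega>, x) \<partial>lborel)"
      unfolding R_def by (rule integrable_from_subalg[OF subalg])
    have "(\<integral>\<omega>. h (\<omega>, W \<omega>) \<partial>M) = (\<integral>z. h z \<partial>P1)"
      unfolding P1_def by (rule integral_distr[OF graph_meas h, symmetric])
    also have "\<dots> = (\<integral>z. h z * g z \<partial>(R \<Otimes>\<^sub>M lborel))"
      unfolding P_eq P2_def using integral_real_density[OF gm _ hm] by (simp add: g_nonneg mult.commute)
    also have "\<dots> = (\<integral>\<omega>. (\<integral>x. h (\<omega>, x) * g (\<omega>, x) \<partial>lborel) \<partial>R)"
      using PS.integral_fst'[OF i2] by simp
    also have "\<dots> = (\<integral>\<omega>. (\<integral>x. h (\<omega>, x) * g (\<omega>, x) \<partial>lborel) \<partial>M)"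
      unfolding R_def by (rule integral_subalgebra2[OF subalg m])
    finally show "(\<integral>\<omega>. h (\<omega>, W \<omega>) \<partial>M) = (\<integral>\<omega>. (\<integral>x. h (\<omega>, x) * g (\<omega>, x) \<partial>lborel) \<partial>M)" .
  qed
  show 1: "integrable M (\<lambda>\<omega>. \<integral>x. f (\<omega>, x) * g (\<omega>, x) \<partial>lborel)"
    and "(\<integral>\<omega>. f (\<omega>, W \<omega>) \<partial>M) = (\<integral>\<omega>. (\<integral>x. f (\<omega>, x) * g (\<omega>, x) \<partial>lborel) \<partial>M)"
    using key[OF f int] by auto
  show 2: "(\<integral>\<omega>. indicator B \<omega> * f (\<omega>, W \<omega>) \<partial>M)
      = (\<integral>\<omega>. indicator B \<omega> * (\<integral>x. f (\<omega>, x) * g (\<omega>, x) \<partial>lborel) \<partial>M)" if B: "B \<in> sets F" for B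
  proof -
    have "B \<in> sets M" using B sets_F by auto
    then have "integrable M (\<lambda>\<omega>. indicator B \<omega> * f (\<omega>, W \<omega>))"
      using integrable_real_mult_indicator[OF _ int, of B] by (simp add: mult.commute)
    moreover have "(\<lambda>z. indicator B (fst z) * f z) \<in> borel_measurable (F \<Otimes>\<^sub>M borel)"
      using B by measurable
    ultimately have "(\<integral>\<omega>. indicator B \<omega> * f (\<omega>, W \<omega>) \<partial>M)
      = (\<integral>\<omega>. (\<integral>x. (indicator B \<omega> * f (\<omega>, x)) * g (\<omega>, x) \<partial>lborel) \<partial>M)"
      using key(2)[of "\<lambda>z. indicator B (fst z) * f z"] by simp
    then show ?thesis by (simp add: mult.assoc)
  qed
  interpret sf: sigma_finite_subalgebra M F by (rule sigma_finite_subalgebraI[OF subalg])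
  show "AE \<omega> in M. real_cond_exp M F (\<lambda>\<omega>. f (\<omega>, W \<omega>)) \<omega> = (\<integral>x. f (\<omega>, x) * g (\<omega>, x) \<partial>lborel)"
    by (rule sf.real_cond_exp_charact)
       (auto simp: set_lebesgue_integral_def 2 intro: int 1 Hm[OF f])
qed

end

text \<open>Half-line indicators are limits of continuous functions, so \<open>eq_halfline\<close>
  can be checked on continuous test functions. At a stopping time these are the ones for which the
  passage from dyadic times to the limit works.\<close>

lemma (in prob_space) cond_density_from_continuous:
  assumes subalg: "subalgebra M F"
    and W[measurable]: "W \<in> borel_measurable M"
    and g[measurable]: "g \<in> borel_measurable (F \<Otimes>\<^sub>M borel)"
    and g_nonneg: "\<And>z. 0 \<le> g z"
    and g_int: "\<And>\<omega>. \<omega> \<in> space M \<Longrightarrow> integrable lborel (\<lambda>x. g (\<omega>, x))"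
    and g_le: "AE \<omega> in M. (\<integral>x. g (\<omega>, x) \<partial>lborel) \<le> 1"
    and eq: "\<And>B \<phi>. B \<in> sets F \<Longrightarrow> continuous_on UNIV \<phi> \<Longrightarrow> (\<And>x. 0 \<le> \<phi> x \<and> \<phi> x \<le> 1) \<Longrightarrow>
      (\<integral>\<omega>. indicator B \<omega> * \<phi> (W \<omega>) \<partial>M)
        = (\<integral>\<omega>. indicator B \<omega> * (\<integral>x. \<phi> x * g (\<omega>, x) \<partial>lborel) \<partial>M)"
  shows "cond_density M F W g"
proof (intro cond_density.intro cond_density_axioms.intro)
  fix B a assume B: "B \<in> sets F"
  then have BM[measurable]: "B \<in> sets M" using subalg unfolding subalgebra_def by blast
  \<comment> \<open>Ramps of slope \<open>n\<close> that start at \<open>a\<close>; they increase to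
    the indicator of the open half-line.\<close>
  define \<phi> where "\<phi> = (\<lambda>n x. max 0 (min 1 (real n * (x - a))))"
  have \<phi>01: "0 \<le> \<phi> n x \<and> \<phi> n x \<le> 1" for n x by (simp add: \<phi>_def)
  have \<phi>c: "continuous_on UNIV (\<phi> n)" for n unfolding \<phi>_def by (intro continuous_intros)
  then have \<phi>m[measurable]: "\<phi> n \<in> borel_measurable borel" for n by (rule borel_measurable_continuous_onI)
  have \<phi>lim: "(\<lambda>n. \<phi> n x) \<longlonglongrightarrow> indicator {a<..} x" for x
  proof (cases "a < x")
    case True
    obtain N where N: "1 / (x - a) \<le> real N" using real_arch_simple by blast
    have "\<phi> n x = 1" if "N \<le> n" for n
    proof -
      have "1 / (x - a) \<le> real n" using N that by (meson of_nat_le_iff order_trans)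
      then have "1 \<le> real n * (x - a)" using True by (simp add: pos_divide_le_eq)
      then show ?thesis by (simp add: \<phi>_def)
    qed
    then have "\<forall>\<^sub>F n in sequentially. \<phi> n x = 1" by (auto simp: eventually_sequentially)
    then show ?thesis using True by (simp add: tendsto_eventually)
  next
    case False
    have "\<phi> n x = 0" for n
    proof -
      have "real n * (x - a) \<le> 0" using False by (intro mult_nonneg_nonpos) auto
      then show ?thesis by (simp add: \<phi>_def)
    qed
    then show ?thesis using False by simp
  qed
  have gMF: "(\<lambda>\<omega>. \<integral>x. h x * g (\<omega>, x) \<partial>lborel) \<in> borel_measurable M"
    if [measurable]: "h \<in> borel_measurable borel" for h
  proof (rule measurable_from_subalg[OF subalg])
    have "(\<lambda>(\<omega>, x). h x * g (\<omega>, x)) \<in> borel_measurable (F \<Otimes>\<^sub>M borel)" by measurable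
    then have "(\<lambda>(\<omega>, x). h x * g (\<omega>, x)) \<in> borel_measurable (F \<Otimes>\<^sub>M lborel)" by simp
    then show "(\<lambda>\<omega>. \<integral>x. h x * g (\<omega>, x) \<partial>lborel) \<in> borel_measurable F"
      by (rule lborel.borel_measurable_lebesgue_integral)
  qed
  have gx: "(\<lambda>x. g (\<omega>, x)) \<in> borel_measurable borel" if "\<omega> \<in> space M" for \<omega>
    using borel_measurable_integrable[OF g_int[OF that]] by simp
  have inner: "(\<lambda>n. \<integral>x. \<phi> n x * g (\<omega>, x) \<partial>lborel) \<longlonglongrightarrow> (\<integral>x. indicator {a<..} x * g (\<omega>, x) \<partial>lborel)"
    if w: "\<omega> \<in> space M" for \<omega>
  proof (rule integral_dominated_convergence[where w="\<lambda>x. g (\<omega>, x)"])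
    show "AE x in lborel. (\<lambda>n. \<phi> n x * g (\<omega>, x)) \<longlonglongrightarrow> indicator {a<..} x * g (\<omega>, x)"
      by (intro AE_I2 tendsto_mult \<phi>lim tendsto_const)
    show "AE x in lborel. norm (\<phi> n x * g (\<omega>, x)) \<le> g (\<omega>, x)" for n
      using \<phi>01 g_nonneg by (intro AE_I2) (simp add: abs_mult mult_left_le_one_le)
  qed (use gx[OF w] g_int[OF w] in auto)
  have "(\<lambda>n. \<integral>\<omega>. indicator B \<omega> * \<phi> n (W \<omega>) \<partial>M) \<longlonglongrightarrow> (\<integral>\<omega>. indicator B \<omega> * indicator {a<..} (W \<omega>) \<partial>M)"
  proof (rule integral_dominated_convergence[where w="\<lambda>_. 1"])
    show "AE \<omega> in M. (\<lambda>n. indicator B \<omega> * \<phi> n (W \<omega>)) \<longlonglongrightarrow> indicator B \<omega> * indicator {a<..} (W \<omega>)"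
      by (intro AE_I2 tendsto_mult \<phi>lim tendsto_const)
    show "AE \<omega> in M. norm (indicator B \<omega> * \<phi> n (W \<omega>)) \<le> 1" for n
      using \<phi>01 by (intro AE_I2) (auto simp: indicator_def)
  qed auto
  moreover have "(\<lambda>n. \<integral>\<omega>. indicator B \<omega> * (\<integral>x. \<phi> n x * g (\<omega>, x) \<partial>lborel) \<partial>M)
    \<longlonglongrightarrow> (\<integral>\<omega>. indicator B \<omega> * (\<integral>x. indicator {a<..} x * g (\<omega>, x) \<partial>lborel) \<partial>M)"
  proof (rule integral_dominated_convergence[where w="\<lambda>_. 1"])
    show "AE \<omega> in M. (\<lambda>n. indicator B \<omega> * (\<integral>x. \<phi> n x * g (\<omega>, x) \<partial>lborel))
       \<longlonglongrightarrow> indicator B \<omega> * (\<integral>x. indicator {a<..} x * g (\<omega>, x) \<partial>lborel)"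
      by (intro AE_I2 tendsto_mult inner tendsto_const)
    show "AE \<omega> in M. norm (indicator B \<omega> * (\<integral>x. \<phi> n x * g (\<omega>, x) \<partial>lborel)) \<le> 1" for n
      using g_le AE_space
    proof eventually_elim
      case (elim \<omega>)
      have "(\<integral>x. \<phi> n x * g (\<omega>, x) \<partial>lborel) \<le> (\<integral>x. g (\<omega>, x) \<partial>lborel)"
      proof (rule integral_mono)
        show "integrable lborel (\<lambda>x. \<phi> n x * g (\<omega>, x))"
          using gx[OF elim(2)] \<phi>01 g_nonneg
          by (intro Bochner_Integration.integrable_bound[OF g_int[OF elim(2)]])
             (auto simp: abs_mult mult_left_le_one_le)
      qed (use \<phi>01 g_nonneg g_int[OF elim(2)] in \<open>auto simp: mult_left_le_one_le\<close>)
      moreover have "0 \<le> (\<integral>x. \<phi> n x * g (\<omega>, x) \<partial>lborel)"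
        using \<phi>01 g_nonneg by (intro integral_nonneg_AE) auto
      ultimately show ?case using elim by (auto simp: indicator_def)
    qed
  qed (auto intro!: borel_measurable_times gMF)
  ultimately show "(\<integral>\<omega>. indicator B \<omega> * indicator {a<..} (W \<omega>) \<partial>M)
        = (\<integral>\<omega>. indicator B \<omega> * (\<integral>x. indicator {a<..} x * g (\<omega>, x) \<partial>lborel) \<partial>M)"
    unfolding eq[OF B \<phi>c \<phi>01] by (rule LIMSEQ_unique)
qed (fact prob_space_axioms subalg W g g_nonneg g_int g_le)+

section \<open>Conditional moments of the Ornstein--Uhlenbeck process\<close>

lemma space_gen_sigma: "space (gen_sigma M Z I) = space M"
  unfolding gen_sigma_def by (intro space_measure_of) auto

lemma sets_gen_sigma:
  "sets (gen_sigma M Z I) = sigma_sets (space M) (\<Union>i\<in>I. {Z i -` A \<inter> space M | A. A \<in> sets borel})"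
  unfolding gen_sigma_def by (intro sets_measure_of) auto

lemma gen_sigma_measurable: "i \<in> I \<Longrightarrow> Z i \<in> borel_measurable (gen_sigma M Z I)"
  by (rule measurableI) (auto simp: space_gen_sigma sets_gen_sigma intro!: sigma_sets.Basic)

lemma gen_sigma_subalgebra:
  assumes "\<And>i. i \<in> I \<Longrightarrow> Z i \<in> borel_measurable M"
  shows "subalgebra M (gen_sigma M Z I)"
  unfolding subalgebra_def
proof (intro conjI space_gen_sigma)
  show "sets (gen_sigma M Z I) \<subseteq> sets M"
    unfolding sets_gen_sigma using assms by (intro sets.sigma_sets_subset) (auto intro: measurable_sets)
qed

lemma gen_sigma_mono: "I \<subseteq> J \<Longrightarrow> sets (gen_sigma M Z I) \<subseteq> sets (gen_sigma M Z J)"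
  unfolding sets_gen_sigma by (intro sigma_sets_mono') auto

section \<open>Conditional laws of the Ornstein--Uhlenbeck process\<close>

locale ou = prob_space M for M :: "'a measure" +
  fixes \<alpha> q :: real and Y :: "real \<Rightarrow> 'a \<Rightarrow> real"
  assumes alpha: "0 < \<alpha>" and q: "-1 < q" "q \<le> 1" and ou: "ou_process M \<alpha> q Y"
begin

lemma Y_meas [measurable]: "Y t \<in> borel_measurable M"
  and Y_S: "\<omega> \<in> space M \<Longrightarrow> Y t \<omega> \<in> S_q q"
  and Y_markov: "markov M Y"
  and Y_dist: "distributed M lborel (Y t) (\<lambda>x. ennreal (f_N q x))"
  and Y_trans: "t < s \<Longrightarrow> A \<in> sets borel \<Longrightarrow> AE \<omega> in M.
        real_cond_exp M (gen_sigma M Y {t}) (\<lambda>\<omega>. indicator A (Y s \<omega>)) \<omega>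
          = (LINT x:A|lborel. f_CN q (exp (- \<alpha> * (s - t))) (Y t \<omega>) x)"
  using ou unfolding ou_process_def by blast+

lemma fN_nonneg: "0 \<le> f_N q x"
  unfolding f_N_eq_kern[OF q] by (rule kern_nonneg[OF q])

lemma Y_integral:
  fixes h :: "real \<Rightarrow> real"
  assumes [measurable]: "h \<in> borel_measurable borel"
  shows "(\<integral>\<omega>. h (Y t \<omega>) \<partial>M) = (\<integral>x. f_N q x * h x \<partial>lborel)"
    "integrable lborel (\<lambda>x. f_N q x * h x) \<longleftrightarrow> integrable M (\<lambda>\<omega>. h (Y t \<omega>))"
  using distributed_integral[OF Y_dist, of h] distributed_integrable[OF Y_dist, of h] fN_nonneg by auto

lemma fN_integrable: "integrable lborel (f_N q)" and fN_integral: "(\<integral>x. f_N q x \<partial>lborel) = 1"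
  using Y_integral[of "\<lambda>_. 1" 0] by (simp_all add: prob_space)

text \<open>Time differences are indexed by the correlation they produce. The lag is linear in
  \<open>ln \<rho>\<close>, so \<open>\<rho>\<^sup>2\<close> stands for twice the lag of
  \<open>\<rho>\<close>.\<close>

abbreviation "lag \<rho> \<equiv> - ln \<rho> / \<alpha>"
abbreviation "past t \<equiv> gen_sigma M Y {..t}"

lemma lag: "0 < \<rho> \<Longrightarrow> \<rho> < 1 \<Longrightarrow> 0 < lag \<rho>" "0 < \<rho> \<Longrightarrow> exp (- \<alpha> * lag \<rho>) = \<rho>"
  using alpha by (auto simp: divide_neg_pos)

lemma past_subalgebra: "subalgebra M (past t)"
  by (rule gen_sigma_subalgebra) simp

lemma kern_dom_integrable:
  assumes "mehler_dom q p s" shows "integrable lborel (kern q p s)"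
  using kern_integrable[OF q fN_integrable assms, of "\<lambda>_. 1" 1] by simp

lemma Y_dom: "\<omega> \<in> space M \<Longrightarrow> \<bar>\<rho>\<bar> < 1 \<Longrightarrow> mehler_dom q (\<rho>\<^sup>2) (\<rho> * Y t \<omega>)"
  by (rule f_CN_eq_kern(1)[OF q Y_S])

lemma ou_cond_prob:
  assumes r: "0 < \<rho>" "\<rho> < 1" and A: "A \<in> sets borel"
  shows "AE \<omega> in M. real_cond_exp M (past t) (\<lambda>\<omega>. indicator A (Y (t + lag \<rho>) \<omega>)) \<omega>
     = (\<integral>x. indicator A x * kern q (\<rho>\<^sup>2) (\<rho> * Y t \<omega>) x \<partial>lborel)"
proof -
  have l: "t < t + lag \<rho>" using lag(1)[OF r] by simp
  have e: "exp (- \<alpha> * (t + lag \<rho> - t)) = \<rho>" using lag(2)[OF r(1)] by simp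
  have "AE \<omega> in M. real_cond_exp M (past t) (\<lambda>\<omega>. indicator A (Y (t + lag \<rho>) \<omega>)) \<omega>
     = real_cond_exp M (gen_sigma M Y {t}) (\<lambda>\<omega>. indicator A (Y (t + lag \<rho>) \<omega>)) \<omega>"
    using Y_markov l A unfolding markov_def by blast
  moreover note Y_trans[OF l A]
  ultimately show ?thesis
    using AE_space
  proof eventually_elim
    case (elim \<omega>)
    have "f_CN q \<rho> (Y t \<omega>) x = kern q (\<rho>\<^sup>2) (\<rho> * Y t \<omega>) x" for x
      using r by (intro f_CN_eq_kern(2)[OF q Y_S[OF elim(3)]]) auto
    then show ?case using elim unfolding e set_lebesgue_integral_def by simp
  qed
qed

text \<open>The whole line has conditional probability 1; no computation with the product formula
  enters. The exceptional null set comes from the conditional probability and is inherited by all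
  moment identities.\<close>

lemma kern_total:
  assumes r: "0 < \<rho>" "\<rho> < 1"
  shows "AE \<omega> in M. (\<integral>x. kern q (\<rho>\<^sup>2) (\<rho> * Y t \<omega>) x \<partial>lborel) = 1"
proof -
  interpret sf: sigma_finite_subalgebra M "past t" by (rule sigma_finite_subalgebraI[OF past_subalgebra])
  have "AE \<omega> in M. real_cond_exp M (past t) (\<lambda>\<omega>. 1) \<omega> = 1"
    by (rule sf.real_cond_exp_F_meas) auto
  moreover have "AE \<omega> in M. real_cond_exp M (past t) (\<lambda>\<omega>. indicator UNIV (Y (t + lag \<rho>) \<omega>)) \<omega>
     = (\<integral>x. indicator UNIV x * kern q (\<rho>\<^sup>2) (\<rho> * Y t \<omega>) x \<partial>lborel)"
    by (rule ou_cond_prob[OF r]) simp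
  ultimately show ?thesis by eventually_elim simp
qed

lemma ou_cond_density:
  assumes r: "0 < \<rho>" "\<rho> < 1"
  shows "cond_density M (past t) (Y (t + lag \<rho>)) (\<lambda>z. kern q (\<rho>\<^sup>2) (\<rho> * Y t (fst z)) (snd z))"
proof (intro cond_density.intro cond_density_axioms.intro prob_space_axioms past_subalgebra Y_meas)
  have Yt[measurable]: "Y t \<in> borel_measurable (past t)" by (rule gen_sigma_measurable) simp
  show "(\<lambda>z. kern q (\<rho>\<^sup>2) (\<rho> * Y t (fst z)) (snd z)) \<in> borel_measurable (past t \<Otimes>\<^sub>M borel)"
    by (rule kern_measurable[OF q]) measurable
  show "0 \<le> kern q (\<rho>\<^sup>2) (\<rho> * Y t (fst z)) (snd z)" for z by (rule kern_nonneg[OF q])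
  show "integrable lborel (\<lambda>x. kern q (\<rho>\<^sup>2) (\<rho> * Y t (fst (\<omega>, x))) (snd (\<omega>, x)))" if "\<omega> \<in> space M" for \<omega>
    using kern_dom_integrable[OF Y_dom[OF that]] r by simp
  show "AE \<omega> in M. (\<integral>x. kern q (\<rho>\<^sup>2) (\<rho> * Y t (fst (\<omega>, x))) (snd (\<omega>, x)) \<partial>lborel) \<le> 1"
    using kern_total[OF r, of t] by auto
  fix B a assume B: "B \<in> sets (past t)"
  interpret sf: sigma_finite_subalgebra M "past t" by (rule sigma_finite_subalgebraI[OF past_subalgebra])
  have BM: "B \<in> sets M" using B past_subalgebra by (auto simp: subalgebra_def)
  have i: "integrable M (\<lambda>\<omega>. indicator B \<omega> * indicator {a<..} (Y (t + lag \<rho>) \<omega>) :: real)"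
    using BM by (intro integrable_const_bound[of _ 1]) (auto simp: indicator_def)
  have "(\<integral>\<omega>. indicator B \<omega> * indicator {a<..} (Y (t + lag \<rho>) \<omega>) \<partial>M)
    = (\<integral>\<omega>. indicator B \<omega> * real_cond_exp M (past t) (\<lambda>\<omega>. indicator {a<..} (Y (t + lag \<rho>) \<omega>)) \<omega> \<partial>M)"
    using B by (intro sf.real_cond_exp_intg(2)[symmetric] i) auto
  also have "\<dots> = (\<integral>\<omega>. indicator B \<omega> * (\<integral>x. indicator {a<..} x * kern q (\<rho>\<^sup>2) (\<rho> * Y t \<omega>) x \<partial>lborel) \<partial>M)"
  proof (rule integral_cong_AE)
    show m: "(\<lambda>\<omega>. indicator B \<omega> * real_cond_exp M (past t) (\<lambda>\<omega>. indicator {a<..} (Y (t + lag \<rho>) \<omega>)) \<omega>) \<in> borel_measurable M"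
      using BM by measurable
    show "AE \<omega> in M. indicator B \<omega> * real_cond_exp M (past t) (\<lambda>\<omega>. indicator {a<..} (Y (t + lag \<rho>) \<omega>)) \<omega>
       = indicator B \<omega> * (\<integral>x. indicator {a<..} x * kern q (\<rho>\<^sup>2) (\<rho> * Y t \<omega>) x \<partial>lborel)"
      using ou_cond_prob[OF r, of "{a<..}" t] by auto
    have "(\<lambda>(\<omega>, x). indicator {a<..} x * kern q (\<rho>\<^sup>2) (\<rho> * Y t \<omega>) x) \<in> borel_measurable (M \<Otimes>\<^sub>M lborel)"
    proof -
      have "(\<lambda>z. kern q (\<rho>\<^sup>2) (\<rho> * Y t (fst z)) (snd z)) \<in> borel_measurable (M \<Otimes>\<^sub>M lborel)"
        by (rule kern_measurable[OF q]) measurable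
      then show ?thesis by (simp add: case_prod_beta')
    qed
    from lborel.borel_measurable_lebesgue_integral[OF this]
    show "(\<lambda>\<omega>. indicator B \<omega> * (\<integral>x. indicator {a<..} x * kern q (\<rho>\<^sup>2) (\<rho> * Y t \<omega>) x \<partial>lborel)) \<in> borel_measurable M"
      using BM by simp
  qed
  finally show "(\<integral>\<omega>. indicator B \<omega> * indicator {a<..} (Y (t + lag \<rho>) \<omega>) \<partial>M) =
      (\<integral>\<omega>. indicator B \<omega> * (\<integral>x. indicator {a<..} x * kern q (\<rho>\<^sup>2) (\<rho> * Y t (fst (\<omega>, x))) (snd (\<omega>, x)) \<partial>lborel) \<partial>M)"
    by simp
qed

end

section \<open>Moment recursion, variance and conditional mean for |q| < 1\<close>

locale ou_lt_1 = ou +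
  assumes q1: "\<bar>q\<bar> < 1"
begin

lemmas q_lt = q_lt_1[OF q1]

definition "rad = 2 / sqrt (1 - q)"

lemma rad_pos: "0 < rad" using q_lt by (simp add: rad_def)

lemma support_iff: "(1 - q) * x\<^sup>2 \<le> 4 \<longleftrightarrow> \<bar>x\<bar> \<le> rad"
  using S_q_iff[OF q_lt(1), of x] q_lt by (auto simp: S_q_def rad_def)

lemma S_q_rad: "x \<in> S_q q \<longleftrightarrow> \<bar>x\<bar> \<le> rad"
  using S_q_iff[OF q_lt(1), of x] support_iff by simp

lemma Y_rad: "\<omega> \<in> space M \<Longrightarrow> \<bar>Y t \<omega>\<bar> \<le> rad"
  using Y_S S_q_rad by simp

lemma Y_bounded_integrable:
  fixes h :: "'a \<Rightarrow> real"
  assumes "h \<in> borel_measurable M" "AE \<omega> in M. \<bar>h \<omega>\<bar> \<le> B"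
  shows "integrable M h"
  using assms by (intro integrable_const_bound[of _ B]) auto

definition "mom k \<rho> y = (\<integral>x. x ^ k * kern q (\<rho>\<^sup>2) (\<rho> * y) x \<partial>lborel)"

lemma pow_int:
  assumes "mehler_dom q p s" shows "integrable lborel (\<lambda>x. x ^ k * kern q p s x)"
proof (rule kern_integrable[OF q fN_integrable assms, where B="rad ^ k"])
  show "\<bar>x ^ k\<bar> \<le> rad ^ k" if "(1 - q) * x\<^sup>2 \<le> 4" for x
    using that unfolding support_iff by (simp add: power_abs power_mono)
qed simp

lemma S_dom: "\<bar>y\<bar> \<le> rad \<Longrightarrow> \<bar>\<rho>\<bar> < 1 \<Longrightarrow> mehler_dom q (\<rho>\<^sup>2) (\<rho> * y)"
  by (rule f_CN_eq_kern(1)[OF q]) (simp_all add: S_q_rad)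

lemma mom_relation:
  assumes y: "\<bar>y\<bar> \<le> rad" and r: "\<bar>\<rho>\<bar> < 1"
  shows "(1 - \<rho>\<^sup>2)\<^sup>2 * mom k \<rho> y - (1 - q) * (1 + \<rho>\<^sup>2) * \<rho> * y * mom (k + 1) \<rho> y
      + (1 - q) * \<rho>\<^sup>2 * (mom (k + 2) \<rho> y + y\<^sup>2 * mom k \<rho> y)
    = (1 - \<rho>\<^sup>2) * (1 - \<rho>\<^sup>2 * q) * mom k (\<rho> * q) y"
proof -
  note d = S_dom[OF y r]
  let ?k = "kern q (\<rho>\<^sup>2) (\<rho> * y)"
  have sh: "?k x * mehler_den q (\<rho>\<^sup>2) (\<rho> * y) x 0 = (1 - \<rho>\<^sup>2) * (1 - \<rho>\<^sup>2 * q) * kern q ((\<rho> * q)\<^sup>2) (\<rho> * q * y) x" for x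
    using kern_shift(2)[OF q1 d, of x] by (simp add: power_mult_distrib mult_ac)
  have "(1 - \<rho>\<^sup>2) * (1 - \<rho>\<^sup>2 * q) * mom k (\<rho> * q) y
    = (\<integral>x. x ^ k * ((1 - \<rho>\<^sup>2) * (1 - \<rho>\<^sup>2 * q) * kern q ((\<rho> * q)\<^sup>2) (\<rho> * q * y) x) \<partial>lborel)"
    unfolding mom_def integral_mult_right_zero[symmetric] by (intro Bochner_Integration.integral_cong) (auto simp: mult_ac)
  also have "\<dots> = (\<integral>x. (1 - \<rho>\<^sup>2)\<^sup>2 * (x ^ k * ?k x) - (1 - q) * (1 + \<rho>\<^sup>2) * \<rho> * y * (x ^ (k + 1) * ?k x)
      + (1 - q) * \<rho>\<^sup>2 * (x ^ (k + 2) * ?k x) + (1 - q) * \<rho>\<^sup>2 * y\<^sup>2 * (x ^ k * ?k x) \<partial>lborel)"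
  proof (rule Bochner_Integration.integral_cong[OF refl])
    fix x
    show "x ^ k * ((1 - \<rho>\<^sup>2) * (1 - \<rho>\<^sup>2 * q) * kern q ((\<rho> * q)\<^sup>2) (\<rho> * q * y) x)
      = (1 - \<rho>\<^sup>2)\<^sup>2 * (x ^ k * ?k x) - (1 - q) * (1 + \<rho>\<^sup>2) * \<rho> * y * (x ^ (k + 1) * ?k x)
      + (1 - q) * \<rho>\<^sup>2 * (x ^ (k + 2) * ?k x) + (1 - q) * \<rho>\<^sup>2 * y\<^sup>2 * (x ^ k * ?k x)"
      unfolding sh[symmetric] mehler_den_def by (simp add: algebra_simps power_mult_distrib power_add power2_eq_square)
  qed
  also have "\<dots> = (1 - \<rho>\<^sup>2)\<^sup>2 * mom k \<rho> y - (1 - q) * (1 + \<rho>\<^sup>2) * \<rho> * y * mom (k + 1) \<rho> y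
      + (1 - q) * \<rho>\<^sup>2 * mom (k + 2) \<rho> y + (1 - q) * \<rho>\<^sup>2 * y\<^sup>2 * mom k \<rho> y"
    unfolding mom_def
    by (simp only: Bochner_Integration.integral_add Bochner_Integration.integral_diff Bochner_Integration.integrable_add
        Bochner_Integration.integrable_diff integrable_mult_right pow_int[OF d] integral_mult_right_zero)
  finally show ?thesis by (simp add: algebra_simps)
qed

lemma mom_minus: "mom k (- \<rho>) y = (- 1) ^ k * mom k \<rho> y"
proof -
  have "mom k (- \<rho>) y = (\<integral>x. x ^ k * kern q (\<rho>\<^sup>2) (\<rho> * y) (- x) \<partial>lborel)"
    unfolding mom_def using kern_minus[OF q1, of "\<rho>\<^sup>2" "\<rho> * y"] by simp
  also have "\<dots> = (\<integral>x. (- x) ^ k * kern q (\<rho>\<^sup>2) (\<rho> * y) x \<partial>lborel)"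
    using lborel_integral_real_affine[of "-1" "\<lambda>x. (- x) ^ k * kern q (\<rho>\<^sup>2) (\<rho> * y) x" 0] by simp
  also have "\<dots> = (\<integral>x. (- 1) ^ k * (x ^ k * kern q (\<rho>\<^sup>2) (\<rho> * y) x) \<partial>lborel)"
    by (subst power_minus) (simp only: mult.assoc)
  finally show ?thesis unfolding mom_def by simp
qed

lemma mom_0: "\<bar>\<rho>\<bar> < 1 \<Longrightarrow> AE \<omega> in M. mom 0 \<rho> (Y t \<omega>) = 1"
proof -
  assume r: "\<bar>\<rho>\<bar> < 1"
  consider "\<rho> = 0" | "0 < \<rho>" | "\<rho> < 0" by linarith
  then show ?thesis
  proof cases
    case 1
    then show ?thesis using fN_integral by (simp add: mom_def f_N_eq_kern[OF q, symmetric])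
  next
    case 2
    then show ?thesis using kern_total[of \<rho> t] r by (simp add: mom_def)
  next
    case 3
    then show ?thesis using kern_total[of "- \<rho>" t] r mom_minus[of 0 "- \<rho>"] by (simp add: mom_def)
  qed
qed

lemma mom_meas [measurable]: "(\<lambda>y. mom k \<rho> y) \<in> borel_measurable borel"
proof -
  have "(\<lambda>z. kern q (\<rho>\<^sup>2) (\<rho> * fst z) (snd z)) \<in> borel_measurable (borel \<Otimes>\<^sub>M lborel)"
    by (rule kern_measurable[OF q]) measurable
  then have "(\<lambda>(y, x). x ^ k * kern q (\<rho>\<^sup>2) (\<rho> * y) x) \<in> borel_measurable (borel \<Otimes>\<^sub>M lborel)"
    by (simp add: case_prod_beta')
  from lborel.borel_measurable_lebesgue_integral[OF this] show ?thesis unfolding mom_def .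
qed

lemma mom_bound: "\<bar>\<rho>\<bar> < 1 \<Longrightarrow> \<exists>C. \<forall>y. \<bar>y\<bar> \<le> rad \<longrightarrow> \<bar>mom k \<rho> y\<bar> \<le> C"
proof (intro exI allI impI)
  fix y assume r: "\<bar>\<rho>\<bar> < 1" and y: "\<bar>y\<bar> \<le> rad"
  have p: "\<rho>\<^sup>2 < 1" using r by (simp add: abs_square_less_1)
  note d = S_dom[OF y r]
  let ?K = "exp (20 / (1 - sqrt (\<rho>\<^sup>2)) ^ 4 / (1 - \<bar>q\<bar>))"
  have "\<bar>mom k \<rho> y\<bar> \<le> (\<integral>x. \<bar>x ^ k * kern q (\<rho>\<^sup>2) (\<rho> * y) x\<bar> \<partial>lborel)"
    unfolding mom_def by (rule integral_abs_bound)
  also have "\<dots> \<le> (\<integral>x. rad ^ k * ?K * f_N q x \<partial>lborel)"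
  proof (rule integral_mono)
    show "integrable lborel (\<lambda>x. \<bar>x ^ k * kern q (\<rho>\<^sup>2) (\<rho> * y) x\<bar>)" using pow_int[OF d] by simp
    show "integrable lborel (\<lambda>x. rad ^ k * ?K * f_N q x)" using fN_integrable by simp
    fix x
    show "\<bar>x ^ k * kern q (\<rho>\<^sup>2) (\<rho> * y) x\<bar> \<le> rad ^ k * ?K * f_N q x"
    proof (cases "(1 - q) * x\<^sup>2 \<le> 4")
      case True
      have "\<bar>x\<bar> ^ k * kern q (\<rho>\<^sup>2) (\<rho> * y) x \<le> rad ^ k * (?K * f_N q x)"
      proof (rule mult_mono)
        show "\<bar>x\<bar> ^ k \<le> rad ^ k" using True unfolding support_iff by (intro power_mono) auto
        show "kern q (\<rho>\<^sup>2) (\<rho> * y) x \<le> ?K * f_N q x" by (rule kern_bound[OF q1 d order_refl p])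
      qed (use rad_pos kern_nonneg[OF q] in auto)
      then show ?thesis using kern_nonneg[OF q, of "\<rho>\<^sup>2" "\<rho> * y" x] by (simp add: abs_mult power_abs mult.assoc)
    qed (use fN_nonneg[of x] rad_pos in \<open>simp add: kern_outside[OF q1]\<close>)
  qed
  also have "\<dots> = rad ^ k * ?K" using fN_integral by simp
  finally show "\<bar>mom k \<rho> y\<bar> \<le> rad ^ k * ?K" .
qed

definition "v = (\<integral>x. f_N q x * x\<^sup>2 \<partial>lborel)"

lemma Y_sq: "(\<integral>\<omega>. (Y t \<omega>)\<^sup>2 \<partial>M) = v"
  unfolding v_def by (rule Y_integral) simp

lemma fN_pow_int: "integrable lborel (\<lambda>x. x ^ k * f_N q x)"
  using pow_int[of 0 0 k] by (simp add: f_N_eq_kern[OF q] mehler_dom_def)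

lemma fN_mean: "(\<integral>x. x * f_N q x \<partial>lborel) = 0"
  using mom_minus[of 1 0 0] by (simp add: mom_def f_N_eq_kern[OF q, symmetric])

lemma Y_int [simp]:
  "integrable M (\<lambda>\<omega>. Y s \<omega> * Y t \<omega>)" "integrable M (\<lambda>\<omega>. (Y t \<omega>)\<^sup>2)" "integrable M (Y t)"
proof -
  have "AE \<omega> in M. \<bar>Y s \<omega> * Y t \<omega>\<bar> \<le> rad * rad" for s
  proof (rule AE_I2)
    fix \<omega> assume w: "\<omega> \<in> space M"
    show "\<bar>Y s \<omega> * Y t \<omega>\<bar> \<le> rad * rad"
      unfolding abs_mult by (rule mult_mono[OF Y_rad[OF w] Y_rad[OF w]]) (use rad_pos in auto)
  qed
  then show 1: "integrable M (\<lambda>\<omega>. Y s \<omega> * Y t \<omega>)" for s by (rule Y_bounded_integrable[rotated]) simp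
  from 1[of t] show "integrable M (\<lambda>\<omega>. (Y t \<omega>)\<^sup>2)" by (simp add: power2_eq_square)
  have "AE \<omega> in M. \<bar>Y t \<omega>\<bar> \<le> rad" using AE_space by eventually_elim (rule Y_rad)
  then show "integrable M (Y t)" by (rule Y_bounded_integrable[rotated]) simp
qed

text \<open>The last clause, with an earlier time \<open>s\<close>, is where the Markov property
  goes beyond the pair of times \<open>t\<close> and \<open>t + lag \<rho>\<close>;
  \<open>mom_1_sq\<close> uses it to join two successive lags.\<close>

lemma lag_product:
  assumes r: "0 < \<rho>" "\<rho> < 1"
  shows "(\<integral>\<omega>. Y t \<omega> * Y (t + lag \<rho>) \<omega> \<partial>M) = (\<integral>\<omega>. Y t \<omega> * mom 1 \<rho> (Y t \<omega>) \<partial>M)"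
    "integrable M (\<lambda>\<omega>. Y t \<omega> * mom 1 \<rho> (Y t \<omega>))"
    "(\<integral>\<omega>. mom 2 \<rho> (Y t \<omega>) \<partial>M) = v"
    "integrable M (\<lambda>\<omega>. mom 2 \<rho> (Y t \<omega>))"
    "s \<le> t \<Longrightarrow> (\<integral>\<omega>. Y s \<omega> * Y (t + lag \<rho>) \<omega> \<partial>M) = (\<integral>\<omega>. Y s \<omega> * mom 1 \<rho> (Y t \<omega>) \<partial>M)"
proof -
  interpret cd: cond_density M "past t" "Y (t + lag \<rho>)" "\<lambda>z. kern q (\<rho>\<^sup>2) (\<rho> * Y t (fst z)) (snd z)"
    by (rule ou_cond_density[OF r])
  have Ym[measurable]: "s \<le> t \<Longrightarrow> Y s \<in> borel_measurable (past t)" for s by (rule gen_sigma_measurable) simp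
  have f: "(\<lambda>z. Y s (fst z) * snd z) \<in> borel_measurable (past t \<Otimes>\<^sub>M borel)" if "s \<le> t" for s
    using Ym[OF that] by measurable
  have g: "(\<lambda>z. (snd z)\<^sup>2) \<in> borel_measurable (past t \<Otimes>\<^sub>M (borel :: real measure))" by measurable
  have i: "integrable M (\<lambda>\<omega>. Y s (fst (\<omega>, Y (t + lag \<rho>) \<omega>)) * snd (\<omega>, Y (t + lag \<rho>) \<omega>))" for s by simp
  have i2: "integrable M (\<lambda>\<omega>. (snd (\<omega>, Y (t + lag \<rho>) \<omega>))\<^sup>2)" by simp
  have m: "(\<integral>x. Y s (fst (\<omega>, x)) * snd (\<omega>, x) * kern q (\<rho>\<^sup>2) (\<rho> * Y t (fst (\<omega>, x))) (snd (\<omega>, x)) \<partial>lborel) = Y s \<omega> * mom 1 \<rho> (Y t \<omega>)" for \<omega> s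
    unfolding mom_def by (simp add: mult.assoc)
  have m2: "(\<integral>x. (snd (\<omega>, x))\<^sup>2 * kern q (\<rho>\<^sup>2) (\<rho> * Y t (fst (\<omega>, x))) (snd (\<omega>, x)) \<partial>lborel) = mom 2 \<rho> (Y t \<omega>)" for \<omega>
    unfolding mom_def by simp
  show 1: "(\<integral>\<omega>. Y s \<omega> * Y (t + lag \<rho>) \<omega> \<partial>M) = (\<integral>\<omega>. Y s \<omega> * mom 1 \<rho> (Y t \<omega>) \<partial>M)" if "s \<le> t" for s
    using cd.cond_exp_density(4)[OF f[OF that] i] unfolding m by simp
  show "(\<integral>\<omega>. Y t \<omega> * Y (t + lag \<rho>) \<omega> \<partial>M) = (\<integral>\<omega>. Y t \<omega> * mom 1 \<rho> (Y t \<omega>) \<partial>M)" by (rule 1) simp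
  show "integrable M (\<lambda>\<omega>. Y t \<omega> * mom 1 \<rho> (Y t \<omega>))"
    using cd.cond_exp_density(1)[OF f[OF order_refl] i] unfolding m .
  show "integrable M (\<lambda>\<omega>. mom 2 \<rho> (Y t \<omega>))"
    using cd.cond_exp_density(1)[OF g i2] unfolding m2 .
  show "(\<integral>\<omega>. mom 2 \<rho> (Y t \<omega>) \<partial>M) = v"
    using cd.cond_exp_density(4)[OF g i2] Y_sq[of "t + lag \<rho>"] unfolding m2 by simp
qed

text \<open>This is \<open>mom_relation\<close> with \<open>k = 0\<close> and both zeroth moments
  equal to 1, divided by \<open>(1 - q) * \<rho>\<close>.\<close>

lemma mom_relation_0:
  assumes r: "\<bar>\<rho>\<bar> < 1" "\<rho> \<noteq> 0"
  shows "AE \<omega> in M. (1 + \<rho>\<^sup>2) * (Y t \<omega> * mom 1 \<rho> (Y t \<omega>)) = \<rho> * (mom 2 \<rho> (Y t \<omega>) + (Y t \<omega>)\<^sup>2 - 1 + \<rho>\<^sup>2)"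
proof -
  have rq: "\<bar>\<rho> * q\<bar> < 1" using r q1 mult_strict_mono[of "\<bar>\<rho>\<bar>" 1 "\<bar>q\<bar>" 1] by (simp add: abs_mult)
  show ?thesis using mom_0[OF r(1), of t] mom_0[OF rq, of t] AE_space
  proof eventually_elim
    case (elim \<omega>)
    define y m1 m2 where "y = Y t \<omega>" and "m1 = mom 1 \<rho> (Y t \<omega>)" and "m2 = mom 2 \<rho> (Y t \<omega>)"
    have "(1 - \<rho>\<^sup>2)\<^sup>2 - (1 - q) * (1 + \<rho>\<^sup>2) * \<rho> * y * m1 + (1 - q) * \<rho>\<^sup>2 * (m2 + y\<^sup>2) = (1 - \<rho>\<^sup>2) * (1 - \<rho>\<^sup>2 * q)"
      using mom_relation[OF Y_rad[OF elim(3), of t] r(1), of 0] elim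
      unfolding y_def m1_def m2_def One_nat_def[symmetric] by (simp add: numeral_2_eq_2)
    then have "(1 - q) * \<rho> * ((1 + \<rho>\<^sup>2) * (y * m1)) = (1 - q) * \<rho> * (\<rho> * (m2 + y\<^sup>2 - 1 + \<rho>\<^sup>2))"
      by (simp add: algebra_simps power2_eq_square)
    then show ?case using r(2) q_lt(3) unfolding y_def m1_def m2_def by simp
  qed
qed

text \<open>The relation \<open>mom_relation_0\<close> is integrated. The mean of
  \<open>mom 2 \<rho> (Y t)\<close> is \<open>v\<close>, because \<open>Y (t + lag \<rho>)\<close>
  and \<open>Y t\<close> have the same law.\<close>

lemma lag_covariance:
  assumes r: "0 < \<rho>" "\<rho> < 1"
  shows "(1 + \<rho>\<^sup>2) * (\<integral>\<omega>. Y t \<omega> * Y (t + lag \<rho>) \<omega> \<partial>M) = \<rho> * (2 * v - 1 + \<rho>\<^sup>2)"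
proof -
  have "(1 + \<rho>\<^sup>2) * (\<integral>\<omega>. Y t \<omega> * Y (t + lag \<rho>) \<omega> \<partial>M) = (\<integral>\<omega>. (1 + \<rho>\<^sup>2) * (Y t \<omega> * mom 1 \<rho> (Y t \<omega>)) \<partial>M)"
    unfolding lag_product(1)[OF r] by simp
  also have "\<dots> = (\<integral>\<omega>. \<rho> * (mom 2 \<rho> (Y t \<omega>) + (Y t \<omega>)\<^sup>2 - 1 + \<rho>\<^sup>2) \<partial>M)"
    using mom_relation_0[of \<rho> t] r by (intro integral_cong_AE) auto
  also have "\<dots> = \<rho> * (v + v - 1 + \<rho>\<^sup>2)"
    using lag_product(3,4)[OF r, of t] Y_sq[of t] by (simp add: prob_space)
  finally show ?thesis by simp
qed

text \<open>The expansion \<open>mehler_expansion\<close> is integrated against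
  \<open>x * f_N q x\<close>. Its constant term vanishes because \<open>f_N\<close> is even, and the
  linear term contributes \<open>\<rho> * y * v\<close>.\<close>

lemma mom_1_expansion:
  obtains C \<epsilon> where "0 < \<epsilon>" "\<epsilon> < 1"
    "\<And>\<rho> y. 0 < \<rho> \<Longrightarrow> \<rho> < \<epsilon> \<Longrightarrow> \<bar>y\<bar> \<le> rad \<Longrightarrow> \<bar>mom 1 \<rho> y - \<rho> * v * y\<bar> \<le> C * \<rho>\<^sup>2"
proof -
  obtain C \<epsilon> where e: "0 < \<epsilon>" "\<epsilon> < 1" and C:
    "\<And>\<rho> x y. 0 < \<rho> \<Longrightarrow> \<rho> < \<epsilon> \<Longrightarrow> (1 - q) * x\<^sup>2 \<le> 4 \<Longrightarrow> (1 - q) * y\<^sup>2 \<le> 4 \<Longrightarrow>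
       \<bar>exp (\<Sum>k. mehler_ln q (\<rho>\<^sup>2) (\<rho> * y) x k) - 1 - \<rho> * x * y\<bar> \<le> C * \<rho>\<^sup>2"
    by (rule mehler_expansion[OF q1]) blast
  have "\<bar>mom 1 \<rho> y - \<rho> * v * y\<bar> \<le> (rad * C) * \<rho>\<^sup>2" if r: "0 < \<rho>" "\<rho> < \<epsilon>" and y: "\<bar>y\<bar> \<le> rad" for \<rho> y
  proof -
    have r1: "\<bar>\<rho>\<bar> < 1" using r e by auto
    note d = S_dom[OF y r1]
    let ?h = "\<lambda>x. x ^ 1 * kern q (\<rho>\<^sup>2) (\<rho> * y) x - x ^ 1 * f_N q x - \<rho> * y * (x ^ 2 * f_N q x)"
    have ih: "integrable lborel ?h"
      by (intro Bochner_Integration.integrable_diff integrable_mult_right pow_int[OF d] fN_pow_int)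
    have "(\<integral>x. ?h x \<partial>lborel) = (\<integral>x. x ^ 1 * kern q (\<rho>\<^sup>2) (\<rho> * y) x - x ^ 1 * f_N q x \<partial>lborel) - (\<integral>x. \<rho> * y * (x ^ 2 * f_N q x) \<partial>lborel)"
      by (intro Bochner_Integration.integral_diff Bochner_Integration.integrable_diff integrable_mult_right pow_int[OF d] fN_pow_int)
    also have "(\<integral>x. x ^ 1 * kern q (\<rho>\<^sup>2) (\<rho> * y) x - x ^ 1 * f_N q x \<partial>lborel) = mom 1 \<rho> y - (\<integral>x. x ^ 1 * f_N q x \<partial>lborel)"
      unfolding mom_def by (intro Bochner_Integration.integral_diff pow_int[OF d] fN_pow_int)
    also have "(\<integral>x. x ^ 1 * f_N q x \<partial>lborel) = 0" using fN_mean by simp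
    also have "(\<integral>x. \<rho> * y * (x ^ 2 * f_N q x) \<partial>lborel) = \<rho> * y * v"
      unfolding v_def by (simp add: mult.commute[of "f_N q _"])
    finally have "(\<integral>x. ?h x \<partial>lborel) = mom 1 \<rho> y - 0 - \<rho> * y * v" .
    then have "\<bar>mom 1 \<rho> y - \<rho> * v * y\<bar> = \<bar>\<integral>x. ?h x \<partial>lborel\<bar>" by (simp add: mult_ac)
    also have "\<dots> \<le> (\<integral>x. \<bar>?h x\<bar> \<partial>lborel)" by (rule integral_abs_bound)
    also have "\<dots> \<le> (\<integral>x. rad * C * \<rho>\<^sup>2 * f_N q x \<partial>lborel)"
    proof (rule integral_mono)
      show "integrable lborel (\<lambda>x. \<bar>?h x\<bar>)" using ih by (rule integrable_abs)
      show "integrable lborel (\<lambda>x. rad * C * \<rho>\<^sup>2 * f_N q x)" using fN_integrable by simp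
      fix x
      show "\<bar>?h x\<bar> \<le> rad * C * \<rho>\<^sup>2 * f_N q x"
      proof (cases "(1 - q) * x\<^sup>2 \<le> 4")
        case True
        let ?E = "exp (\<Sum>k. mehler_ln q (\<rho>\<^sup>2) (\<rho> * y) x k)"
        have "kern q (\<rho>\<^sup>2) (\<rho> * y) x = f_N q x * ?E" using True d q_lt(3) by (simp add: kern_def)
        then have "?h x = x * (f_N q x * (?E - 1 - \<rho> * x * y))" by (simp add: algebra_simps power2_eq_square)
        then have "\<bar>?h x\<bar> = \<bar>x\<bar> * (f_N q x * \<bar>?E - 1 - \<rho> * x * y\<bar>)" using fN_nonneg[of x] by (simp add: abs_mult)
        also have "\<dots> \<le> rad * (f_N q x * (C * \<rho>\<^sup>2))"
        proof (rule mult_mono)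
          show "\<bar>x\<bar> \<le> rad" using True unfolding support_iff .
          show "f_N q x * \<bar>?E - 1 - \<rho> * x * y\<bar> \<le> f_N q x * (C * \<rho>\<^sup>2)"
            using y by (intro mult_left_mono[OF C[OF r True] fN_nonneg]) (simp add: support_iff)
        qed (use rad_pos fN_nonneg[of x] in auto)
        finally show ?thesis by (simp add: mult_ac)
      qed (simp add: kern_outside[OF q1] f_N_outside[OF q1])
    qed
    also have "\<dots> = rad * C * \<rho>\<^sup>2" using fN_integral by simp
    finally show ?thesis .
  qed
  then show thesis using that[OF e] by blast
qed

text \<open>Compared with \<open>mom_1_expansion\<close>, the identity \<open>lag_covariance\<close> gives \<open>2 * v - 1 = v\<^sup>2\<close> as \<open>\<rho> \<rightarrow> 0\<close>.\<close>

lemma v_eq_1: "v = 1"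
proof -
  obtain C \<epsilon> where e: "0 < \<epsilon>" "\<epsilon> < 1" and C:
    "\<And>\<rho> y. 0 < \<rho> \<Longrightarrow> \<rho> < \<epsilon> \<Longrightarrow> \<bar>y\<bar> \<le> rad \<Longrightarrow> \<bar>mom 1 \<rho> y - \<rho> * v * y\<bar> \<le> C * \<rho>\<^sup>2"
    by (rule mom_1_expansion) blast
  \<comment> \<open>The covariance divided by \<open>\<rho>\<close> equals the first fraction by
    \<open>lag_covariance\<close> and equals \<open>v\<^sup>2\<close> up to an error of order
    \<open>\<rho>\<close> by \<open>mom_1_expansion\<close>.\<close>
  have "\<bar>(2 * v - 1 + \<rho>\<^sup>2) / (1 + \<rho>\<^sup>2) - v\<^sup>2\<bar> \<le> rad * C * \<rho>" if r: "0 < \<rho>" "\<rho> < \<epsilon>" for \<rho>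
  proof -
    have r1: "\<rho> < 1" using r e by simp
    let ?c = "\<integral>\<omega>. Y 0 \<omega> * mom 1 \<rho> (Y 0 \<omega>) \<partial>M"
    have pos: "0 < 1 + \<rho>\<^sup>2" by (simp add: add_pos_nonneg)
    have "(1 + \<rho>\<^sup>2) * ?c = \<rho> * (2 * v - 1 + \<rho>\<^sup>2)"
      using lag_covariance[OF r(1) r1, of 0] lag_product(1)[OF r(1) r1, of 0] by simp
    then have c: "?c = \<rho> * ((2 * v - 1 + \<rho>\<^sup>2) / (1 + \<rho>\<^sup>2))" using pos by (simp add: field_simps)
    have ceq: "?c - \<rho> * v * v = (\<integral>\<omega>. Y 0 \<omega> * mom 1 \<rho> (Y 0 \<omega>) - \<rho> * v * (Y 0 \<omega>)\<^sup>2 \<partial>M)"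
      using lag_product(2)[OF r(1) r1, of 0] Y_sq[of 0] by simp
    have "\<bar>?c - \<rho> * v * v\<bar> \<le> (\<integral>\<omega>. \<bar>Y 0 \<omega> * mom 1 \<rho> (Y 0 \<omega>) - \<rho> * v * (Y 0 \<omega>)\<^sup>2\<bar> \<partial>M)"
      unfolding ceq by (rule integral_abs_bound)
    also have "\<dots> \<le> (\<integral>\<omega>. rad * (C * \<rho>\<^sup>2) \<partial>M)"
    proof (rule integral_mono)
      show "integrable M (\<lambda>\<omega>. \<bar>Y 0 \<omega> * mom 1 \<rho> (Y 0 \<omega>) - \<rho> * v * (Y 0 \<omega>)\<^sup>2\<bar>)"
      proof (rule integrable_abs)
        have "integrable M (\<lambda>\<omega>. \<rho> * v * (Y 0 \<omega>)\<^sup>2)" by simp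
        from Bochner_Integration.integrable_diff[OF lag_product(2)[OF r(1) r1, of 0] this]
        show "integrable M (\<lambda>\<omega>. Y 0 \<omega> * mom 1 \<rho> (Y 0 \<omega>) - \<rho> * v * (Y 0 \<omega>)\<^sup>2)" .
      qed
      fix \<omega> assume w: "\<omega> \<in> space M"
      have "\<bar>Y 0 \<omega> * mom 1 \<rho> (Y 0 \<omega>) - \<rho> * v * (Y 0 \<omega>)\<^sup>2\<bar> = \<bar>Y 0 \<omega>\<bar> * \<bar>mom 1 \<rho> (Y 0 \<omega>) - \<rho> * v * Y 0 \<omega>\<bar>"
        unfolding abs_mult[symmetric] by (simp add: algebra_simps power2_eq_square)
      also have "\<dots> \<le> rad * (C * \<rho>\<^sup>2)"
        by (rule mult_mono[OF Y_rad[OF w] C[OF r Y_rad[OF w]]]) (use rad_pos in auto)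
      finally show "\<bar>Y 0 \<omega> * mom 1 \<rho> (Y 0 \<omega>) - \<rho> * v * (Y 0 \<omega>)\<^sup>2\<bar> \<le> rad * (C * \<rho>\<^sup>2)" .
    qed simp
    also have "\<dots> = rad * (C * \<rho>\<^sup>2)" by (simp add: prob_space)
    finally have "\<bar>?c - \<rho> * v * v\<bar> \<le> rad * (C * \<rho>\<^sup>2)" .
    then have "\<bar>\<rho> * ((2 * v - 1 + \<rho>\<^sup>2) / (1 + \<rho>\<^sup>2) - v\<^sup>2)\<bar> \<le> \<rho> * (rad * C * \<rho>)"
      unfolding c by (simp add: algebra_simps power2_eq_square)
    then show ?thesis using r by (simp add: abs_mult)
  qed
  then have ev: "\<forall>\<^sub>F \<rho> in at_right 0. \<bar>(2 * v - 1 + \<rho>\<^sup>2) / (1 + \<rho>\<^sup>2) - v\<^sup>2\<bar> \<le> rad * C * \<rho>"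
    unfolding eventually_at_right_field using e(1) by blast
  have "((\<lambda>\<rho>. \<bar>(2 * v - 1 + \<rho>\<^sup>2) / (1 + \<rho>\<^sup>2) - v\<^sup>2\<bar>) \<longlongrightarrow> \<bar>(2 * v - 1 + 0\<^sup>2) / (1 + 0\<^sup>2) - v\<^sup>2\<bar>) (at_right (0::real))"
    by (intro tendsto_intros) auto
  moreover have "((\<lambda>\<rho>. rad * C * \<rho>) \<longlongrightarrow> rad * C * 0) (at_right (0::real))" by (intro tendsto_intros)
  ultimately have "\<bar>(2 * v - 1 + 0\<^sup>2) / (1 + 0\<^sup>2) - v\<^sup>2\<bar> \<le> rad * C * 0"
    using ev by (intro tendsto_le[of "at_right (0::real)"]) auto
  then have "(v - 1)\<^sup>2 = 0" by (simp add: power2_eq_square algebra_simps)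
  then show ?thesis by simp
qed

lemma covariance:
  assumes r: "0 < \<rho>" "\<rho> < 1"
  shows "(\<integral>\<omega>. Y t \<omega> * Y (t + lag \<rho>) \<omega> \<partial>M) = \<rho>"
proof -
  have "(1 + \<rho>\<^sup>2) * (\<integral>\<omega>. Y t \<omega> * Y (t + lag \<rho>) \<omega> \<partial>M) = (1 + \<rho>\<^sup>2) * \<rho>"
    using lag_covariance[OF r, of t] v_eq_1 by (simp add: algebra_simps)
  moreover have "1 + \<rho>\<^sup>2 \<noteq> 0" by (metis add_pos_nonneg less_irrefl zero_le_power2 zero_less_one)
  ultimately show ?thesis by simp
qed

text \<open>Detailed balance: \<open>kern / f_N\<close> involves \<open>x\<close> and
  \<open>z\<close> only through \<open>x * z\<close> and \<open>x\<^sup>2 + z\<^sup>2\<close>, so it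
  is symmetric in them.\<close>

lemma kern_reversible:
  "f_N q z * kern q (\<rho>\<^sup>2) (\<rho> * z) x = f_N q x * kern q (\<rho>\<^sup>2) (\<rho> * x) z" if r: "\<bar>\<rho>\<bar> < 1"
proof (cases "\<bar>x\<bar> \<le> rad \<and> \<bar>z\<bar> \<le> rad")
  case True
  have "mehler_ln q (\<rho>\<^sup>2) (\<rho> * z) x = mehler_ln q (\<rho>\<^sup>2) (\<rho> * x) z"
  proof
    fix k
    have "mehler_den q (\<rho>\<^sup>2) (\<rho> * z) x k = mehler_den q (\<rho>\<^sup>2) (\<rho> * x) z k"
      unfolding mehler_den_def by (simp only: power_mult_distrib mult_ac add_ac)
    then show "mehler_ln q (\<rho>\<^sup>2) (\<rho> * z) x k = mehler_ln q (\<rho>\<^sup>2) (\<rho> * x) z k"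
      by (simp add: mehler_ln_def)
  qed
  then show ?thesis
    using True S_dom[OF _ r, of x] S_dom[OF _ r, of z] q_lt(3) by (simp add: kern_def support_iff)
next
  case False
  then have "f_N q x = 0 \<and> kern q (\<rho>\<^sup>2) (\<rho> * z) x = 0 \<or> f_N q z = 0 \<and> kern q (\<rho>\<^sup>2) (\<rho> * x) z = 0"
    using f_N_outside[OF q1] kern_outside[OF q1] unfolding support_iff by auto
  then show ?thesis by auto
qed

text \<open>By reversibility the second moment of \<open>E (Y (t + lag \<rho>) | Y t)\<close> is the covariance at the doubled lag.\<close>

lemma mom_1_sq:
  assumes r: "0 < \<rho>" "\<rho> < 1"
  shows "(\<integral>\<omega>. (mom 1 \<rho> (Y t \<omega>))\<^sup>2 \<partial>M) = \<rho>\<^sup>2" "integrable M (\<lambda>\<omega>. (mom 1 \<rho> (Y t \<omega>))\<^sup>2)"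
proof -
  have ra: "\<bar>\<rho>\<bar> < 1" using r by simp
  define h where "h = mom 1 \<rho>"
  have [measurable]: "h \<in> borel_measurable borel" unfolding h_def by (rule mom_meas)
  obtain C where C: "\<And>y. \<bar>y\<bar> \<le> rad \<Longrightarrow> \<bar>h y\<bar> \<le> C" unfolding h_def using mom_bound[OF ra] by blast
  have C0: "0 \<le> C" using C[of 0] rad_pos by simp
  show "integrable M (\<lambda>\<omega>. (mom 1 \<rho> (Y t \<omega>))\<^sup>2)"
  proof (rule Y_bounded_integrable)
    show "AE \<omega> in M. \<bar>(mom 1 \<rho> (Y t \<omega>))\<^sup>2\<bar> \<le> C\<^sup>2"
    proof (rule AE_I2)
      fix \<omega> assume "\<omega> \<in> space M"
      from C[OF Y_rad[OF this, of t]] show "\<bar>(mom 1 \<rho> (Y t \<omega>))\<^sup>2\<bar> \<le> C\<^sup>2"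
        by (simp add: h_def abs_le_square_iff[symmetric] C0)
    qed
  qed simp
  \<comment> \<open>Three equally spaced times \<open>?s\<close>, \<open>t\<close> and
    \<open>t + lag \<rho>\<close>. The outer two are \<open>lag (\<rho>\<^sup>2)\<close> apart, so
    their covariance is \<open>\<rho>\<^sup>2\<close>.\<close>
  let ?s = "t - lag \<rho>"
  have s: "?s + lag \<rho> = t" "?s \<le> t" using lag(1)[OF r] by auto
  have r2: "0 < \<rho>\<^sup>2" "\<rho>\<^sup>2 < 1" using r ra by (auto simp: abs_square_less_1)
  have l2: "?s + lag (\<rho>\<^sup>2) = t + lag \<rho>" using r alpha by (simp add: ln_realpow field_simps)
  have "\<rho>\<^sup>2 = (\<integral>\<omega>. Y ?s \<omega> * Y (t + lag \<rho>) \<omega> \<partial>M)"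
    using covariance[OF r2, of ?s] unfolding l2 by simp
  also have "\<dots> = (\<integral>\<omega>. Y ?s \<omega> * h (Y t \<omega>) \<partial>M)"
    unfolding h_def by (rule lag_product(5)[OF r s(2)])
  also have "\<dots> = (\<integral>\<omega>. (\<integral>x. Y ?s \<omega> * h x * kern q (\<rho>\<^sup>2) (\<rho> * Y ?s \<omega>) x \<partial>lborel) \<partial>M)"
  proof -
    interpret cd: cond_density M "past ?s" "Y t" "\<lambda>z. kern q (\<rho>\<^sup>2) (\<rho> * Y ?s (fst z)) (snd z)"
      using ou_cond_density[OF r, of ?s] unfolding s(1) .
    have [measurable]: "Y ?s \<in> borel_measurable (past ?s)" by (rule gen_sigma_measurable) simp
    have f: "(\<lambda>z. Y ?s (fst z) * h (snd z)) \<in> borel_measurable (past ?s \<Otimes>\<^sub>M borel)" by measurable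
    have "integrable M (\<lambda>\<omega>. Y ?s (fst (\<omega>, Y t \<omega>)) * h (snd (\<omega>, Y t \<omega>)))"
    proof (rule Y_bounded_integrable)
      show "AE \<omega> in M. \<bar>Y ?s (fst (\<omega>, Y t \<omega>)) * h (snd (\<omega>, Y t \<omega>))\<bar> \<le> rad * C"
      proof (rule AE_I2)
        fix \<omega> assume w: "\<omega> \<in> space M"
        show "\<bar>Y ?s (fst (\<omega>, Y t \<omega>)) * h (snd (\<omega>, Y t \<omega>))\<bar> \<le> rad * C"
          using rad_pos unfolding abs_mult fst_conv snd_conv by (intro mult_mono C Y_rad w) auto
      qed
    qed simp
    from cd.cond_exp_density(4)[OF f this] show ?thesis by simp
  qed
  also have "\<dots> = (\<integral>z. f_N q z * (\<integral>x. z * h x * kern q (\<rho>\<^sup>2) (\<rho> * z) x \<partial>lborel) \<partial>lborel)"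
  proof (rule Y_integral(1))
    have "(\<lambda>w. kern q (\<rho>\<^sup>2) (\<rho> * fst w) (snd w)) \<in> borel_measurable (borel \<Otimes>\<^sub>M lborel)"
      by (rule kern_measurable[OF q]) measurable
    then have "(\<lambda>(z, x). z * h x * kern q (\<rho>\<^sup>2) (\<rho> * z) x) \<in> borel_measurable (borel \<Otimes>\<^sub>M lborel)"
      by (simp add: case_prod_beta')
    from lborel.borel_measurable_lebesgue_integral[OF this]
    show "(\<lambda>z. \<integral>x. z * h x * kern q (\<rho>\<^sup>2) (\<rho> * z) x \<partial>lborel) \<in> borel_measurable borel" .
  qed
  also have "\<dots> = (\<integral>z. (\<integral>x. z * h x * (f_N q z * kern q (\<rho>\<^sup>2) (\<rho> * z) x) \<partial>lborel) \<partial>lborel)"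
    unfolding integral_mult_right_zero[symmetric] by (simp add: mult_ac)
  also have "\<dots> = (\<integral>x. (\<integral>z. z * h x * (f_N q z * kern q (\<rho>\<^sup>2) (\<rho> * z) x) \<partial>lborel) \<partial>lborel)"
  proof (rule lborel_pair.Fubini_integral[symmetric, of "\<lambda>z x. z * h x * (f_N q z * kern q (\<rho>\<^sup>2) (\<rho> * z) x)"])
    let ?K = "exp (20 / (1 - sqrt (\<rho>\<^sup>2)) ^ 4 / (1 - \<bar>q\<bar>))"
    note fm[measurable] = f_N_measurable[OF q1]
    have km: "(\<lambda>w. kern q (\<rho>\<^sup>2) (\<rho> * fst w) (snd w)) \<in> borel_measurable (lborel \<Otimes>\<^sub>M lborel)"
      by (rule kern_measurable[OF q]) measurable
    \<comment> \<open>Majorant for Fubini: on the support \<open>z * h x\<close> is bounded and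
      \<open>kern\<close> is at most a multiple of \<open>f_N\<close>, which leaves a product of two
      integrable densities.\<close>
    have "integrable (lborel \<Otimes>\<^sub>M lborel) (\<lambda>(z, x). f_N q z * f_N q x)"
    proof (rule lborel_pair.Fubini_integrable)
      show "(\<lambda>(z, x). f_N q z * f_N q x) \<in> borel_measurable (lborel \<Otimes>\<^sub>M lborel)" by measurable
      show "integrable lborel (\<lambda>x. LBINT y. norm (case (x, y) of (z, x) \<Rightarrow> f_N q z * f_N q x))"
        using fN_nonneg fN_integral fN_integrable by (simp add: abs_mult)
      show "AE x in lborel. integrable lborel (\<lambda>y. case (x, y) of (z, x) \<Rightarrow> f_N q z * f_N q x)"
        using fN_integrable by simp
    qed
    then have "integrable (lborel \<Otimes>\<^sub>M lborel) (\<lambda>w. rad * C * ?K * (case w of (z, x) \<Rightarrow> f_N q z * f_N q x))"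
      by (rule integrable_mult_right)
    then show "integrable (lborel \<Otimes>\<^sub>M lborel) (\<lambda>(z, x). z * h x * (f_N q z * kern q (\<rho>\<^sup>2) (\<rho> * z) x))"
    proof (rule Bochner_Integration.integrable_bound)
      show "(\<lambda>(z, x). z * h x * (f_N q z * kern q (\<rho>\<^sup>2) (\<rho> * z) x)) \<in> borel_measurable (lborel \<Otimes>\<^sub>M lborel)"
        using km by (simp add: case_prod_beta')
      show "AE w in lborel \<Otimes>\<^sub>M lborel. norm (case w of (z, x) \<Rightarrow> z * h x * (f_N q z * kern q (\<rho>\<^sup>2) (\<rho> * z) x))
        \<le> norm (rad * C * ?K * (case w of (z, x) \<Rightarrow> f_N q z * f_N q x))"
      proof (rule AE_I2, clarify)
        fix z x
        show "norm (z * h x * (f_N q z * kern q (\<rho>\<^sup>2) (\<rho> * z) x)) \<le> norm (rad * C * ?K * (f_N q z * f_N q x))"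
        proof (cases "\<bar>x\<bar> \<le> rad \<and> \<bar>z\<bar> \<le> rad")
          case True
          then have d: "mehler_dom q (\<rho>\<^sup>2) (\<rho> * z)" using S_dom ra by blast
          have "\<bar>z\<bar> * \<bar>h x\<bar> * (f_N q z * kern q (\<rho>\<^sup>2) (\<rho> * z) x) \<le> rad * C * (f_N q z * (?K * f_N q x))"
          proof (rule mult_mono)
            show "\<bar>z\<bar> * \<bar>h x\<bar> \<le> rad * C" by (rule mult_mono) (use True C rad_pos in auto)
            show "f_N q z * kern q (\<rho>\<^sup>2) (\<rho> * z) x \<le> f_N q z * (?K * f_N q x)"
              by (rule mult_left_mono[OF kern_bound[OF q1 d order_refl r2(2)] fN_nonneg])
            show "0 \<le> rad * C" using rad_pos C0 by simp
            show "0 \<le> f_N q z * kern q (\<rho>\<^sup>2) (\<rho> * z) x" by (intro mult_nonneg_nonneg fN_nonneg kern_nonneg[OF q])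
          qed
          moreover have "norm (z * h x * (f_N q z * kern q (\<rho>\<^sup>2) (\<rho> * z) x)) = \<bar>z\<bar> * \<bar>h x\<bar> * (f_N q z * kern q (\<rho>\<^sup>2) (\<rho> * z) x)"
            unfolding real_norm_def abs_mult abs_of_nonneg[OF fN_nonneg] abs_of_nonneg[OF kern_nonneg[OF q]] ..
          moreover have "rad * C * (f_N q z * (?K * f_N q x)) = rad * C * ?K * (f_N q z * f_N q x)"
            by (simp only: mult_ac)
          ultimately show ?thesis
            unfolding real_norm_def using abs_ge_self[of "rad * C * ?K * (f_N q z * f_N q x)"] by linarith
        next
          case False
          then have "f_N q z * kern q (\<rho>\<^sup>2) (\<rho> * z) x = 0"
            using f_N_outside[OF q1, of z] kern_outside[OF q1, of x] unfolding support_iff by auto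
          then have e: "z * h x * (f_N q z * kern q (\<rho>\<^sup>2) (\<rho> * z) x) = 0" by (simp only: mult_zero_right)
          show ?thesis unfolding e by simp
        qed
      qed
    qed
  qed
  \<comment> \<open>After the swap, reversibility exchanges the roles of \<open>x\<close> and
    \<open>z\<close>, and the inner integral is again the conditional mean
    \<open>h x\<close>.\<close>
  also have "\<dots> = (\<integral>x. f_N q x * (h x)\<^sup>2 \<partial>lborel)"
  proof (rule Bochner_Integration.integral_cong[OF refl])
    fix x
    have "(\<integral>z. z * h x * (f_N q z * kern q (\<rho>\<^sup>2) (\<rho> * z) x) \<partial>lborel)
      = (\<integral>z. f_N q x * h x * (z ^ 1 * kern q (\<rho>\<^sup>2) (\<rho> * x) z) \<partial>lborel)"
    proof (rule Bochner_Integration.integral_cong[OF refl])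
      fix z
      show "z * h x * (f_N q z * kern q (\<rho>\<^sup>2) (\<rho> * z) x) = f_N q x * h x * (z ^ 1 * kern q (\<rho>\<^sup>2) (\<rho> * x) z)"
        unfolding kern_reversible[OF ra, of z x] power_one_right by (simp only: mult_ac)
    qed
    also have "\<dots> = f_N q x * h x * h x" unfolding h_def mom_def by simp
    finally show "(\<integral>z. z * h x * (f_N q z * kern q (\<rho>\<^sup>2) (\<rho> * z) x) \<partial>lborel) = f_N q x * (h x)\<^sup>2"
      by (simp add: power2_eq_square)
  qed
  also have "\<dots> = (\<integral>\<omega>. (h (Y t \<omega>))\<^sup>2 \<partial>M)"
    by (rule Y_integral(1)[symmetric]) simp
  finally show "(\<integral>\<omega>. (mom 1 \<rho> (Y t \<omega>))\<^sup>2 \<partial>M) = \<rho>\<^sup>2" by (simp add: h_def)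
qed

lemma mom_1:
  assumes r: "\<bar>\<rho>\<bar> < 1"
  shows "AE \<omega> in M. mom 1 \<rho> (Y t \<omega>) = \<rho> * Y t \<omega>"
proof -
  have pos: "AE \<omega> in M. mom 1 \<rho> (Y t \<omega>) = \<rho> * Y t \<omega>" if r: "0 < \<rho>" "\<rho> < 1" for \<rho>
  proof -
    have i: "integrable M (\<lambda>\<omega>. (mom 1 \<rho> (Y t \<omega>))\<^sup>2 - 2 * \<rho> * (Y t \<omega> * mom 1 \<rho> (Y t \<omega>)) + \<rho>\<^sup>2 * (Y t \<omega>)\<^sup>2)"
      using mom_1_sq(2)[OF r] lag_product(2)[OF r] by simp
    have e: "(mom 1 \<rho> (Y t \<omega>) - \<rho> * Y t \<omega>)\<^sup>2
       = (mom 1 \<rho> (Y t \<omega>))\<^sup>2 - 2 * \<rho> * (Y t \<omega> * mom 1 \<rho> (Y t \<omega>)) + \<rho>\<^sup>2 * (Y t \<omega>)\<^sup>2" for \<omega>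
      by (simp add: power2_diff power_mult_distrib)
    have "(\<integral>\<omega>. (mom 1 \<rho> (Y t \<omega>) - \<rho> * Y t \<omega>)\<^sup>2 \<partial>M) = \<rho>\<^sup>2 - 2 * \<rho> * \<rho> + \<rho>\<^sup>2 * v"
      unfolding e using mom_1_sq[OF r, of t] lag_product(1,2)[OF r, of t] covariance[OF r, of t] Y_sq[of t] by simp
    also have "\<dots> = 0" using v_eq_1 by (simp add: power2_eq_square)
    finally have "AE \<omega> in M. (mom 1 \<rho> (Y t \<omega>) - \<rho> * Y t \<omega>)\<^sup>2 = 0"
      using i unfolding e[symmetric] by (subst (asm) integral_nonneg_eq_0_iff_AE) auto
    then show ?thesis by eventually_elim simp
  qed
  consider "\<rho> = 0" | "0 < \<rho>" | "\<rho> < 0" by linarith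
  then show ?thesis
  proof cases
    case 1
    then show ?thesis using fN_mean by (simp add: mom_def f_N_eq_kern[OF q, symmetric])
  next
    case 2
    then show ?thesis using pos r by auto
  next
    case 3
    then show ?thesis using pos[of "- \<rho>"] r mom_minus[of 1 "- \<rho>"] by auto
  qed
qed

text \<open>For \<open>\<rho> \<noteq> 0\<close> the relation \<open>mom_relation_0\<close> is
  solved for the second moment with the help of \<open>mom_1\<close>; at \<open>\<rho> = 0\<close>
  the second moment is \<open>v\<close>.\<close>

lemma mom_2:
  assumes r: "\<bar>\<rho>\<bar> < 1"
  shows "AE \<omega> in M. mom 2 \<rho> (Y t \<omega>) = \<rho>\<^sup>2 * (Y t \<omega>)\<^sup>2 + 1 - \<rho>\<^sup>2"
proof (cases "\<rho> = 0")
  case True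
  then show ?thesis using v_eq_1 by (simp add: mom_def v_def f_N_eq_kern[OF q, symmetric] mult.commute)
next
  case False
  show ?thesis using mom_relation_0[OF r False, of t] mom_1[OF r, of t]
  proof eventually_elim
    case (elim \<omega>)
    have "\<rho> * (mom 2 \<rho> (Y t \<omega>) + (Y t \<omega>)\<^sup>2 - 1 + \<rho>\<^sup>2) = \<rho> * ((1 + \<rho>\<^sup>2) * (Y t \<omega>)\<^sup>2)"
      using elim(1) unfolding elim(2) by algebra
    then have "mom 2 \<rho> (Y t \<omega>) + (Y t \<omega>)\<^sup>2 - 1 + \<rho>\<^sup>2 = (1 + \<rho>\<^sup>2) * (Y t \<omega>)\<^sup>2" using False by simp
    then show ?case by (simp add: algebra_simps)
  qed
qed

text \<open>The recursion with \<open>k = 1\<close> and then \<open>k = 2\<close>. Its right-hand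
  side contains moments at \<open>\<rho> * q\<close>, so \<open>mom_1\<close> and
  \<open>mom_2\<close> are applied there too, where the correlation may be negative or 0. Solving
  for the highest moment divides by \<open>(1 - q) * \<rho>\<^sup>2\<close>, hence
  \<open>0 < \<rho>\<close>.\<close>

lemma mom_3_4:
  assumes r: "0 < \<rho>" "\<rho> < 1"
  shows "AE \<omega> in M. mom 3 \<rho> (Y t \<omega>) = \<rho> ^ 3 * Y t \<omega> ^ 3 + (1 - \<rho>\<^sup>2) * \<rho> * (2 + q) * Y t \<omega> \<and>
    mom 4 \<rho> (Y t \<omega>) = \<rho> ^ 4 * Y t \<omega> ^ 4 + (1 - \<rho>\<^sup>2) * (\<rho>\<^sup>2 * (Y t \<omega>)\<^sup>2 * (3 + 2 * q + q\<^sup>2) + (1 - \<rho>\<^sup>2) * (2 + q) + \<rho>\<^sup>2 * (1 - q\<^sup>2))"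
proof -
  have ra: "\<bar>\<rho>\<bar> < 1" using r by simp
  have rq: "\<bar>\<rho> * q\<bar> < 1" using ra q1 mult_strict_mono[of "\<bar>\<rho>\<bar>" 1 "\<bar>q\<bar>" 1] by (simp add: abs_mult)
  show ?thesis
    using mom_1[OF ra, of t] mom_2[OF ra, of t] mom_1[OF rq, of t] mom_2[OF rq, of t] AE_space
  proof eventually_elim
    case (elim \<omega>)
    define y m3 m4 where "y = Y t \<omega>" and "m3 = mom 3 \<rho> (Y t \<omega>)" and "m4 = mom 4 \<rho> (Y t \<omega>)"
    have nz: "(1 - q) * \<rho>\<^sup>2 \<noteq> 0" using r q_lt by simp
    note rel = mom_relation[OF Y_rad[OF elim(5), of t] ra]
    have i: "1 + 1 = (2::nat)" "1 + 2 = (3::nat)" "2 + 1 = (3::nat)" "2 + 2 = (4::nat)" by simp_all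
    have "(1 - \<rho>\<^sup>2)\<^sup>2 * (\<rho> * y) - (1 - q) * (1 + \<rho>\<^sup>2) * \<rho> * y * (\<rho>\<^sup>2 * y\<^sup>2 + 1 - \<rho>\<^sup>2)
      + (1 - q) * \<rho>\<^sup>2 * (m3 + y\<^sup>2 * (\<rho> * y)) = (1 - \<rho>\<^sup>2) * (1 - \<rho>\<^sup>2 * q) * (\<rho> * q * y)"
      using rel[of 1] unfolding i elim(1) elim(2) elim(3) unfolding y_def m3_def .
    then have "(1 - q) * \<rho>\<^sup>2 * m3 = (1 - q) * \<rho>\<^sup>2 * (\<rho> ^ 3 * y ^ 3 + (1 - \<rho>\<^sup>2) * \<rho> * (2 + q) * y)"
      by algebra
    then have m3: "m3 = \<rho> ^ 3 * y ^ 3 + (1 - \<rho>\<^sup>2) * \<rho> * (2 + q) * y" using nz by simp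
    have "(1 - \<rho>\<^sup>2)\<^sup>2 * (\<rho>\<^sup>2 * y\<^sup>2 + 1 - \<rho>\<^sup>2) - (1 - q) * (1 + \<rho>\<^sup>2) * \<rho> * y * m3
      + (1 - q) * \<rho>\<^sup>2 * (m4 + y\<^sup>2 * (\<rho>\<^sup>2 * y\<^sup>2 + 1 - \<rho>\<^sup>2))
      = (1 - \<rho>\<^sup>2) * (1 - \<rho>\<^sup>2 * q) * ((\<rho> * q)\<^sup>2 * y\<^sup>2 + 1 - (\<rho> * q)\<^sup>2)"
      using rel[of 2] unfolding i elim(2) elim(4) unfolding y_def m3_def m4_def .
    then have "(1 - q) * \<rho>\<^sup>2 * m4 = (1 - q) * \<rho>\<^sup>2 * (\<rho> ^ 4 * y ^ 4 + (1 - \<rho>\<^sup>2) * (\<rho>\<^sup>2 * y\<^sup>2 * (3 + 2 * q + q\<^sup>2) + (1 - \<rho>\<^sup>2) * (2 + q) + \<rho>\<^sup>2 * (1 - q\<^sup>2)))"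
      unfolding m3 by algebra
    then have "m4 = \<rho> ^ 4 * y ^ 4 + (1 - \<rho>\<^sup>2) * (\<rho>\<^sup>2 * y\<^sup>2 * (3 + 2 * q + q\<^sup>2) + (1 - \<rho>\<^sup>2) * (2 + q) + \<rho>\<^sup>2 * (1 - q\<^sup>2))"
      using nz by simp
    with m3 show ?case unfolding y_def m3_def m4_def by simp
  qed
qed

end

section \<open>Upcrossings and cadlag modifications\<close>

text \<open>Doob's strategy: the value at \<open>n\<close> tells whether the step from
  \<open>n\<close> to \<open>Suc n\<close> is taken. It depends on the path up to \<open>n\<close>
  alone, which is the predictability used in \<open>upcrossing_inequality\<close>.\<close>

primrec upcross_hold :: "(nat \<Rightarrow> real) \<Rightarrow> real \<Rightarrow> real \<Rightarrow> nat \<Rightarrow> bool" where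
  "upcross_hold x a b 0 \<longleftrightarrow> x 0 < a"
| "upcross_hold x a b (Suc n) \<longleftrightarrow> (if upcross_hold x a b n then x (Suc n) \<le> b else x (Suc n) < a)"

primrec upcross_count :: "(nat \<Rightarrow> real) \<Rightarrow> real \<Rightarrow> real \<Rightarrow> nat \<Rightarrow> nat" where
  "upcross_count x a b 0 = 0"
| "upcross_count x a b (Suc n) = upcross_count x a b n + (if upcross_hold x a b n \<and> b < x (Suc n) then 1 else 0)"

text \<open>The gain of the strategy that buys below \<open>a\<close> and sells above \<open>b\<close>.\<close>

lemma upcross_gain:
  assumes "a < b"
  shows "(b - a) * real (upcross_count x a b n) + (if upcross_hold x a b n then x n - a else 0)
    \<le> (\<Sum>k<n. of_bool (upcross_hold x a b k) * (x (Suc k) - x k))"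
proof (induction n)
  case 0
  then show ?case by simp
next
  case (Suc n)
  then show ?case using assms by (auto simp: algebra_simps split: if_splits)
qed

lemma upcross_count_mono: "m \<le> n \<Longrightarrow> upcross_count x a b m \<le> upcross_count x a b n"
  by (induction n rule: dec_induct) auto

lemma upcross_hold_low: "x n < a \<Longrightarrow> a < b \<Longrightarrow> upcross_hold x a b n"
  by (cases n) auto

lemma upcross_hold_high: "b < x n \<Longrightarrow> a < b \<Longrightarrow> \<not> upcross_hold x a b n"
  by (cases n) auto

text \<open>As long as no sale has occurred since \<open>m\<close>, the position is still held. A
  value above \<open>b\<close> at \<open>n\<close> excludes holding at \<open>n\<close>, so a sale
  has taken place by then.\<close>

lemma upcross_count_step:
  assumes "upcross_hold x a b m" "m < n" "b < x n" "a < b"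
  shows "upcross_count x a b m + 1 \<le> upcross_count x a b n"
proof -
  have "upcross_count x a b m + 1 \<le> upcross_count x a b k
      \<or> (upcross_hold x a b k \<and> upcross_count x a b m \<le> upcross_count x a b k)" if "m \<le> k" for k
    using that by (induction k rule: dec_induct) (use assms(1) in auto)
  from this[of n] upcross_hold_high[of b x n a, OF assms(3,4)] assms(2) show ?thesis by auto
qed

text \<open>Passages from below \<open>a\<close> to above \<open>b\<close> along a time set with no
  discrete index. Each passage starts no earlier than the previous one ends, so the relation can be
  compared with upcrossings on every grid.\<close>

primrec oscillates :: "real set \<Rightarrow> (real \<Rightarrow> real) \<Rightarrow> real \<Rightarrow> real \<Rightarrow> nat \<Rightarrow> real \<Rightarrow> real \<Rightarrow> bool" where
  "oscillates D g a b 0 l h \<longleftrightarrow> l \<le> h"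
| "oscillates D g a b (Suc K) l h \<longleftrightarrow>
     (\<exists>d\<in>D. \<exists>e\<in>D. l \<le> d \<and> d < e \<and> e \<le> h \<and> g d < a \<and> b < g e \<and> oscillates D g a b K e h)"

lemma oscillates_mono:
  "oscillates D g a b K l h \<Longrightarrow> l' \<le> l \<Longrightarrow> h \<le> h' \<Longrightarrow> D \<subseteq> D' \<Longrightarrow> oscillates D' g a b K l' h'"
  by (induction K arbitrary: l l') (auto, meson order_trans order_refl subsetD)

section \<open>Dyadic times and passages along them\<close>

definition dyadic :: "nat \<Rightarrow> real set" where
  "dyadic m = range (\<lambda>k::nat. real k / 2 ^ m)"

definition dyadics :: "real set" where
  "dyadics = (\<Union>m. dyadic m)"

lemma dyadic_mono: "m \<le> n \<Longrightarrow> dyadic m \<subseteq> dyadic n"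
proof
  fix x assume "m \<le> n" "x \<in> dyadic m"
  then obtain k where x: "x = real k / 2 ^ m" by (auto simp: dyadic_def)
  have "x = real (k * 2 ^ (n - m)) / 2 ^ n"
  proof -
    have "(2::real) ^ n = 2 ^ m * 2 ^ (n - m)" using \<open>m \<le> n\<close> by (simp flip: power_add)
    then show ?thesis by (simp add: x)
  qed
  then show "x \<in> dyadic n" unfolding dyadic_def by blast
qed

lemma countable_dyadics: "countable dyadics"
  unfolding dyadics_def dyadic_def by auto

lemma dyadics_nonneg: "d \<in> dyadics \<Longrightarrow> 0 \<le> d"
  by (auto simp: dyadics_def dyadic_def)

lemma zero_dyadics: "0 \<in> dyadics"
  unfolding dyadics_def dyadic_def by (auto intro!: exI[of _ 0] image_eqI[of _ _ 0])

text \<open>Floor plus one instead of a ceiling: the value lies strictly above \<open>t\<close> even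
  for dyadic \<open>t\<close>, so the sequence approaches \<open>t\<close> within
  \<open>at_right t\<close>.\<close>

definition dyadic_above :: "nat \<Rightarrow> real \<Rightarrow> real" where
  "dyadic_above n t = real (nat \<lfloor>2 ^ n * t\<rfloor> + 1) / 2 ^ n"

lemma dyadic_above:
  assumes "0 \<le> t"
  shows "t < dyadic_above n t" "dyadic_above n t \<le> t + 1 / 2 ^ n" "dyadic_above n t \<in> dyadics"
proof -
  have f: "0 \<le> \<lfloor>2 ^ n * t\<rfloor>" using assms by simp
  have e: "real (nat \<lfloor>2 ^ n * t\<rfloor> + 1) = real_of_int \<lfloor>2 ^ n * t\<rfloor> + 1" using f by simp
  show "t < dyadic_above n t"
    unfolding dyadic_above_def e by (simp add: pos_less_divide_eq mult.commute)
  have "real_of_int \<lfloor>2 ^ n * t\<rfloor> + 1 \<le> 2 ^ n * t + 1" by simp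
  then show "dyadic_above n t \<le> t + 1 / 2 ^ n"
    unfolding dyadic_above_def e by (simp add: field_simps)
  show "dyadic_above n t \<in> dyadics"
    unfolding dyadic_above_def dyadics_def dyadic_def by blast
qed

lemma dyadic_above_lim:
  assumes "0 \<le> t" shows "(\<lambda>n. dyadic_above n t) \<longlonglongrightarrow> t"
proof (rule tendsto_sandwich[of "\<lambda>_. t"])
  show "(\<lambda>n. t + 1 / 2 ^ n) \<longlonglongrightarrow> t"
    using tendsto_add[OF tendsto_const[of t] LIMSEQ_realpow_zero[of "1/2"]] by (simp add: power_one_over)
qed (use dyadic_above[OF assms] in \<open>auto intro!: always_eventually less_imp_le\<close>)

lemma dyadics_between:
  assumes "0 \<le> s" "s < t" obtains d where "d \<in> dyadics" "s < d" "d < t"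
proof -
  have "\<forall>\<^sub>F n in sequentially. dyadic_above n s < t"
    using order_tendstoD(2)[OF dyadic_above_lim[OF assms(1)] assms(2)] .
  then obtain n where "dyadic_above n s < t" by (auto simp: eventually_sequentially)
  then show thesis using that dyadic_above[OF assms(1)] by blast
qed

text \<open>Only finitely many times occur, and the grids are nested, so one level contains them
  all.\<close>

lemma oscillates_dyadic:
  assumes "oscillates dyadics g a b K l h"
  shows "\<exists>m. oscillates (dyadic m) g a b K l h"
  using assms
proof (induction K arbitrary: l)
  case (Suc K)
  then obtain d e where 1: "d \<in> dyadics" "e \<in> dyadics" "l \<le> d" "d < e" "e \<le> h" "g d < a" "b < g e"
    "oscillates dyadics g a b K e h" by auto
  moreover obtain m3 where "oscillates (dyadic m3) g a b K e h" using Suc.IH[OF 1(8)] by blast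
  moreover obtain m1 where "d \<in> dyadic m1" using 1(1) unfolding dyadics_def by blast
  moreover obtain m2 where "e \<in> dyadic m2" using 1(2) unfolding dyadics_def by blast
  ultimately have *: "d \<in> dyadic m1" "e \<in> dyadic m2" "l \<le> d" "d < e" "e \<le> h" "g d < a" "b < g e"
    "oscillates (dyadic m3) g a b K e h" by auto
  define m where "m = max m1 (max m2 m3)"
  have "dyadic m1 \<subseteq> dyadic m" "dyadic m2 \<subseteq> dyadic m" "dyadic m3 \<subseteq> dyadic m"
    by (auto intro!: dyadic_mono simp: m_def)
  then have "d \<in> dyadic m" "e \<in> dyadic m" "oscillates (dyadic m) g a b K e h"
    using * oscillates_mono[OF *(8) order_refl order_refl] by auto
  then show ?case using * by auto
qed auto

text \<open>The free index \<open>i\<close>, a grid point not beyond \<open>l\<close>, carries the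
  induction: each passage adds at least one to the count, and the rest starts at the grid index
  where it ended.\<close>

lemma oscillates_upcross_count:
  assumes "a < b" "oscillates (dyadic m) g a b K l (real n / 2 ^ m)" "real i / 2 ^ m \<le> l"
  shows "upcross_count (\<lambda>k. g (real k / 2 ^ m)) a b i + K \<le> upcross_count (\<lambda>k. g (real k / 2 ^ m)) a b n"
  using assms(2,3)
proof (induction K arbitrary: l i)
  case 0
  then have "real i / 2 ^ m \<le> real n / 2 ^ m" by simp
  then have "i \<le> n" by (simp add: divide_le_cancel)
  then show ?case using upcross_count_mono by simp
next
  case (Suc K)
  then obtain d e where de: "d \<in> dyadic m" "e \<in> dyadic m" "l \<le> d" "d < e" "g d < a" "b < g e"
    "oscillates (dyadic m) g a b K e (real n / 2 ^ m)" by auto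
  from de obtain j k where jk: "d = real j / 2 ^ m" "e = real k / 2 ^ m" by (auto simp: dyadic_def)
  have "real i / 2 ^ m \<le> real j / 2 ^ m" using Suc.prems(2) de(3) jk by simp
  then have ij: "i \<le> j" by (simp add: divide_le_cancel)
  have jk': "j < k" using de(4) jk by (simp add: divide_less_cancel)
  let ?u = "upcross_count (\<lambda>k. g (real k / 2 ^ m)) a b"
  have "?u i \<le> ?u j" using ij by (rule upcross_count_mono)
  moreover have "?u j + 1 \<le> ?u k"
    using de(5,6) jk jk' assms(1) by (intro upcross_count_step upcross_hold_low) auto
  moreover have "?u k + K \<le> ?u n" using Suc.IH[OF de(7), of k] jk by simp
  ultimately show ?case by linarith
qed

lemma oscillates_eventually:
  assumes "a < b" "oscillates dyadics g a b K 0 (real N)"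
  shows "\<forall>\<^sub>F m in sequentially. K \<le> upcross_count (\<lambda>k. g (real k / 2 ^ m)) a b (N * 2 ^ m)"
proof -
  obtain m0 where m0: "oscillates (dyadic m0) g a b K 0 (real N)" using oscillates_dyadic[OF assms(2)] by blast
  have "K \<le> upcross_count (\<lambda>k. g (real k / 2 ^ m)) a b (N * 2 ^ m)" if "m0 \<le> m" for m
  proof -
    have "oscillates (dyadic m) g a b K 0 (real (N * 2 ^ m) / 2 ^ m)"
      using oscillates_mono[OF m0 order_refl order_refl dyadic_mono[OF that]] by simp
    from oscillates_upcross_count[OF assms(1) this, of 0] show ?thesis by simp
  qed
  then show ?thesis by (auto simp: eventually_sequentially)
qed

text \<open>Low and high values accumulate at \<open>t\<close> from the right, so a new passage
  always fits between \<open>t\<close> and the first of the passages already found. The sequence is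
  therefore built from its last passage backwards.\<close>

lemma oscillates_right:
  assumes "0 \<le> t"
    and low: "\<And>\<delta>. 0 < \<delta> \<Longrightarrow> \<exists>d\<in>dyadics. t < d \<and> d < t + \<delta> \<and> g d < a"
    and high: "\<And>\<delta>. 0 < \<delta> \<Longrightarrow> \<exists>d\<in>dyadics. t < d \<and> d < t + \<delta> \<and> b < g d"
  shows "\<exists>l>t. l \<le> t + 1 \<and> oscillates dyadics g a b K l (t + 1)"
proof (induction K)
  case 0
  then show ?case by (auto intro!: exI[of _ "t + 1"])
next
  case (Suc K)
  then obtain l where l: "t < l" "l \<le> t + 1" "oscillates dyadics g a b K l (t + 1)" by blast
  from high[of "l - t"] l obtain e where e: "e \<in> dyadics" "t < e" "e < l" "b < g e" by auto
  from low[of "e - t"] e obtain d where d: "d \<in> dyadics" "t < d" "d < e" "g d < a" by auto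
  have "oscillates dyadics g a b K e (t + 1)" using oscillates_mono[OF l(3)] e by simp
  then show ?case using e d l by (intro exI[of _ d]) force
qed

text \<open>From the left, the passages run towards \<open>t\<close> and each leaves room for the
  next; the starting point can therefore be any \<open>l < t\<close>.\<close>

lemma oscillates_left:
  assumes low: "\<And>s. s < t \<Longrightarrow> \<exists>d\<in>dyadics. s < d \<and> d < t \<and> g d < a"
    and high: "\<And>s. s < t \<Longrightarrow> \<exists>d\<in>dyadics. s < d \<and> d < t \<and> b < g d"
  shows "l < t \<Longrightarrow> oscillates dyadics g a b K l t"
proof (induction K arbitrary: l)
  case (Suc K)
  from low[OF Suc.prems] obtain d where d: "d \<in> dyadics" "l < d" "d < t" "g d < a" by auto
  from high[OF d(3)] obtain e where e: "e \<in> dyadics" "d < e" "e < t" "b < g e" by auto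
  then show ?case using d Suc.IH[OF e(3)]
    by (simp, intro bexI[of _ d] bexI[of _ e] conjI less_imp_le) auto
qed simp

text \<open>A gap between the lower and the upper limit contains two rational levels, both of which
  are passed frequently. Rational levels keep the later exceptional sets countable in number; the
  bound excludes an infinite limit.\<close>

lemma limit_or_oscillation:
  fixes g :: "real \<Rightarrow> real"
  assumes F: "F \<noteq> bot" and bdd: "\<forall>\<^sub>F x in F. \<bar>g x\<bar> \<le> C"
    and no: "\<And>a b. a \<in> \<rat> \<Longrightarrow> b \<in> \<rat> \<Longrightarrow> a < b \<Longrightarrow> \<not> ((\<exists>\<^sub>F x in F. g x < a) \<and> (\<exists>\<^sub>F x in F. b < g x))"
  shows "\<exists>l. (g \<longlongrightarrow> l) F"
proof -
  let ?L = "Liminf F (\<lambda>x. ereal (g x))" and ?U = "Limsup F (\<lambda>x. ereal (g x))"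
  have LU: "?L \<le> ?U" by (rule Liminf_le_Limsup[OF F])
  have "?L = ?U"
  proof (rule ccontr)
    assume "?L \<noteq> ?U"
    then have "?L < ?U" using LU by simp
    then obtain m where m: "?L < ereal m" "ereal m < ?U" using ereal_dense2 by blast
    obtain m' where m': "ereal m < ereal m'" "ereal m' < ?U" using ereal_dense2[OF m(2)] by blast
    \<comment> \<open>Separates the two levels: \<open>m < a < m2 < b < m'\<close> gives
      \<open>a < b\<close>.\<close>
    then obtain m2 where m2: "m < m2" "m2 < m'" using dense by auto
    obtain a where a: "a \<in> \<rat>" "m < a" "a < m2" using Rats_dense_in_real[OF m2(1)] by blast
    obtain b where b: "b \<in> \<rat>" "m2 < b" "b < m'" using Rats_dense_in_real[OF m2(2)] by blast
    have La: "?L < ereal a" using m(1) a by (meson ereal_less_le less_ereal.simps(1) order.strict_trans)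
    have Ub: "ereal b < ?U" using m'(2) b by (meson less_ereal.simps(1) order.strict_trans)
    have "\<exists>\<^sub>F x in F. g x < a"
    proof (rule ccontr)
      assume "\<not> (\<exists>\<^sub>F x in F. g x < a)"
      then have "\<forall>\<^sub>F x in F. ereal a \<le> ereal (g x)" by (simp add: not_frequently not_less)
      then have "ereal a \<le> ?L" by (rule Liminf_bounded)
      then show False using La by simp
    qed
    moreover have "\<exists>\<^sub>F x in F. b < g x"
    proof (rule ccontr)
      assume "\<not> (\<exists>\<^sub>F x in F. b < g x)"
      then have "\<forall>\<^sub>F x in F. ereal (g x) \<le> ereal b" by (simp add: not_frequently not_less)
      then have "?U \<le> ereal b" by (rule Limsup_bounded)
      then show False using Ub by simp
    qed
    ultimately show False using no[OF a(1) b(1)] a b by simp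
  qed
  then have lim: "((\<lambda>x. ereal (g x)) \<longlongrightarrow> ?L) F"
    using Liminf_eq_Limsup[OF F] tendsto_iff_Liminf_eq_Limsup[OF F] by metis
  have "\<forall>\<^sub>F x in F. ereal (- C) \<le> ereal (g x)" using bdd by eventually_elim auto
  then have 1: "ereal (- C) \<le> ?L" by (rule Liminf_bounded)
  have "\<forall>\<^sub>F x in F. ereal (g x) \<le> ereal C" using bdd by eventually_elim auto
  then have 2: "?U \<le> ereal C" by (rule Limsup_bounded)
  have "\<bar>?L\<bar> \<noteq> \<infinity>" using 1 2 \<open>?L = ?U\<close> by auto
  then obtain l where "?L = ereal l" by auto
  then show ?thesis using lim by auto
qed

lemma dyadic_limits:
  fixes g :: "real \<Rightarrow> real"
  assumes osc: "\<And>N a b. a \<in> \<rat> \<Longrightarrow> b \<in> \<rat> \<Longrightarrow> a < b \<Longrightarrow> \<exists>K. \<not> oscillates dyadics g a b K 0 (real N)"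
    and bdd: "\<And>N::nat. \<exists>C. \<forall>d\<in>dyadics. d \<le> real N \<longrightarrow> \<bar>g d\<bar> \<le> C"
  shows "0 \<le> t \<Longrightarrow> \<exists>l. (g \<longlongrightarrow> l) (at t within dyadics \<inter> {t<..})"
    and "0 < t \<Longrightarrow> \<exists>l. (g \<longlongrightarrow> l) (at t within dyadics \<inter> {..<t})"
proof -
  obtain N :: nat where N: "t + 1 \<le> real N" using real_arch_simple by blast
  obtain C where C: "\<And>d. d \<in> dyadics \<Longrightarrow> d \<le> real N \<Longrightarrow> \<bar>g d\<bar> \<le> C" using bdd[of N] by blast
  show "\<exists>l. (g \<longlongrightarrow> l) (at t within dyadics \<inter> {t<..})" if t: "0 \<le> t"
  proof (rule limit_or_oscillation)
    have "t islimpt dyadics \<inter> {t<..}"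
      unfolding islimpt_approachable
    proof (intro allI impI)
      fix e :: real assume "0 < e"
      then obtain d where "d \<in> dyadics" "t < d" "d < t + e" using dyadics_between[OF t, of "t + e"] by auto
      then show "\<exists>x'\<in>dyadics \<inter> {t<..}. x' \<noteq> t \<and> dist x' t < e" by (intro bexI[of _ d]) (auto simp: dist_real_def)
    qed
    then show "at t within dyadics \<inter> {t<..} \<noteq> bot" by (simp add: trivial_limit_within)
    show "\<forall>\<^sub>F x in at t within dyadics \<inter> {t<..}. \<bar>g x\<bar> \<le> C"
      unfolding eventually_at by (rule exI[of _ 1]) (use N C in \<open>auto simp: dist_real_def\<close>)
    fix a b :: real assume ab: "a \<in> \<rat>" "b \<in> \<rat>" "a < b"
    show "\<not> ((\<exists>\<^sub>F x in at t within dyadics \<inter> {t<..}. g x < a) \<and> (\<exists>\<^sub>F x in at t within dyadics \<inter> {t<..}. b < g x))"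
    proof
      assume f: "(\<exists>\<^sub>F x in at t within dyadics \<inter> {t<..}. g x < a) \<and> (\<exists>\<^sub>F x in at t within dyadics \<inter> {t<..}. b < g x)"
      have ex: "\<exists>d\<in>dyadics. t < d \<and> d < t + \<delta> \<and> P d"
        if f1: "\<exists>\<^sub>F x in at t within dyadics \<inter> {t<..}. P x" and f2: "0 < \<delta>" for P \<delta>
      proof -
        obtain d where "d \<in> dyadics \<inter> {t<..}" "dist d t < \<delta>" "P d"
          using f1 f2 unfolding frequently_at by blast
        then show ?thesis by (intro bexI[of _ d]) (auto simp: dist_real_def)
      qed
      have "\<exists>K. \<not> oscillates dyadics g a b K 0 (real N)" using osc ab by blast
      then obtain K where K: "\<not> oscillates dyadics g a b K 0 (real N)" ..
      have "\<exists>l>t. l \<le> t + 1 \<and> oscillates dyadics g a b K l (t + 1)"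
        using f by (intro oscillates_right t ex) auto
      then obtain l where l: "t < l" "oscillates dyadics g a b K l (t + 1)" by blast
      have "oscillates dyadics g a b K 0 (real N)" by (rule oscillates_mono[OF l(2)]) (use l t N in auto)
      then show False using K by simp
    qed
  qed
  show "\<exists>l. (g \<longlongrightarrow> l) (at t within dyadics \<inter> {..<t})" if t: "0 < t"
  proof (rule limit_or_oscillation)
    have "t islimpt dyadics \<inter> {..<t}"
      unfolding islimpt_approachable
    proof (intro allI impI)
      fix e :: real assume "0 < e"
      then obtain d where "d \<in> dyadics" "max 0 (t - e) < d" "d < t"
        using dyadics_between[of "max 0 (t - e)" t] t by auto
      then show "\<exists>x'\<in>dyadics \<inter> {..<t}. x' \<noteq> t \<and> dist x' t < e" by (intro bexI[of _ d]) (auto simp: dist_real_def)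
    qed
    then show "at t within dyadics \<inter> {..<t} \<noteq> bot" by (simp add: trivial_limit_within)
    show "\<forall>\<^sub>F x in at t within dyadics \<inter> {..<t}. \<bar>g x\<bar> \<le> C"
      unfolding eventually_at by (rule exI[of _ 1]) (use N C in \<open>auto simp: dist_real_def\<close>)
    fix a b :: real assume ab: "a \<in> \<rat>" "b \<in> \<rat>" "a < b"
    show "\<not> ((\<exists>\<^sub>F x in at t within dyadics \<inter> {..<t}. g x < a) \<and> (\<exists>\<^sub>F x in at t within dyadics \<inter> {..<t}. b < g x))"
    proof
      assume f: "(\<exists>\<^sub>F x in at t within dyadics \<inter> {..<t}. g x < a) \<and> (\<exists>\<^sub>F x in at t within dyadics \<inter> {..<t}. b < g x)"
      have ex: "\<exists>d\<in>dyadics. s < d \<and> d < t \<and> P d"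
        if f1: "\<exists>\<^sub>F x in at t within dyadics \<inter> {..<t}. P x" and f2: "s < t" for P s
      proof -
        have "0 < t - s" using f2 by simp
        then obtain d where "d \<in> dyadics \<inter> {..<t}" "dist d t < t - s" "P d"
          using f1 unfolding frequently_at by blast
        then show ?thesis by (intro bexI[of _ d]) (auto simp: dist_real_def)
      qed
      have "\<exists>K. \<not> oscillates dyadics g a b K 0 (real N)" using osc ab by blast
      then obtain K where K: "\<not> oscillates dyadics g a b K 0 (real N)" ..
      have l: "oscillates dyadics g a b K 0 t"
        using f t by (intro oscillates_left ex) auto
      have "oscillates dyadics g a b K 0 (real N)" by (rule oscillates_mono[OF l]) (use t N in auto)
      then show False using K by simp
    qed
  qed
qed

text \<open>\<open>Z\<close> collects the right limits of \<open>g\<close> along the dyadics.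
  Estimates for \<open>g\<close> near \<open>t\<close> pass to \<open>Z\<close>, since the values of
  \<open>Z\<close> near \<open>t\<close> are limits of values of \<open>g\<close> that are still
  near \<open>t\<close>.\<close>

lemma cadlag_regularization:
  fixes g Z :: "real \<Rightarrow> real"
  assumes r: "\<And>t. 0 \<le> t \<Longrightarrow> (g \<longlongrightarrow> Z t) (at t within dyadics \<inter> {t<..})"
    and l: "\<And>t. 0 < t \<Longrightarrow> \<exists>l. (g \<longlongrightarrow> l) (at t within dyadics \<inter> {..<t})"
  shows "cadlag Z"
proof -
  \<comment> \<open>The transfer: \<open>Z s\<close> is a limit of values of \<open>g\<close> at
    dyadics between \<open>s\<close> and \<open>u\<close>, and closed balls survive limits. The
    radius \<open>e / 2\<close> below compensates for the passage to closed balls.\<close>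
  have inv: "Z s \<in> cball l e" if s: "0 \<le> s" "s < u" and "\<And>d. d \<in> dyadics \<Longrightarrow> s < d \<Longrightarrow> d < u \<Longrightarrow> g d \<in> cball l e" for s u l e
  proof (rule Lim_in_closed_set[OF closed_cball _ _ r[OF s(1)]])
    have "s islimpt dyadics \<inter> {s<..}"
      unfolding islimpt_approachable
    proof (intro allI impI)
      fix e :: real assume "0 < e"
      then obtain d where "d \<in> dyadics" "s < d" "d < s + e" using dyadics_between[OF s(1), of "s + e"] by auto
      then show "\<exists>x'\<in>dyadics \<inter> {s<..}. x' \<noteq> s \<and> dist x' s < e" by (intro bexI[of _ d]) (auto simp: dist_real_def)
    qed
    then show "at s within dyadics \<inter> {s<..} \<noteq> bot" by (simp add: trivial_limit_within)
    show "\<forall>\<^sub>F x in at s within dyadics \<inter> {s<..}. g x \<in> cball l e"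
      unfolding eventually_at by (rule exI[of _ "u - s"]) (use that in \<open>auto simp: dist_real_def\<close>)
  qed
  have 1: "(Z \<longlongrightarrow> Z t) (at_right t)" if t: "0 \<le> t" for t
  proof (rule tendstoI)
    fix e :: real assume e: "0 < e"
    have "\<forall>\<^sub>F x in at t within dyadics \<inter> {t<..}. dist (g x) (Z t) < e / 2"
      using tendstoD[OF r[OF t], of "e / 2"] e by simp
    then obtain \<delta> where \<delta>: "0 < \<delta>" "\<And>x. x \<in> dyadics \<Longrightarrow> t < x \<Longrightarrow> x < t + \<delta> \<Longrightarrow> dist (g x) (Z t) < e / 2"
      unfolding eventually_at by (force simp: dist_real_def)
    have "dist (Z s) (Z t) < e" if "t < s" "s < t + \<delta>" for s
    proof -
      have "Z s \<in> cball (Z t) (e / 2)"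
        using that t \<delta> by (intro inv[of s "t + \<delta>"]) (auto simp: dist_commute intro: less_imp_le)
      then show ?thesis using e by (simp add: dist_commute)
    qed
    then show "\<forall>\<^sub>F x in at_right t. dist (Z x) (Z t) < e"
      unfolding eventually_at_right_field using \<delta>(1) by (intro exI[of _ "t + \<delta>"]) auto
  qed
  have 2: "\<exists>l. (Z \<longlongrightarrow> l) (at_left t)" if t: "0 < t" for t
  proof -
    obtain l where l: "(g \<longlongrightarrow> l) (at t within dyadics \<inter> {..<t})" using l[OF t] by blast
    have "(Z \<longlongrightarrow> l) (at_left t)"
    proof (rule tendstoI)
      fix e :: real assume e: "0 < e"
      have "\<forall>\<^sub>F x in at t within dyadics \<inter> {..<t}. dist (g x) l < e / 2"
        using tendstoD[OF l, of "e / 2"] e by simp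
      then obtain \<delta> where \<delta>: "0 < \<delta>" "\<And>x. x \<in> dyadics \<Longrightarrow> x < t \<Longrightarrow> t - \<delta> < x \<Longrightarrow> dist (g x) l < e / 2"
        unfolding eventually_at by (force simp: dist_real_def)
      have "dist (Z s) l < e" if "max 0 (t - \<delta>) < s" "s < t" for s
      proof -
        have "Z s \<in> cball l (e / 2)"
          using that t \<delta> by (intro inv[of s t]) (auto simp: dist_commute intro: less_imp_le)
        then show ?thesis using e by (simp add: dist_commute)
      qed
      then show "\<forall>\<^sub>F x in at_left t. dist (Z x) l < e"
        unfolding eventually_at_left_field using \<delta>(1) t by (intro exI[of _ "max 0 (t - \<delta>)"]) auto
    qed
    then show ?thesis by blast
  qed
  show ?thesis using 1 2 by (simp add: cadlag_def)
qed

section \<open>Upcrossing inequality and cadlag modification for martingales starting at 0\<close>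

locale null_start_martingale = prob_space M for M :: "'a measure" +
  fixes G :: "real \<Rightarrow> 'a measure" and X :: "real \<Rightarrow> 'a \<Rightarrow> real"
  assumes subalg: "\<And>t. 0 \<le> t \<Longrightarrow> subalgebra M (G t)"
    and G_mono: "\<And>s t. 0 \<le> s \<Longrightarrow> s \<le> t \<Longrightarrow> sets (G s) \<subseteq> sets (G t)"
    and adapted: "\<And>t. 0 \<le> t \<Longrightarrow> X t \<in> borel_measurable (G t)"
    and int_X: "\<And>t. 0 \<le> t \<Longrightarrow> integrable M (X t)"
    and mart: "\<And>s t B. 0 \<le> s \<Longrightarrow> s < t \<Longrightarrow> B \<in> sets (G s) \<Longrightarrow>
       (\<integral>\<omega>. indicator B \<omega> * X t \<omega> \<partial>M) = (\<integral>\<omega>. indicator B \<omega> * X s \<omega> \<partial>M)"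
    and X_0: "\<And>\<omega>. \<omega> \<in> space M \<Longrightarrow> X 0 \<omega> = 0"
begin

lemma G_M: "0 \<le> t \<Longrightarrow> B \<in> sets (G t) \<Longrightarrow> B \<in> sets M" "0 \<le> t \<Longrightarrow> space (G t) = space M"
  using subalg by (auto simp: subalgebra_def)

lemma X_M: "0 \<le> t \<Longrightarrow> X t \<in> borel_measurable M"
  by (rule borel_measurable_integrable[OF int_X])

lemma uminus_martingale: "null_start_martingale M G (\<lambda>t \<omega>. - X t \<omega>)"
  by unfold_locales (use subalg G_mono adapted int_X mart X_0 in auto)

abbreviation "grid m \<omega> \<equiv> \<lambda>k::nat. X (real k / 2 ^ m) \<omega>"

lemma hold_sets:
  "{\<omega>\<in>space M. upcross_hold (grid m \<omega>) a b n} \<in> sets (G (real n / 2 ^ m))"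
proof (induction n)
  case 0
  have "{\<omega>\<in>space (G 0). X 0 \<omega> < a} \<in> sets (G 0)"
    using adapted[of 0] by measurable
  then show ?case by (simp add: G_M)
next
  case (Suc n)
  let ?G = "G (real (Suc n) / 2 ^ m)" and ?H = "{\<omega>\<in>space M. upcross_hold (grid m \<omega>) a b n}"
  have sp: "space ?G = space M" by (rule G_M) simp
  have H: "?H \<in> sets ?G"
    using Suc G_mono[of "real n / 2 ^ m" "real (Suc n) / 2 ^ m"] by (auto simp: divide_right_mono)
  have [measurable]: "X (real (Suc n) / 2 ^ m) \<in> borel_measurable ?G" by (rule adapted) simp
  have "{\<omega>\<in>space ?G. X (real (Suc n) / 2 ^ m) \<omega> \<le> b} \<in> sets ?G" "{\<omega>\<in>space ?G. X (real (Suc n) / 2 ^ m) \<omega> < a} \<in> sets ?G"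
    by measurable
  then have "(?H \<inter> {\<omega>\<in>space ?G. X (real (Suc n) / 2 ^ m) \<omega> \<le> b}) \<union> ({\<omega>\<in>space ?G. X (real (Suc n) / 2 ^ m) \<omega> < a} - ?H) \<in> sets ?G"
    using H by blast
  moreover have "{\<omega>\<in>space M. upcross_hold (grid m \<omega>) a b (Suc n)}
     = (?H \<inter> {\<omega>\<in>space ?G. X (real (Suc n) / 2 ^ m) \<omega> \<le> b}) \<union> ({\<omega>\<in>space ?G. X (real (Suc n) / 2 ^ m) \<omega> < a} - ?H)"
    unfolding sp by auto
  ultimately show ?case by (simp only:)
qed

lemma hold_pred [measurable]: "Measurable.pred M (\<lambda>\<omega>. upcross_hold (grid m \<omega>) a b n)"
  using G_M(1)[OF _ hold_sets[of m a b n]] by (simp add: pred_def)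

lemma count_measurable [measurable]: "(\<lambda>\<omega>. real (upcross_count (grid m \<omega>) a b n)) \<in> borel_measurable M"
proof (induction n)
  case (Suc n)
  have [measurable]: "X (real (Suc n) / 2 ^ m) \<in> borel_measurable M" by (rule X_M) simp
  note Suc[measurable]
  have "(\<lambda>\<omega>. real (upcross_count (grid m \<omega>) a b n)
     + (if upcross_hold (grid m \<omega>) a b n \<and> b < X (real (Suc n) / 2 ^ m) \<omega> then 1 else 0)) \<in> borel_measurable M"
    by measurable
  moreover have "(\<lambda>\<omega>. real (upcross_count (grid m \<omega>) a b (Suc n))) = (\<lambda>\<omega>. real (upcross_count (grid m \<omega>) a b n)
     + (if upcross_hold (grid m \<omega>) a b n \<and> b < X (real (Suc n) / 2 ^ m) \<omega> then 1 else 0))"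
    by (simp add: fun_eq_iff)
  ultimately show ?case by (simp only:)
qed simp

text \<open>The gain of the strategy has mean 0, because each step is chosen at its left end point.
  All grids share the final time \<open>N\<close>, so the bound does not depend on the level
  \<open>m\<close>.\<close>

lemma upcrossing_inequality:
  assumes ab: "a < b"
  shows "(\<integral>\<^sup>+\<omega>. ennreal (real (upcross_count (grid m \<omega>) a b (N * 2 ^ m))) \<partial>M)
    \<le> ennreal ((\<bar>a\<bar> + (\<integral>\<omega>. \<bar>X (real N) \<omega>\<bar> \<partial>M)) / (b - a))"
proof -
  define n where "n = N * 2 ^ m"
  have nN: "real n / 2 ^ m = real N" by (simp add: n_def)
  define H where "H k = {\<omega>\<in>space M. upcross_hold (grid m \<omega>) a b k}" for k
  have H: "H k \<in> sets (G (real k / 2 ^ m))" "H k \<in> sets M" for k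
    unfolding H_def using hold_sets G_M(1)[OF _ hold_sets] by auto
  have int_term: "integrable M (\<lambda>\<omega>. indicator (H k) \<omega> * X (real j / 2 ^ m) \<omega>)" for k j
    using integrable_real_mult_indicator[OF H(2) int_X[of "real j / 2 ^ m"], of k] by (simp add: mult.commute)
  define S where "S \<omega> = (\<Sum>k<n. indicator (H k) \<omega> * X (real (Suc k) / 2 ^ m) \<omega> - indicator (H k) \<omega> * X (real k / 2 ^ m) \<omega>)" for \<omega>
  have int_S: "integrable M S" unfolding S_def by (intro Bochner_Integration.integrable_sum Bochner_Integration.integrable_diff int_term)
  have "(\<integral>\<omega>. S \<omega> \<partial>M) = (\<Sum>k<n. (\<integral>\<omega>. indicator (H k) \<omega> * X (real (Suc k) / 2 ^ m) \<omega> \<partial>M) - (\<integral>\<omega>. indicator (H k) \<omega> * X (real k / 2 ^ m) \<omega> \<partial>M))"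
    unfolding S_def by (subst Bochner_Integration.integral_sum) (simp_all only: Bochner_Integration.integrable_diff int_term Bochner_Integration.integral_diff)
  also have "\<dots> = (\<Sum>k<n. 0)"
  proof (rule sum.cong[OF refl])
    fix k
    have "real k / 2 ^ m < real (Suc k) / 2 ^ m" by (simp add: divide_strict_right_mono)
    from mart[OF _ this H(1)[of k]]
    show "(\<integral>\<omega>. indicator (H k) \<omega> * X (real (Suc k) / 2 ^ m) \<omega> \<partial>M) - (\<integral>\<omega>. indicator (H k) \<omega> * X (real k / 2 ^ m) \<omega> \<partial>M) = 0"
      by simp
  qed
  finally have ES: "(\<integral>\<omega>. S \<omega> \<partial>M) = 0" by simp
  \<comment> \<open>The position left open at the end may lose at most
    \<open>a - X (real N) \<omega>\<close>, which is covered by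
    \<open>\<bar>a\<bar> + \<bar>X (real N) \<omega>\<bar>\<close>.\<close>
  have path: "(b - a) * real (upcross_count (grid m \<omega>) a b n) \<le> S \<omega> + (\<bar>a\<bar> + \<bar>X (real N) \<omega>\<bar>)" if w: "\<omega> \<in> space M" for \<omega>
  proof -
    have "S \<omega> = (\<Sum>k<n. of_bool (upcross_hold (grid m \<omega>) a b k) * (grid m \<omega> (Suc k) - grid m \<omega> k))"
      unfolding S_def using w by (intro sum.cong refl) (auto simp: H_def indicator_def)
    then show ?thesis using upcross_gain[OF ab, of "grid m \<omega>" n] unfolding nN
      by (auto split: if_splits)
  qed
  have "(\<integral>\<^sup>+\<omega>. ennreal (real (upcross_count (grid m \<omega>) a b n)) \<partial>M)
    \<le> (\<integral>\<^sup>+\<omega>. ennreal ((S \<omega> + (\<bar>a\<bar> + \<bar>X (real N) \<omega>\<bar>)) / (b - a)) \<partial>M)"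
    using path ab by (intro nn_integral_mono ennreal_leI) (simp add: pos_le_divide_eq mult.commute)
  also have "\<dots> = ennreal (\<integral>\<omega>. (S \<omega> + (\<bar>a\<bar> + \<bar>X (real N) \<omega>\<bar>)) / (b - a) \<partial>M)"
  proof (rule nn_integral_eq_integral)
    show "integrable M (\<lambda>\<omega>. (S \<omega> + (\<bar>a\<bar> + \<bar>X (real N) \<omega>\<bar>)) / (b - a))"
      using int_S int_X[of "real N"] by auto
    show "AE \<omega> in M. 0 \<le> (S \<omega> + (\<bar>a\<bar> + \<bar>X (real N) \<omega>\<bar>)) / (b - a)"
    proof (rule AE_I2)
      fix \<omega> assume "\<omega> \<in> space M"
      from path[OF this] have "0 \<le> S \<omega> + (\<bar>a\<bar> + \<bar>X (real N) \<omega>\<bar>)"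
        using ab by (smt (verit) mult_nonneg_nonneg of_nat_0_le_iff)
      then show "0 \<le> (S \<omega> + (\<bar>a\<bar> + \<bar>X (real N) \<omega>\<bar>)) / (b - a)" using ab by simp
    qed
  qed
  also have "(\<integral>\<omega>. (S \<omega> + (\<bar>a\<bar> + \<bar>X (real N) \<omega>\<bar>)) / (b - a) \<partial>M) = (\<bar>a\<bar> + (\<integral>\<omega>. \<bar>X (real N) \<omega>\<bar> \<partial>M)) / (b - a)"
    using int_S int_X[of "real N"] ES by (simp add: prob_space)
  finally show ?thesis unfolding n_def .
qed

text \<open>With the lower limit over the levels, Fatou's lemma applies without a proof that the
  counts increase from grid to grid.\<close>

definition "lim_count N a b \<omega> = liminf (\<lambda>m. ennreal (real (upcross_count (grid m \<omega>) a b (N * 2 ^ m))))"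

lemma lim_count_measurable [measurable]: "lim_count N a b \<in> borel_measurable M"
  unfolding lim_count_def[abs_def] by measurable

lemma lim_count_integral:
  assumes ab: "a < b"
  shows "(\<integral>\<^sup>+\<omega>. lim_count N a b \<omega> \<partial>M) \<le> ennreal ((\<bar>a\<bar> + (\<integral>\<omega>. \<bar>X (real N) \<omega>\<bar> \<partial>M)) / (b - a))"
proof -
  have "(\<integral>\<^sup>+\<omega>. lim_count N a b \<omega> \<partial>M) \<le> liminf (\<lambda>m. \<integral>\<^sup>+\<omega>. ennreal (real (upcross_count (grid m \<omega>) a b (N * 2 ^ m))) \<partial>M)"
    unfolding lim_count_def by (rule nn_integral_liminf) measurable
  also have "\<dots> \<le> ennreal ((\<bar>a\<bar> + (\<integral>\<omega>. \<bar>X (real N) \<omega>\<bar> \<partial>M)) / (b - a))"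
    by (rule Liminf_le) (use upcrossing_inequality[OF ab] in auto)
  finally show ?thesis .
qed

lemma oscillates_lim_count:
  assumes "a < b" "oscillates dyadics (\<lambda>t. X t \<omega>) a b K 0 (real N)"
  shows "ennreal (real K) \<le> lim_count N a b \<omega>"
  unfolding lim_count_def
  by (rule Liminf_bounded) (use oscillates_eventually[OF assms] in \<open>auto elim!: eventually_mono intro: ennreal_leI\<close>)

lemma AE_not_oscillates:
  assumes ab: "a < b"
  shows "AE \<omega> in M. \<exists>K. \<not> oscillates dyadics (\<lambda>t. X t \<omega>) a b K 0 (real N)"
proof -
  have "(\<integral>\<^sup>+\<omega>. lim_count N a b \<omega> \<partial>M) \<noteq> \<infinity>"
    using lim_count_integral[OF ab, of N] by (auto simp: top_unique)
  then have "AE \<omega> in M. lim_count N a b \<omega> \<noteq> \<infinity>"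
    by (intro nn_integral_noteq_infinite) auto
  then show ?thesis
  proof eventually_elim
    case (elim \<omega>)
    show ?case
    proof (rule ccontr)
      assume "\<nexists>K. \<not> oscillates dyadics (\<lambda>t. X t \<omega>) a b K 0 (real N)"
      then have "ennreal (real K) \<le> lim_count N a b \<omega>" for K
        using oscillates_lim_count[OF ab] by blast
      moreover obtain n where "lim_count N a b \<omega> < of_nat n"
        using elim ennreal_Ex_less_of_nat[of "lim_count N a b \<omega>"] by (auto simp: less_top)
      ultimately show False by (metis ennreal_of_nat_eq_real_of_nat not_le)
    qed
  qed
qed

text \<open>The upcrossing bound replaces a maximal inequality. A path starts at 0, so exceeding
  \<open>k + 2\<close> at a dyadic time makes a passage from below 1 to above \<open>k + 2\<close>,
  and the expected number of these tends to 0 as \<open>k\<close> grows.\<close>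

lemma AE_bounded_above: "AE \<omega> in M. \<exists>C. \<forall>d\<in>dyadics. d \<le> real N \<longrightarrow> X d \<omega> \<le> C"
proof -
  define C where "C = 1 + (\<integral>\<omega>. \<bar>X (real N) \<omega>\<bar> \<partial>M)"
  \<comment> \<open>Levels 1 and \<open>k + 2\<close>: their distance is \<open>k + 1\<close>, and
    the lower level contributes the summand 1 of \<open>C\<close>.\<close>
  let ?u = "\<lambda>k \<omega>. lim_count N 1 (real k + 2) \<omega>"
  have "(\<integral>\<^sup>+\<omega>. liminf (\<lambda>k. ?u k \<omega>) \<partial>M) \<le> liminf (\<lambda>k. \<integral>\<^sup>+\<omega>. ?u k \<omega> \<partial>M)"
    by (rule nn_integral_liminf) measurable
  also have "\<dots> \<le> liminf (\<lambda>k. ennreal (C / (real k + 1)))"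
    using lim_count_integral[of 1 "real k + 2" N for k]
    by (intro Liminf_mono always_eventually allI) (simp add: C_def add.commute)
  also have "\<dots> = ennreal 0"
  proof (rule lim_imp_Liminf)
    have "(\<lambda>k. C / (real k + 1)) \<longlonglongrightarrow> 0"
      using LIMSEQ_Suc[OF lim_const_over_n[of C]] by (simp add: add.commute)
    then show "((\<lambda>k. ennreal (C / (real k + 1))) \<longlongrightarrow> ennreal 0) sequentially" by (rule tendsto_ennrealI)
  qed simp
  finally have "(\<integral>\<^sup>+\<omega>. liminf (\<lambda>k. ?u k \<omega>) \<partial>M) = 0" by simp
  then have "AE \<omega> in M. liminf (\<lambda>k. ?u k \<omega>) = 0"
    by (subst (asm) nn_integral_0_iff_AE) measurable
  then show ?thesis
    using AE_space
  proof eventually_elim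
    case (elim \<omega>)
    show ?case
    proof (rule ccontr)
      assume n: "\<nexists>C. \<forall>d\<in>dyadics. d \<le> real N \<longrightarrow> X d \<omega> \<le> C"
      have "1 \<le> ?u k \<omega>" for k
      proof -
        obtain d where d: "d \<in> dyadics" "d \<le> real N" "real k + 2 < X d \<omega>"
          using n by (meson not_less)
        have "d \<noteq> 0" using d(3) X_0[OF elim(2)] by auto
        then have "0 < d" using dyadics_nonneg[OF d(1)] by simp
        then have "oscillates dyadics (\<lambda>t. X t \<omega>) 1 (real k + 2) 1 0 (real N)"
          unfolding One_nat_def oscillates.simps using d zero_dyadics X_0[OF elim(2)]
          by (intro bexI[of _ 0] bexI[of _ d]) auto
        from oscillates_lim_count[OF _ this] show ?thesis by simp
      qed
      then have "1 \<le> liminf (\<lambda>k. ?u k \<omega>)" by (intro Liminf_bounded) auto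
      then show False using elim(1) by simp
    qed
  qed
qed

text \<open>The exceptional sets are indexed by pairs of rational levels and by natural horizons,
  hence countable in number. The lower bound is \<open>AE_bounded_above\<close> for
  \<open>- X\<close>.\<close>

lemma AE_regular:
  "AE \<omega> in M. (\<forall>t\<ge>0. \<exists>l. ((\<lambda>t. X t \<omega>) \<longlongrightarrow> l) (at t within dyadics \<inter> {t<..}))
     \<and> (\<forall>t>0. \<exists>l. ((\<lambda>t. X t \<omega>) \<longlongrightarrow> l) (at t within dyadics \<inter> {..<t}))"
proof -
  interpret neg: null_start_martingale M G "\<lambda>t \<omega>. - X t \<omega>" by (rule uminus_martingale)
  have 1: "AE \<omega> in M. \<forall>N a b. a < b \<longrightarrow> (\<exists>K. \<not> oscillates dyadics (\<lambda>t. X t \<omega>) (of_rat a) (of_rat b) K 0 (real N))"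
    unfolding AE_all_countable using AE_not_oscillates by (auto simp: of_rat_less)
  have 2: "AE \<omega> in M. \<forall>N. \<exists>C. \<forall>d\<in>dyadics. d \<le> real N \<longrightarrow> X d \<omega> \<le> C"
    unfolding AE_all_countable using AE_bounded_above by blast
  have 3: "AE \<omega> in M. \<forall>N. \<exists>C. \<forall>d\<in>dyadics. d \<le> real N \<longrightarrow> - X d \<omega> \<le> C"
    unfolding AE_all_countable using neg.AE_bounded_above by blast
  from 1 2 3 show ?thesis
  proof eventually_elim
    case (elim \<omega>)
    have osc: "\<exists>K. \<not> oscillates dyadics (\<lambda>t. X t \<omega>) a b K 0 (real N)" if "a \<in> \<rat>" "b \<in> \<rat>" "a < b" for a b N
    proof -
      obtain a' b' where "a = of_rat a'" "b = of_rat b'" using \<open>a \<in> \<rat>\<close> \<open>b \<in> \<rat>\<close> by (auto elim!: Rats_cases)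
      then show ?thesis using elim(1) that(3) by (auto simp: of_rat_less)
    qed
    have bdd: "\<exists>C. \<forall>d\<in>dyadics. d \<le> real N \<longrightarrow> \<bar>X d \<omega>\<bar> \<le> C" for N
    proof -
      obtain C1 C2 where "\<forall>d\<in>dyadics. d \<le> real N \<longrightarrow> X d \<omega> \<le> C1" "\<forall>d\<in>dyadics. d \<le> real N \<longrightarrow> - X d \<omega> \<le> C2"
        using elim(2,3) by meson
      then have "\<forall>d\<in>dyadics. d \<le> real N \<longrightarrow> \<bar>X d \<omega>\<bar> \<le> max C1 C2" by (auto simp: abs_le_iff)
      then show ?thesis ..
    qed
    show ?case using dyadic_limits[of "\<lambda>t. X t \<omega>", OF osc bdd] by blast
  qed
qed

text \<open>The second moments serve to identify the right limit with \<open>X t\<close>: by Fatou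
  the mean square of the difference is at most the lower limit of
  \<open>dyadic_above n t - t\<close>, which is 0.\<close>

theorem cadlag_modification:
  assumes L2: "\<And>s t. 0 \<le> s \<Longrightarrow> s < t \<Longrightarrow> integrable M (\<lambda>\<omega>. (X t \<omega> - X s \<omega>)\<^sup>2)"
    "\<And>s t. 0 \<le> s \<Longrightarrow> s < t \<Longrightarrow> (\<integral>\<omega>. (X t \<omega> - X s \<omega>)\<^sup>2 \<partial>M) = t - s"
  shows "\<exists>Z. modification M X Z \<and> (\<forall>\<omega>\<in>space M. cadlag (\<lambda>\<tau>. Z \<tau> \<omega>))"
proof -
  define reg where "reg \<omega> \<longleftrightarrow> (\<forall>t\<ge>0. \<exists>l. ((\<lambda>t. X t \<omega>) \<longlongrightarrow> l) (at t within dyadics \<inter> {t<..}))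
     \<and> (\<forall>t>0. \<exists>l. ((\<lambda>t. X t \<omega>) \<longlongrightarrow> l) (at t within dyadics \<inter> {..<t}))" for \<omega>
  have "AE \<omega> in M. reg \<omega>" unfolding reg_def by (rule AE_regular)
  then obtain B where "{\<omega>\<in>space M. \<not> reg \<omega>} \<subseteq> B" and B: "emeasure M B = 0" "B \<in> sets M" by (rule AE_E)
  then have reg: "reg \<omega>" if "\<omega> \<in> space M" "\<omega> \<notin> B" for \<omega> using that by auto
  define l where "l t \<omega> = (SOME l. ((\<lambda>t. X t \<omega>) \<longlongrightarrow> l) (at t within dyadics \<inter> {t<..}))" for t \<omega>
  have l: "((\<lambda>t. X t \<omega>) \<longlongrightarrow> l t \<omega>) (at t within dyadics \<inter> {t<..})"
    if "\<omega> \<in> space M" "\<omega> \<notin> B" "0 \<le> t" for t \<omega>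
    unfolding l_def by (rule someI_ex) (use reg[OF that(1,2)] that(3) in \<open>simp add: reg_def\<close>)
  \<comment> \<open>On the null set \<open>B\<close> the path is constant, so that every path of
    \<open>Z\<close>, not just almost every one, is cadlag.\<close>
  define Z where "Z t \<omega> = (if \<omega> \<in> B then 0 else l t \<omega>)" for t \<omega>
  have seq: "(\<lambda>n. X (dyadic_above n t) \<omega>) \<longlonglongrightarrow> l t \<omega>" if "\<omega> \<in> space M" "\<omega> \<notin> B" "0 \<le> t" for t \<omega>
  proof (rule filterlim_compose[OF l[OF that]])
    show "filterlim (\<lambda>n. dyadic_above n t) (at t within dyadics \<inter> {t<..}) sequentially"
      unfolding filterlim_at using dyadic_above[OF that(3)] dyadic_above_lim[OF that(3)]
      by (auto simp: order_less_imp_not_eq2)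
  qed
  have Zmeas: "Z t \<in> borel_measurable M" if t: "0 \<le> t" for t
  proof (rule borel_measurable_LIMSEQ_real)
    show "(\<lambda>n. indicator (- B) \<omega> * X (dyadic_above n t) \<omega>) \<longlonglongrightarrow> Z t \<omega>" if "\<omega> \<in> space M" for \<omega>
      using seq[OF that _ t] by (cases "\<omega> \<in> B") (auto simp: Z_def)
    show "(\<lambda>\<omega>. indicator (- B) \<omega> * X (dyadic_above n t) \<omega>) \<in> borel_measurable M" for n
      using X_M[OF order.trans[OF t less_imp_le[OF dyadic_above(1)[OF t, of n]]]] B(2) by measurable
  qed
  have ae: "AE \<omega> in M. Z t \<omega> = X t \<omega>" if t: "0 \<le> t" for t
  proof -
    have [measurable]: "X t \<in> borel_measurable M" "Z t \<in> borel_measurable M" using X_M[OF t] Zmeas[OF t] .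
    have [measurable]: "X (dyadic_above n t) \<in> borel_measurable M" for n
      by (rule X_M[OF order.trans[OF t less_imp_le[OF dyadic_above(1)[OF t, of n]]]])
    have notB: "AE \<omega> in M. \<omega> \<notin> B" using B by (intro AE_not_in) (simp add: null_setsI)
    have "(\<integral>\<^sup>+\<omega>. ennreal ((Z t \<omega> - X t \<omega>)\<^sup>2) \<partial>M) = (\<integral>\<^sup>+\<omega>. liminf (\<lambda>n. ennreal ((X (dyadic_above n t) \<omega> - X t \<omega>)\<^sup>2)) \<partial>M)"
    proof (rule nn_integral_cong_AE)
      show "AE \<omega> in M. ennreal ((Z t \<omega> - X t \<omega>)\<^sup>2) = liminf (\<lambda>n. ennreal ((X (dyadic_above n t) \<omega> - X t \<omega>)\<^sup>2))"
        using notB AE_space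
      proof eventually_elim
        case (elim \<omega>)
        have "(\<lambda>n. ennreal ((X (dyadic_above n t) \<omega> - X t \<omega>)\<^sup>2)) \<longlonglongrightarrow> ennreal ((l t \<omega> - X t \<omega>)\<^sup>2)"
          by (intro tendsto_ennrealI tendsto_intros seq elim t)
        from lim_imp_Liminf[OF _ this] show ?case using elim by (simp add: Z_def)
      qed
    qed
    also have "\<dots> \<le> liminf (\<lambda>n. \<integral>\<^sup>+\<omega>. ennreal ((X (dyadic_above n t) \<omega> - X t \<omega>)\<^sup>2) \<partial>M)"
      by (rule nn_integral_liminf) measurable
    also have "\<dots> = liminf (\<lambda>n. ennreal (dyadic_above n t - t))"
    proof -
      have "(\<integral>\<^sup>+\<omega>. ennreal ((X (dyadic_above n t) \<omega> - X t \<omega>)\<^sup>2) \<partial>M) = ennreal (dyadic_above n t - t)" for n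
        using L2[OF t dyadic_above(1)[OF t, of n]] by (subst nn_integral_eq_integral) auto
      then show ?thesis by simp
    qed
    also have "\<dots> = ennreal 0"
    proof (rule lim_imp_Liminf)
      have "(\<lambda>n. dyadic_above n t - t) \<longlonglongrightarrow> t - t" by (intro tendsto_intros dyadic_above_lim t)
      then show "((\<lambda>n. ennreal (dyadic_above n t - t)) \<longlongrightarrow> ennreal 0) sequentially" by (intro tendsto_ennrealI) simp
    qed simp
    finally have "(\<integral>\<^sup>+\<omega>. ennreal ((Z t \<omega> - X t \<omega>)\<^sup>2) \<partial>M) = 0" by simp
    then have "AE \<omega> in M. ennreal ((Z t \<omega> - X t \<omega>)\<^sup>2) = 0" by (subst (asm) nn_integral_0_iff_AE) measurable
    then show ?thesis by eventually_elim simp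
  qed
  have "cadlag (\<lambda>t. Z t \<omega>)" if w: "\<omega> \<in> space M" for \<omega>
  proof (cases "\<omega> \<in> B")
    case True
    then show ?thesis by (auto simp: Z_def cadlag_def)
  next
    case False
    show ?thesis
      by (rule cadlag_regularization[of "\<lambda>t. X t \<omega>"]) (use l[OF w False] reg[OF w False] False in \<open>simp_all add: Z_def reg_def\<close>)
  qed
  then show ?thesis using Zmeas ae by (auto simp: modification_def intro!: exI[of _ Z])
qed

end

text \<open>Right-continuity suffices: for \<open>t\<close> in the open set \<open>I\<close> the
  points \<open>dyadic_above n t\<close> are eventually in \<open>I\<close>, and the closed set
  \<open>K\<close> keeps the limit.\<close>

lemma cadlag_separable:
  assumes "\<And>\<omega>. \<omega> \<in> space M \<Longrightarrow> cadlag (\<lambda>\<tau>. Z \<tau> \<omega>)"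
  shows "separable_process M Z"
  unfolding separable_process_def
proof (intro exI[of _ dyadics] conjI AE_I2 allI impI ballI)
  show "countable dyadics" by (rule countable_dyadics)
  show "dyadics \<subseteq> {0..}" using dyadics_nonneg by auto
  show "{0..} \<subseteq> closure dyadics"
  proof
    fix t :: real assume "t \<in> {0..}"
    then show "t \<in> closure dyadics"
      unfolding closure_sequential using dyadic_above(3)[of t] dyadic_above_lim[of t]
      by (intro exI[of _ "\<lambda>n. dyadic_above n t"]) auto
  qed
  fix \<omega> t and I K :: "real set"
  assume w: "\<omega> \<in> space M" and IK: "open I \<and> closed K \<and> (\<forall>t\<in>dyadics \<inter> I. Z t \<omega> \<in> K)" and t: "t \<in> {0..} \<inter> I"
  then have t0: "0 \<le> t" by simp
  have "\<forall>\<^sub>F n in sequentially. dyadic_above n t \<in> I"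
    using dyadic_above_lim[OF t0] IK t by (auto intro: topological_tendstoD)
  then have ev: "\<forall>\<^sub>F n in sequentially. Z (dyadic_above n t) \<omega> \<in> K"
    by eventually_elim (use IK dyadic_above(3)[OF t0] in auto)
  have "((\<lambda>s. Z s \<omega>) \<longlongrightarrow> Z t \<omega>) (at_right t)" using assms[OF w] t0 by (simp add: cadlag_def)
  moreover have "filterlim (\<lambda>n. dyadic_above n t) (at_right t) sequentially"
    unfolding filterlim_at using dyadic_above_lim[OF t0] dyadic_above(1)[OF t0] by (auto simp: order_less_imp_not_eq2)
  ultimately have "(\<lambda>n. Z (dyadic_above n t) \<omega>) \<longlonglongrightarrow> Z t \<omega>" by (rule filterlim_compose)
  from Lim_in_closed_set[OF _ ev _ this] IK show "Z t \<omega> \<in> K" by simp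
qed

text \<open>On the countable separating set the two processes agree almost surely. Separability,
  applied to open intervals and closed balls, extends each bound for \<open>Z\<close> to all times
  of \<open>Y\<close>, so the one-sided limits of \<open>Z\<close> are also those of
  \<open>Y\<close>.\<close>

lemma separable_limits:
  assumes Z: "\<And>\<omega>. \<omega> \<in> space M \<Longrightarrow> cadlag (\<lambda>\<tau>. Z \<tau> \<omega>)"
    and sep: "separable_process M Y"
    and ae: "\<And>t. 0 \<le> t \<Longrightarrow> AE \<omega> in M. Y t \<omega> = Z t \<omega>"
  shows "AE \<omega> in M. has_one_sided_limits (\<lambda>\<tau>. Y \<tau> \<omega>)"
proof -
  obtain D where D: "countable D" "D \<subseteq> {0..}"
    and DS: "AE \<omega> in M. \<forall>I K. open I \<and> closed K \<and> (\<forall>t\<in>D \<inter> I. Y t \<omega> \<in> K) \<longrightarrow> (\<forall>t\<in>{0..} \<inter> I. Y t \<omega> \<in> K)"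
    using sep unfolding separable_process_def by blast
  have "AE \<omega> in M. \<forall>t\<in>D. Y t \<omega> = Z t \<omega>"
    using D ae by (intro AE_ball_countable[THEN iffD2]) auto
  then show ?thesis using DS AE_space
  proof eventually_elim
    case (elim \<omega>)
    have cad: "cadlag (\<lambda>t. Z t \<omega>)" by (rule Z[OF elim(3)])
    have key: "Y s \<omega> \<in> cball l e"
      if "open I" "\<And>s. s \<in> I \<Longrightarrow> Z s \<omega> \<in> cball l e" "s \<in> I" "0 \<le> s" for I l e s
    proof -
      have "\<forall>t\<in>D \<inter> I. Y t \<omega> \<in> cball l e" using that(2) elim(1) by auto
      then show ?thesis using elim(2)[rule_format, of I "cball l e"] that by auto
    qed
    have "\<exists>l. ((\<lambda>t. Y t \<omega>) \<longlongrightarrow> l) (at_right t)" if t: "0 \<le> t" for t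
    proof -
      have lim: "((\<lambda>s. Z s \<omega>) \<longlongrightarrow> Z t \<omega>) (at_right t)" using cad t by (simp add: cadlag_def)
      have "((\<lambda>s. Y s \<omega>) \<longlongrightarrow> Z t \<omega>) (at_right t)"
      proof (rule tendstoI)
        fix e :: real assume e: "0 < e"
        have "\<forall>\<^sub>F x in at_right t. dist (Z x \<omega>) (Z t \<omega>) < e / 2" using tendstoD[OF lim, of "e/2"] e by simp
        then obtain u where u: "t < u" "\<And>x. t < x \<Longrightarrow> x < u \<Longrightarrow> dist (Z x \<omega>) (Z t \<omega>) < e / 2"
          unfolding eventually_at_right_field by blast
        have "dist (Y x \<omega>) (Z t \<omega>) < e" if x: "t < x" "x < u" for x
        proof -
          have "Y x \<omega> \<in> cball (Z t \<omega>) (e / 2)"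
            using x t u by (intro key[of "{t<..<u}"]) (auto simp: dist_commute intro: less_imp_le)
          then show ?thesis using e by (simp add: dist_commute)
        qed
        then show "\<forall>\<^sub>F x in at_right t. dist (Y x \<omega>) (Z t \<omega>) < e"
          unfolding eventually_at_right_field using u(1) by blast
      qed
      then show ?thesis by blast
    qed
    moreover have "\<exists>l. ((\<lambda>t. Y t \<omega>) \<longlongrightarrow> l) (at_left t)" if t: "0 < t" for t
    proof -
      obtain l where lim: "((\<lambda>s. Z s \<omega>) \<longlongrightarrow> l) (at_left t)" using cad t by (auto simp: cadlag_def)
      have "((\<lambda>s. Y s \<omega>) \<longlongrightarrow> l) (at_left t)"
      proof (rule tendstoI)
        fix e :: real assume e: "0 < e"
        have "\<forall>\<^sub>F x in at_left t. dist (Z x \<omega>) l < e / 2" using tendstoD[OF lim, of "e/2"] e by simp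
        then obtain u where u: "u < t" "\<And>x. u < x \<Longrightarrow> x < t \<Longrightarrow> dist (Z x \<omega>) l < e / 2"
          unfolding eventually_at_left_field by blast
        have "dist (Y x \<omega>) l < e" if x: "max 0 u < x" "x < t" for x
        proof -
          have "Y x \<omega> \<in> cball l (e / 2)"
            using x t u by (intro key[of "{max 0 u<..<t}"]) (auto simp: dist_commute intro: less_imp_le)
          then show ?thesis using e by (simp add: dist_commute)
        qed
        then show "\<forall>\<^sub>F x in at_left t. dist (Y x \<omega>) l < e"
          unfolding eventually_at_left_field using u(1) t by (intro exI[of _ "max 0 u"]) auto
      qed
      then show ?thesis by blast
    qed
    ultimately show ?case by (simp add: has_one_sided_limits_def)
  qed
qed

section \<open>The q-Wiener process\<close>

text \<open>\<open>X\<close> and the rescaled \<open>Y\<close> agree only on \<open>space M\<close>,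
  and their filtrations agree as families of sets; this transports the conditional density from one
  to the other.\<close>

lemma cond_density_cong:
  assumes cd: "cond_density M F W g" and F: "sets F' = sets F"
    and Weq: "\<And>\<omega>. \<omega> \<in> space M \<Longrightarrow> W' \<omega> = W \<omega>"
    and geq: "\<And>\<omega> x. \<omega> \<in> space M \<Longrightarrow> g' (\<omega>, x) = g (\<omega>, x)" and nonneg: "\<And>z. 0 \<le> g' z"
  shows "cond_density M F' W' g'"
proof -
  interpret cond_density M F W g by (rule cd)
  have sp: "space F' = space M" using sets_eq_imp_space_eq[OF F] space_F by simp
  have gz: "g' z = g z" if "z \<in> space (F \<Otimes>\<^sub>M (borel :: real measure))" for z
  proof -
    have "fst z \<in> space M" using that by (simp add: space_pair_measure space_F mem_Times_iff)
    from geq[OF this, of "snd z"] show ?thesis by simp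
  qed
  show ?thesis
  proof (intro cond_density.intro cond_density_axioms.intro)
    show "prob_space M" by (rule prob_space_axioms)
    show "subalgebra M F'" using subalg F sp by (simp add: subalgebra_def)
    show "W' \<in> borel_measurable M" using measurable_cong[of M W' W borel] Weq by simp
    have "g' \<in> borel_measurable (F \<Otimes>\<^sub>M borel)" using measurable_cong[of "F \<Otimes>\<^sub>M borel" g' g borel] gz by simp
    then show "g' \<in> borel_measurable (F' \<Otimes>\<^sub>M borel)"
      unfolding measurable_cong_sets[OF sets_pair_measure_cong[OF F refl] refl] .
    show "0 \<le> g' z" for z by (rule nonneg)
    show "integrable lborel (\<lambda>x. g' (\<omega>, x))" if "\<omega> \<in> space M" for \<omega> using g_int[OF that] geq[OF that] by simp
    show "AE \<omega> in M. (\<integral>x. g' (\<omega>, x) \<partial>lborel) \<le> 1"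
      using g_le AE_space by eventually_elim (simp add: geq)
    fix B a assume B: "B \<in> sets F'"
    have "(\<integral>\<omega>. indicator B \<omega> * indicator {a<..} (W' \<omega>) \<partial>M) = (\<integral>\<omega>. indicator B \<omega> * indicator {a<..} (W \<omega>) \<partial>M)"
      by (intro Bochner_Integration.integral_cong refl) (simp add: Weq)
    also have "\<dots> = (\<integral>\<omega>. indicator B \<omega> * (\<integral>x. indicator {a<..} x * g (\<omega>, x) \<partial>lborel) \<partial>M)"
      using B F by (intro eq_halfline) simp
    also have "\<dots> = (\<integral>\<omega>. indicator B \<omega> * (\<integral>x. indicator {a<..} x * g' (\<omega>, x) \<partial>lborel) \<partial>M)"
      by (intro Bochner_Integration.integral_cong refl) (simp add: geq)
    finally show "(\<integral>\<omega>. indicator B \<omega> * indicator {a<..} (W' \<omega>) \<partial>M)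
      = (\<integral>\<omega>. indicator B \<omega> * (\<integral>x. indicator {a<..} x * g' (\<omega>, x) \<partial>lborel) \<partial>M)" .
  qed
qed

text \<open>Both branches of \<open>q_trans\<close> become one integral, since for
  \<open>\<sigma> = 0\<close> the state is 0 and both kernel parameters vanish. No case distinction
  at time 0 remains afterwards.\<close>

lemma state_space_dom:
  assumes q: "-1 < q" "q \<le> 1" and t: "0 \<le> \<sigma>" "\<sigma> < \<tau>" and y: "y \<in> state_space q \<sigma>"
  shows "mehler_dom q (\<sigma> / \<tau>) (y / sqrt \<tau>)"
    "q_trans q \<sigma> \<tau> f y = (\<integral>x. f (sqrt \<tau> * x) * kern q (\<sigma> / \<tau>) (y / sqrt \<tau>) x \<partial>lborel)"
proof -
  obtain x0 where x0: "x0 \<in> S_q q" "y = sqrt \<sigma> * x0" using y by (auto simp: state_space_def)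
  define \<rho> where "\<rho> = sqrt (\<sigma> / \<tau>)"
  have r: "\<bar>\<rho>\<bar> < 1" "\<rho>\<^sup>2 = \<sigma> / \<tau>" "\<rho> * x0 = y / sqrt \<tau>"
    using t by (auto simp: \<rho>_def real_sqrt_divide power_divide x0(2))
  show d: "mehler_dom q (\<sigma> / \<tau>) (y / sqrt \<tau>)"
    using f_CN_eq_kern(1)[OF q x0(1) r(1)] r by simp
  show "q_trans q \<sigma> \<tau> f y = (\<integral>x. f (sqrt \<tau> * x) * kern q (\<sigma> / \<tau>) (y / sqrt \<tau>) x \<partial>lborel)"
  proof (cases "\<sigma> = 0")
    case True
    then show ?thesis using x0 by (simp add: q_trans_def f_N_eq_kern[OF q])
  next
    case False
    then have "y / sqrt \<sigma> = x0" using x0 t by simp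
    then show ?thesis
      using False f_CN_eq_kern(2)[OF q x0(1) r(1)] r by (simp add: q_trans_def \<rho>_def[symmetric])
  qed
qed

text \<open>Total mass 1 is known for almost every starting value, but boundedness of the transition
  operator concerns all of them; a uniform bound on the mass does the job.\<close>

lemma kern_total_bound:
  assumes q: "-1 < q" "q \<le> 1" and fN: "integrable lborel (f_N q)" "(\<integral>x. f_N q x \<partial>lborel) = 1" and p0: "p0 < 1"
  shows "\<exists>C. \<forall>p s. mehler_dom q p s \<longrightarrow> p \<le> p0 \<longrightarrow> (\<integral>x. kern q p s x \<partial>lborel) \<le> C"
proof (cases "q = 1")
  case True
  have "(\<integral>x. kern q p s x \<partial>lborel) \<le> 1" if "mehler_dom q p s" for p s
  proof -
    have "0 < sqrt (1 - p)" using that by (simp add: mehler_dom_def)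
    from integral_normal_density[OF this, of s] show ?thesis using True by (simp add: kern_def)
  qed
  then show ?thesis by blast
next
  case False
  then have q': "\<bar>q\<bar> < 1" using q by auto
  let ?K = "exp (20 / (1 - sqrt p0) ^ 4 / (1 - \<bar>q\<bar>))"
  have "(\<integral>x. kern q p s x \<partial>lborel) \<le> ?K" if d: "mehler_dom q p s" "p \<le> p0" for p s
  proof -
    have "(\<integral>x. kern q p s x \<partial>lborel) \<le> (\<integral>x. ?K * f_N q x \<partial>lborel)"
      using kern_integrable[OF q fN(1) d(1), of "\<lambda>_. 1" 1] fN(1)
      by (intro integral_mono kern_bound[OF q' d p0]) auto
    then show ?thesis using fN(2) by simp
  qed
  then show ?thesis by blast
qed

lemma feller_q_trans:
  assumes q: "-1 < q" "q \<le> 1" and fN: "integrable lborel (f_N q)" "(\<integral>x. f_N q x \<partial>lborel) = 1"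
  shows "feller_continuous (state_space q) (q_trans q)"
  unfolding feller_continuous_def
proof (intro allI impI)
  fix \<sigma> \<tau> :: real and f :: "real \<Rightarrow> real"
  assume "0 \<le> \<sigma> \<and> \<sigma> < \<tau>" and f: "continuous_on (state_space q \<tau>) f \<and> bounded (f ` state_space q \<tau>)"
  then have t: "0 \<le> \<sigma>" "\<sigma> < \<tau>" "0 < \<tau>" by auto
  \<comment> \<open>The function \<open>f\<close> is continuous on the state space only, so it is
    cut off outside. The jump at the end points is harmless for |q| < 1, where
    \<open>kern_tendsto\<close> asks for no continuity, and for \<open>q = 1\<close> nothing is cut
    off.\<close>
  define \<phi> where "\<phi> x = indicator (S_q q) x * f (sqrt \<tau> * x)" for x
  obtain B where B: "\<And>y. y \<in> state_space q \<tau> \<Longrightarrow> \<bar>f y\<bar> \<le> B" using f by (auto simp: bounded_iff)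
  have fc: "continuous_on (S_q q) (\<lambda>x. f (sqrt \<tau> * x))"
  proof (rule continuous_on_compose2[of "state_space q \<tau>" f "S_q q" "\<lambda>x. sqrt \<tau> * x"])
    show "continuous_on (state_space q \<tau>) f" using f by blast
    show "continuous_on (S_q q) (\<lambda>x. sqrt \<tau> * x)" by (intro continuous_on_mult continuous_on_const continuous_on_id)
    show "(\<lambda>x. sqrt \<tau> * x) ` S_q q \<subseteq> state_space q \<tau>" by (simp add: state_space_def)
  qed
  have "S_q q \<in> sets borel" by (simp add: S_q_def)
  then have \<phi>m: "\<phi> \<in> borel_measurable borel"
    using borel_measurable_continuous_on_indicator[OF _ fc] unfolding \<phi>_def by simp
  have \<phi>B: "\<bar>\<phi> x\<bar> \<le> \<bar>B\<bar>" for x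
  proof (cases "x \<in> S_q q")
    case True
    then have "\<bar>f (sqrt \<tau> * x)\<bar> \<le> B" by (intro B) (unfold state_space_def, rule imageI)
    then show ?thesis using True by (simp add: \<phi>_def order_trans[OF _ abs_ge_self])
  qed (simp add: \<phi>_def)
  have \<phi>c: "continuous_on UNIV \<phi>" if "q = 1" using fc that unfolding \<phi>_def by (simp add: S_q_def)
  have eq: "q_trans q \<sigma> \<tau> f y = (\<integral>x. \<phi> x * kern q (\<sigma> / \<tau>) (y / sqrt \<tau>) x \<partial>lborel)"
    and d: "mehler_dom q (\<sigma> / \<tau>) (y / sqrt \<tau>)" if y: "y \<in> state_space q \<sigma>" for y
  proof -
    show "mehler_dom q (\<sigma> / \<tau>) (y / sqrt \<tau>)" by (rule state_space_dom(1)[OF q t(1,2) y])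
    have "f (sqrt \<tau> * x) * kern q (\<sigma> / \<tau>) (y / sqrt \<tau>) x = \<phi> x * kern q (\<sigma> / \<tau>) (y / sqrt \<tau>) x" for x
    proof (cases "x \<in> S_q q")
      case False
      then have "q \<noteq> 1" by (auto simp: S_q_def)
      then have "q < 1" using q by simp
      then have "kern q (\<sigma> / \<tau>) (y / sqrt \<tau>) x = 0"
        using False q by (intro kern_outside) (auto simp: S_q_iff)
      then show ?thesis by simp
    qed (simp add: \<phi>_def)
    then show "q_trans q \<sigma> \<tau> f y = (\<integral>x. \<phi> x * kern q (\<sigma> / \<tau>) (y / sqrt \<tau>) x \<partial>lborel)"
      unfolding state_space_dom(2)[OF q t(1,2) y] by (simp only:)
  qed
  show "continuous_on (state_space q \<sigma>) (q_trans q \<sigma> \<tau> f) \<and> bounded (q_trans q \<sigma> \<tau> f ` state_space q \<sigma>)"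
  proof
    show "continuous_on (state_space q \<sigma>) (q_trans q \<sigma> \<tau> f)"
      unfolding continuous_on_sequentially
    proof (intro allI ballI impI)
      fix u y assume y: "y \<in> state_space q \<sigma>" and u: "(\<forall>n. u n \<in> state_space q \<sigma>) \<and> u \<longlonglongrightarrow> y"
      have "(\<lambda>n. \<integral>x. \<phi> x * kern q (\<sigma> / \<tau>) (u n / sqrt \<tau>) x \<partial>lborel) \<longlonglongrightarrow> (\<integral>x. \<phi> x * kern q (\<sigma> / \<tau>) (y / sqrt \<tau>) x \<partial>lborel)"
      proof (rule kern_tendsto[OF q fN(1) _ d[OF y] tendsto_const _ \<phi>m \<phi>B \<phi>c])
        show "mehler_dom q (\<sigma> / \<tau>) (u n / sqrt \<tau>)" for n using u by (intro d) simp
        show "(\<lambda>n. u n / sqrt \<tau>) \<longlonglongrightarrow> y / sqrt \<tau>" using u t by (intro tendsto_divide tendsto_const) auto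
      qed
      then show "(q_trans q \<sigma> \<tau> f \<circ> u) \<longlonglongrightarrow> q_trans q \<sigma> \<tau> f y"
        using u y by (simp add: eq o_def)
    qed
    obtain C where C: "\<And>p s. mehler_dom q p s \<Longrightarrow> p \<le> \<sigma> / \<tau> \<Longrightarrow> (\<integral>x. kern q p s x \<partial>lborel) \<le> C"
      using kern_total_bound[OF q fN, of "\<sigma> / \<tau>"] t by auto
    have "\<bar>q_trans q \<sigma> \<tau> f y\<bar> \<le> \<bar>B\<bar> * C" if y: "y \<in> state_space q \<sigma>" for y
    proof -
      let ?k = "kern q (\<sigma> / \<tau>) (y / sqrt \<tau>)"
      have "\<bar>\<integral>x. \<phi> x * ?k x \<partial>lborel\<bar> \<le> (\<integral>x. \<bar>\<phi> x * ?k x\<bar> \<partial>lborel)" by (rule integral_abs_bound)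
      also have "\<dots> \<le> (\<integral>x. \<bar>B\<bar> * ?k x \<partial>lborel)"
      proof (rule integral_mono)
        show "integrable lborel (\<lambda>x. \<bar>\<phi> x * ?k x\<bar>)"
          by (rule integrable_abs[OF kern_integrable[OF q fN(1) d[OF y] \<phi>m \<phi>B]])
        show "integrable lborel (\<lambda>x. \<bar>B\<bar> * ?k x)"
          by (rule kern_integrable[OF q fN(1) d[OF y], where B="\<bar>B\<bar>"]) auto
        show "\<bar>\<phi> x * ?k x\<bar> \<le> \<bar>B\<bar> * ?k x" for x
          unfolding abs_mult abs_of_nonneg[OF kern_nonneg[OF q]]
          by (rule mult_right_mono[OF \<phi>B kern_nonneg[OF q]])
      qed
      also have "\<dots> = \<bar>B\<bar> * (\<integral>x. ?k x \<partial>lborel)" by simp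
      also have "\<dots> \<le> \<bar>B\<bar> * C" by (rule mult_left_mono[OF C[OF d[OF y] order_refl]]) simp
      finally show ?thesis unfolding eq[OF y] .
    qed
    then show "bounded (q_trans q \<sigma> \<tau> f ` state_space q \<sigma>)" unfolding bounded_iff by auto
  qed
qed

section \<open>Filtration, transition kernel and Feller property of the q-Wiener process\<close>

locale qw = ou +
  fixes X :: "real \<Rightarrow> 'a \<Rightarrow> real"
  assumes X_0: "\<omega> \<in> space M \<Longrightarrow> X 0 \<omega> = 0"
    and X_pos: "0 < \<tau> \<Longrightarrow> \<omega> \<in> space M \<Longrightarrow> X \<tau> \<omega> = sqrt \<tau> * Y (ln \<tau> / (2 * \<alpha>)) \<omega>"
begin

abbreviation "F \<sigma> \<equiv> gen_sigma M X {0..\<sigma>}"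
abbreviation "clock \<tau> \<equiv> ln \<tau> / (2 * \<alpha>)"

text \<open>At \<open>\<tau> = 0\<close> the factor \<open>sqrt \<tau>\<close> vanishes, whatever
  \<open>clock 0\<close> denotes, so a single formula covers all times.\<close>

lemma X_Y: "0 \<le> \<tau> \<Longrightarrow> \<omega> \<in> space M \<Longrightarrow> X \<tau> \<omega> = sqrt \<tau> * Y (clock \<tau>) \<omega>"
  using X_0 X_pos by (cases "\<tau> = 0") auto

lemma X_meas: "0 \<le> \<tau> \<Longrightarrow> X \<tau> \<in> borel_measurable M"
  using measurable_cong[of M "X \<tau>" "\<lambda>\<omega>. sqrt \<tau> * Y (clock \<tau>) \<omega>" borel] X_Y by simp

lemma F_subalgebra: "subalgebra M (F \<sigma>)"
  by (rule gen_sigma_subalgebra) (auto intro: X_meas)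

lemma X_F: "0 \<le> u \<Longrightarrow> u \<le> \<sigma> \<Longrightarrow> X u \<in> borel_measurable (F \<sigma>)"
  by (rule gen_sigma_measurable) simp

lemma X_state: "0 \<le> \<tau> \<Longrightarrow> \<omega> \<in> space M \<Longrightarrow> X \<tau> \<omega> \<in> state_space q \<tau>"
  using X_Y Y_S by (auto simp: state_space_def)

lemma F_0: "sets (F 0) \<subseteq> {{}, space M}"
proof -
  interpret T: sigma_algebra "space M" "{{}, space M}" by (rule sigma_algebra_trivial)
  have "sigma_sets (space M) (\<Union>i\<in>{0..0::real}. {X i -` A \<inter> space M | A. A \<in> sets borel}) \<subseteq> {{}, space M}"
  proof (rule T.sigma_sets_subset, rule subsetI)
    fix B assume "B \<in> (\<Union>i\<in>{0..0::real}. {X i -` A \<inter> space M | A. A \<in> sets borel})"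
    then obtain A where "B = X 0 -` A \<inter> space M" by auto
    then show "B \<in> {{}, space M}" using X_0 by (cases "0 \<in> A") auto
  qed
  then show ?thesis by (simp add: sets_gen_sigma)
qed

text \<open>The clock maps the times in \<open>{0<..\<sigma>}\<close> increasingly onto
  \<open>{..clock \<sigma>}\<close>, and the constant \<open>X 0\<close> adds no
  information.\<close>

lemma F_past: assumes s: "0 < \<sigma>" shows "sets (F \<sigma>) = sets (past (clock \<sigma>))"
proof
  have 1: "X u -` A \<inter> space M \<in> sets (past (clock \<sigma>))" if u: "0 \<le> u" "u \<le> \<sigma>" and A: "A \<in> sets borel" for u A
  proof -
    have "X u \<in> borel_measurable (past (clock \<sigma>))"
    proof (cases "u = 0")
      case True
      then show ?thesis using measurable_cong[of "past (clock \<sigma>)" "X u" "\<lambda>_. 0" borel] X_0 by (simp add: space_gen_sigma)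
    next
      case False
      then have "clock u \<le> clock \<sigma>" using u s alpha by (intro divide_right_mono) auto
      then have "Y (clock u) \<in> borel_measurable (past (clock \<sigma>))" by (intro gen_sigma_measurable) simp
      then have "(\<lambda>\<omega>. sqrt u * Y (clock u) \<omega>) \<in> borel_measurable (past (clock \<sigma>))" by simp
      then show ?thesis
        using measurable_cong[of "past (clock \<sigma>)" "X u" "\<lambda>\<omega>. sqrt u * Y (clock u) \<omega>" borel] X_Y[OF u(1)]
        by (simp add: space_gen_sigma)
    qed
    from measurable_sets[OF this A] show ?thesis by (simp add: space_gen_sigma)
  qed
  show "sets (F \<sigma>) \<subseteq> sets (past (clock \<sigma>))"
    unfolding sets_gen_sigma[of M X]
    by (rule sets.sigma_sets_subset[of _ "past (clock \<sigma>)", unfolded space_gen_sigma]) (use 1 in auto)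
  have 2: "Y t -` A \<inter> space M \<in> sets (F \<sigma>)" if t: "t \<le> clock \<sigma>" and A: "A \<in> sets borel" for t A
  proof -
    define u where "u = exp (2 * \<alpha> * t)"
    have "2 * \<alpha> * t \<le> ln \<sigma>" using t alpha by (simp add: field_simps)
    then have u: "0 < u" "u \<le> \<sigma>" "clock u = t" using s alpha by (auto simp: u_def ln_ge_iff)
    have "(\<lambda>\<omega>. X u \<omega> / sqrt u) \<in> borel_measurable (F \<sigma>)" using X_F[of u \<sigma>] u by simp
    then have "Y t \<in> borel_measurable (F \<sigma>)"
      using measurable_cong[of "F \<sigma>" "Y t" "\<lambda>\<omega>. X u \<omega> / sqrt u" borel] X_pos[OF u(1)] u by (simp add: space_gen_sigma)
    from measurable_sets[OF this A] show ?thesis by (simp add: space_gen_sigma)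
  qed
  show "sets (past (clock \<sigma>)) \<subseteq> sets (F \<sigma>)"
    unfolding sets_gen_sigma[of M Y]
    by (rule sets.sigma_sets_subset[of _ "F \<sigma>", unfolded space_gen_sigma]) (use 2 in auto)
qed

lemma X_kern:
  assumes t: "0 \<le> \<sigma>" "\<sigma> < \<tau>" and w: "\<omega> \<in> space M"
  shows "kern q (\<sigma> / \<tau>) (X \<sigma> \<omega> / sqrt \<tau>) x = kern q ((sqrt (\<sigma> / \<tau>))\<^sup>2) (sqrt (\<sigma> / \<tau>) * Y (clock \<sigma>) \<omega>) x"
  using t X_Y[OF t(1) w] by (simp add: real_sqrt_divide power_divide)

lemma X_cond_density:
  assumes t: "0 \<le> \<sigma>" "\<sigma> < \<tau>"
  shows "cond_density M (F \<sigma>) (\<lambda>\<omega>. X \<tau> \<omega> / sqrt \<tau>) (\<lambda>z. kern q (\<sigma> / \<tau>) (X \<sigma> (fst z) / sqrt \<tau>) (snd z))"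
proof (cases "\<sigma> = 0")
  case False
  then have s: "0 < \<sigma>" using t by simp
  \<comment> \<open>The time change turns a ratio of times into a correlation:
    \<open>clock \<tau> - clock \<sigma>\<close> is exactly the lag of
    \<open>sqrt (\<sigma> / \<tau>)\<close>.\<close>
  define \<rho> where "\<rho> = sqrt (\<sigma> / \<tau>)"
  have r: "0 < \<rho>" "\<rho> < 1" using s t by (auto simp: \<rho>_def)
  have "ln \<rho> = (ln \<sigma> - ln \<tau>) / 2" using s t by (simp add: \<rho>_def ln_sqrt ln_div)
  then have c: "clock \<sigma> + lag \<rho> = clock \<tau>" using alpha by (simp add: field_simps)
  show ?thesis
  proof (rule cond_density_cong[OF ou_cond_density[OF r, of "clock \<sigma>", unfolded c] F_past[OF s]])
    show "X \<tau> \<omega> / sqrt \<tau> = Y (clock \<tau>) \<omega>" if "\<omega> \<in> space M" for \<omega>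
      using X_pos[OF _ that, of \<tau>] s t by simp
    show "kern q (\<sigma> / \<tau>) (X \<sigma> (fst (\<omega>, x)) / sqrt \<tau>) (snd (\<omega>, x))
      = kern q (\<rho>\<^sup>2) (\<rho> * Y (clock \<sigma>) (fst (\<omega>, x))) (snd (\<omega>, x))" if "\<omega> \<in> space M" for \<omega> x
      using X_kern[OF t that] by (simp add: \<rho>_def)
  qed (rule kern_nonneg[OF q])
next
  case True
  have tau: "0 < \<tau>" using t by simp
  show ?thesis
  proof (intro cond_density.intro cond_density_axioms.intro prob_space_axioms F_subalgebra)
    show "(\<lambda>\<omega>. X \<tau> \<omega> / sqrt \<tau>) \<in> borel_measurable M" using X_meas[of \<tau>] tau by simp
    have [measurable]: "X \<sigma> \<in> borel_measurable (F \<sigma>)" using X_F t by simp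
    show "(\<lambda>z. kern q (\<sigma> / \<tau>) (X \<sigma> (fst z) / sqrt \<tau>) (snd z)) \<in> borel_measurable (F \<sigma> \<Otimes>\<^sub>M borel)"
      by (rule kern_measurable[OF q]) measurable
    show "0 \<le> kern q (\<sigma> / \<tau>) (X \<sigma> (fst z) / sqrt \<tau>) (snd z)" for z by (rule kern_nonneg[OF q])
    have k: "kern q (\<sigma> / \<tau>) (X \<sigma> (fst (\<omega>, x)) / sqrt \<tau>) (snd (\<omega>, x)) = f_N q x" if "\<omega> \<in> space M" for \<omega> x
      using True X_0[OF that] by (simp add: f_N_eq_kern[OF q])
    show "integrable lborel (\<lambda>x. kern q (\<sigma> / \<tau>) (X \<sigma> (fst (\<omega>, x)) / sqrt \<tau>) (snd (\<omega>, x)))" if "\<omega> \<in> space M" for \<omega>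
      unfolding k[OF that] by (rule fN_integrable)
    show "AE \<omega> in M. (\<integral>x. kern q (\<sigma> / \<tau>) (X \<sigma> (fst (\<omega>, x)) / sqrt \<tau>) (snd (\<omega>, x)) \<partial>lborel) \<le> 1"
      by (rule AE_I2) (simp only: k fN_integral)
    fix B a assume "B \<in> sets (F \<sigma>)"
    \<comment> \<open>At time 0 only the trivial events have to be checked, and the conditional law
      is the marginal law of \<open>Y\<close>.\<close>
    then have B: "B = {} \<or> B = space M" using F_0 True by auto
    define I where "I = (\<integral>x. f_N q x * indicator {a<..} x \<partial>lborel)"
    have e: "(\<integral>\<omega>. indicator B \<omega> * (\<integral>x. indicator {a<..} x * kern q (\<sigma> / \<tau>) (X \<sigma> (fst (\<omega>, x)) / sqrt \<tau>) (snd (\<omega>, x)) \<partial>lborel) \<partial>M)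
      = (\<integral>\<omega>. indicator B \<omega> * I \<partial>M)"
      unfolding I_def by (intro Bochner_Integration.integral_cong refl) (simp only: k mult.commute)
    have "(\<integral>\<omega>. (indicator {a<..} (X \<tau> \<omega> / sqrt \<tau>) :: real) \<partial>M) = (\<integral>\<omega>. indicator {a<..} (Y (clock \<tau>) \<omega>) \<partial>M)"
      using X_pos[OF tau] tau by (intro Bochner_Integration.integral_cong refl) simp
    also have "\<dots> = I" unfolding I_def by (rule Y_integral(1)) simp
    finally have i: "(\<integral>\<omega>. (indicator {a<..} (X \<tau> \<omega> / sqrt \<tau>) :: real) \<partial>M) = I" .
    show "(\<integral>\<omega>. indicator B \<omega> * indicator {a<..} (X \<tau> \<omega> / sqrt \<tau>) \<partial>M) =
      (\<integral>\<omega>. indicator B \<omega> * (\<integral>x. indicator {a<..} x * kern q (\<sigma> / \<tau>) (X \<sigma> (fst (\<omega>, x)) / sqrt \<tau>) (snd (\<omega>, x)) \<partial>lborel) \<partial>M)"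
      unfolding e
    proof (cases "B = {}")
      case False
      then have B: "B = space M" using B by simp
      have "(\<integral>\<omega>. indicator B \<omega> * indicator {a<..} (X \<tau> \<omega> / sqrt \<tau>) \<partial>M) = (\<integral>\<omega>. (indicator {a<..} (X \<tau> \<omega> / sqrt \<tau>) :: real) \<partial>M)"
        by (intro Bochner_Integration.integral_cong refl) (simp add: B)
      moreover have "(\<integral>\<omega>. indicator B \<omega> * I \<partial>M) = (\<integral>\<omega>. I \<partial>M)"
        by (intro Bochner_Integration.integral_cong refl) (simp add: B)
      ultimately show "(\<integral>\<omega>. indicator B \<omega> * indicator {a<..} (X \<tau> \<omega> / sqrt \<tau>) \<partial>M) = (\<integral>\<omega>. indicator B \<omega> * I \<partial>M)"
        using i by (simp add: prob_space)
    qed simp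
  qed
qed

lemma X_markov: "markov_with_transitions M X (q_trans q)"
  unfolding markov_with_transitions_def has_cond_exp_def
proof (intro allI impI ballI)
  fix \<sigma> \<tau> :: real and f :: "real \<Rightarrow> real"
  assume "0 \<le> \<sigma> \<and> \<sigma> < \<tau>" and f[measurable]: "f \<in> borel_measurable borel" and b: "bounded (range f)"
  then have t: "0 \<le> \<sigma>" "\<sigma> < \<tau>" "0 < \<tau>" by auto
  interpret cd: cond_density M "F \<sigma>" "\<lambda>\<omega>. X \<tau> \<omega> / sqrt \<tau>" "\<lambda>z. kern q (\<sigma> / \<tau>) (X \<sigma> (fst z) / sqrt \<tau>) (snd z)"
    by (rule X_cond_density[OF t(1,2)])
  obtain B where B: "\<And>x. \<bar>f x\<bar> \<le> B" using b by (auto simp: bounded_iff)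
  have [measurable]: "X \<tau> \<in> borel_measurable M" using X_meas t by simp
  have i: "integrable M (\<lambda>\<omega>. f (X \<tau> \<omega>))" by (rule integrable_const_bound[of _ B]) (use B in auto)
  have fm: "(\<lambda>z. f (sqrt \<tau> * snd z)) \<in> borel_measurable (F \<sigma> \<Otimes>\<^sub>M borel)" by measurable
  have "AE \<omega> in M. real_cond_exp M (F \<sigma>) (\<lambda>\<omega>. f (sqrt \<tau> * snd (\<omega>, X \<tau> \<omega> / sqrt \<tau>))) \<omega>
    = (\<integral>x. f (sqrt \<tau> * snd (\<omega>, x)) * kern q (\<sigma> / \<tau>) (X \<sigma> (fst (\<omega>, x)) / sqrt \<tau>) (snd (\<omega>, x)) \<partial>lborel)"
    by (rule cd.cond_exp_density(2)[OF fm]) (use i t in simp)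
  then have "AE \<omega> in M. real_cond_exp M (F \<sigma>) (\<lambda>\<omega>. f (X \<tau> \<omega>)) \<omega> = q_trans q \<sigma> \<tau> f (X \<sigma> \<omega>)"
    using AE_space
  proof eventually_elim
    case (elim \<omega>)
    then show ?case using t state_space_dom(2)[OF q t(1,2) X_state[OF t(1) elim(2)], of f] by simp
  qed
  with i show "integrable M (\<lambda>\<omega>. f (X \<tau> \<omega>)) \<and> (AE \<omega> in M. real_cond_exp M (F \<sigma>) (\<lambda>\<omega>. f (X \<tau> \<omega>)) \<omega> = q_trans q \<sigma> \<tau> f (X \<sigma> \<omega>))"
    by simp
qed

lemma X_feller: "feller_continuous (state_space q) (q_trans q)"
  by (rule feller_q_trans[OF q fN_integrable fN_integral])

end

section \<open>Conditional moments of the increments\<close>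

lemma normal_centered_moments:
  assumes "0 < \<sigma>"
  shows "(\<integral>x. (x - \<mu>) * normal_density \<mu> \<sigma> x \<partial>lborel) = 0"
    "(\<integral>x. (x - \<mu>)\<^sup>2 * normal_density \<mu> \<sigma> x \<partial>lborel) = \<sigma>\<^sup>2"
    "(\<integral>x. (x - \<mu>) ^ 3 * normal_density \<mu> \<sigma> x \<partial>lborel) = 0"
    "(\<integral>x. (x - \<mu>) ^ 4 * normal_density \<mu> \<sigma> x \<partial>lborel) = 3 * \<sigma> ^ 4"
proof -
  note c = mult.commute[of "normal_density \<mu> \<sigma> _"]
  show "(\<integral>x. (x - \<mu>) * normal_density \<mu> \<sigma> x \<partial>lborel) = 0"
    using integral_normal_moment_odd[OF assms, of \<mu> 0] by (simp add: c)
  show "(\<integral>x. (x - \<mu>) ^ 3 * normal_density \<mu> \<sigma> x \<partial>lborel) = 0"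
    using integral_normal_moment_odd[OF assms, of \<mu> 1] by (simp add: c numeral_3_eq_3)
  show "(\<integral>x. (x - \<mu>)\<^sup>2 * normal_density \<mu> \<sigma> x \<partial>lborel) = \<sigma>\<^sup>2"
    using integral_normal_moment_even[OF assms, of \<mu> 1] by (simp add: c)
  have "fact 4 = (24::real)" by (simp add: fact_numeral)
  then show "(\<integral>x. (x - \<mu>) ^ 4 * normal_density \<mu> \<sigma> x \<partial>lborel) = 3 * \<sigma> ^ 4"
    using integral_normal_moment_even[OF assms, of \<mu> 2] assms
    by (simp add: c power_divide power2_eq_square power4_eq_xxxx)
qed

context ou_lt_1
begin

lemma mom_poly:
  assumes d: "mehler_dom q (\<rho>\<^sup>2) (\<rho> * y)"
  shows "(\<integral>x. (c0 + c1 * x + c2 * x ^ 2 + c3 * x ^ 3 + c4 * x ^ 4) * kern q (\<rho>\<^sup>2) (\<rho> * y) x \<partial>lborel)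
    = c0 * mom 0 \<rho> y + c1 * mom 1 \<rho> y + c2 * mom 2 \<rho> y + c3 * mom 3 \<rho> y + c4 * mom 4 \<rho> y"
proof -
  let ?k = "kern q (\<rho>\<^sup>2) (\<rho> * y)"
  have i: "integrable lborel (\<lambda>x. c * (x ^ n * ?k x))" for c n
    by (rule integrable_mult_right[OF pow_int[OF d]])
  have "(\<integral>x. (c0 + c1 * x + c2 * x ^ 2 + c3 * x ^ 3 + c4 * x ^ 4) * ?k x \<partial>lborel)
    = (\<integral>x. c0 * (x ^ 0 * ?k x) + c1 * (x ^ 1 * ?k x) + c2 * (x ^ 2 * ?k x) + c3 * (x ^ 3 * ?k x) + c4 * (x ^ 4 * ?k x) \<partial>lborel)"
    by (intro Bochner_Integration.integral_cong refl) (simp add: algebra_simps)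
  also have "\<dots> = (\<integral>x. c0 * (x ^ 0 * ?k x) \<partial>lborel) + (\<integral>x. c1 * (x ^ 1 * ?k x) \<partial>lborel)
     + (\<integral>x. c2 * (x ^ 2 * ?k x) \<partial>lborel) + (\<integral>x. c3 * (x ^ 3 * ?k x) \<partial>lborel) + (\<integral>x. c4 * (x ^ 4 * ?k x) \<partial>lborel)"
    by (simp only: Bochner_Integration.integral_add Bochner_Integration.integrable_add i)
  also have "\<dots> = c0 * mom 0 \<rho> y + c1 * mom 1 \<rho> y + c2 * mom 2 \<rho> y + c3 * mom 3 \<rho> y + c4 * mom 4 \<rho> y"
    unfolding mom_def by (simp only: integral_mult_right_zero)
  finally show ?thesis .
qed

text \<open>For the q-Wiener process \<open>a = sqrt \<tau>\<close>, so
  \<open>a * \<rho> * y\<close> is \<open>X\<^sub>\<sigma>\<close> while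
  \<open>a\<^sup>2 * (1 - \<rho>\<^sup>2)\<close> and \<open>a\<^sup>2 * \<rho>\<^sup>2\<close> are
  \<open>\<tau> - \<sigma>\<close> and \<open>\<sigma>\<close>. In these terms the claims are
  polynomial identities between moments.\<close>

lemma increment_moments_lt_1:
  fixes a :: real
  assumes r: "0 \<le> \<rho>" "\<rho> < 1"
  shows "AE \<omega> in M. let y = Y t \<omega>; k = kern q (\<rho>\<^sup>2) (\<rho> * y) in
    (\<integral>x. (a * x - a * \<rho> * y) ^ 0 * k x \<partial>lborel) = 1 \<and>
    (\<integral>x. (a * x - a * \<rho> * y) ^ 1 * k x \<partial>lborel) = 0 \<and>
    (\<integral>x. (a * x - a * \<rho> * y) ^ 2 * k x \<partial>lborel) = a\<^sup>2 * (1 - \<rho>\<^sup>2) \<and>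
    (0 < \<rho> \<longrightarrow> (\<integral>x. (a * x - a * \<rho> * y) ^ 3 * k x \<partial>lborel) = - (1 - q) * (a\<^sup>2 * (1 - \<rho>\<^sup>2)) * (a * \<rho> * y)) \<and>
    (0 < \<rho> \<longrightarrow> (\<integral>x. (a * x - a * \<rho> * y) ^ 4 * k x \<partial>lborel)
       = a\<^sup>2 * (1 - \<rho>\<^sup>2) * ((a * \<rho> * y)\<^sup>2 * (1 - q)\<^sup>2 + (2 + q) * (a\<^sup>2 * (1 - \<rho>\<^sup>2)) + a\<^sup>2 * \<rho>\<^sup>2 * (1 - q\<^sup>2)))"
proof -
  have ra: "\<bar>\<rho>\<bar> < 1" using r by simp
  have "AE \<omega> in M. 0 < \<rho> \<longrightarrow> mom 3 \<rho> (Y t \<omega>) = \<rho> ^ 3 * Y t \<omega> ^ 3 + (1 - \<rho>\<^sup>2) * \<rho> * (2 + q) * Y t \<omega> \<and>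
    mom 4 \<rho> (Y t \<omega>) = \<rho> ^ 4 * Y t \<omega> ^ 4 + (1 - \<rho>\<^sup>2) * (\<rho>\<^sup>2 * (Y t \<omega>)\<^sup>2 * (3 + 2 * q + q\<^sup>2) + (1 - \<rho>\<^sup>2) * (2 + q) + \<rho>\<^sup>2 * (1 - q\<^sup>2))"
    using mom_3_4[OF _ r(2), of t] by (cases "0 < \<rho>") auto
  then show ?thesis
    using mom_0[OF ra, of t] mom_1[OF ra, of t] mom_2[OF ra, of t] AE_space
  proof eventually_elim
    case (elim \<omega>)
    define y where "y = Y t \<omega>"
    let ?k = "kern q (\<rho>\<^sup>2) (\<rho> * y)"
    have m: "mom 0 \<rho> y = 1" "mom 1 \<rho> y = \<rho> * y" "mom 2 \<rho> y = \<rho>\<^sup>2 * y\<^sup>2 + 1 - \<rho>\<^sup>2"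
      "0 < \<rho> \<Longrightarrow> mom 3 \<rho> y = \<rho> ^ 3 * y ^ 3 + (1 - \<rho>\<^sup>2) * \<rho> * (2 + q) * y"
      "0 < \<rho> \<Longrightarrow> mom 4 \<rho> y = \<rho> ^ 4 * y ^ 4 + (1 - \<rho>\<^sup>2) * (\<rho>\<^sup>2 * y\<^sup>2 * (3 + 2 * q + q\<^sup>2) + (1 - \<rho>\<^sup>2) * (2 + q) + \<rho>\<^sup>2 * (1 - q\<^sup>2))"
      using elim unfolding y_def by blast+
    note d = S_dom[OF Y_rad[OF elim(5), of t] ra, folded y_def]
    have eq: "(\<integral>x. h x * ?k x \<partial>lborel) = c0 * mom 0 \<rho> y + c1 * mom 1 \<rho> y + c2 * mom 2 \<rho> y + c3 * mom 3 \<rho> y + c4 * mom 4 \<rho> y"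
      if "\<And>x. h x = c0 + c1 * x + c2 * x ^ 2 + c3 * x ^ 3 + c4 * x ^ 4" for h c0 c1 c2 c3 c4
      unfolding that by (rule mom_poly[OF d])
    have 0: "(\<integral>x. (a * x - a * \<rho> * y) ^ 0 * ?k x \<partial>lborel) = 1"
      using eq[of "\<lambda>x. (a * x - a * \<rho> * y) ^ 0" 1 0 0 0 0] m by simp
    have 1: "(\<integral>x. (a * x - a * \<rho> * y) ^ 1 * ?k x \<partial>lborel) = 0"
      using eq[of "\<lambda>x. (a * x - a * \<rho> * y) ^ 1" "- (a * \<rho> * y)" a 0 0 0] m by simp
    have 2: "(\<integral>x. (a * x - a * \<rho> * y) ^ 2 * ?k x \<partial>lborel) = a\<^sup>2 * (1 - \<rho>\<^sup>2)"
    proof -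
      have "(\<integral>x. (a * x - a * \<rho> * y) ^ 2 * ?k x \<partial>lborel)
        = a\<^sup>2 * \<rho>\<^sup>2 * y\<^sup>2 * mom 0 \<rho> y + (- 2 * a\<^sup>2 * \<rho> * y) * mom 1 \<rho> y + a\<^sup>2 * mom 2 \<rho> y + 0 * mom 3 \<rho> y + 0 * mom 4 \<rho> y"
        by (rule eq) algebra
      then show ?thesis unfolding m(1-3) by algebra
    qed
    have 3: "(\<integral>x. (a * x - a * \<rho> * y) ^ 3 * ?k x \<partial>lborel) = - (1 - q) * (a\<^sup>2 * (1 - \<rho>\<^sup>2)) * (a * \<rho> * y)" if p: "0 < \<rho>"
    proof -
      have "(\<integral>x. (a * x - a * \<rho> * y) ^ 3 * ?k x \<partial>lborel)
        = (- (a ^ 3 * \<rho> ^ 3 * y ^ 3)) * mom 0 \<rho> y + (3 * a ^ 3 * \<rho>\<^sup>2 * y\<^sup>2) * mom 1 \<rho> y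
          + (- 3 * a ^ 3 * \<rho> * y) * mom 2 \<rho> y + a ^ 3 * mom 3 \<rho> y + 0 * mom 4 \<rho> y"
        by (rule eq) algebra
      then show ?thesis unfolding m(1-3) m(4)[OF p] by algebra
    qed
    have 4: "(\<integral>x. (a * x - a * \<rho> * y) ^ 4 * ?k x \<partial>lborel)
       = a\<^sup>2 * (1 - \<rho>\<^sup>2) * ((a * \<rho> * y)\<^sup>2 * (1 - q)\<^sup>2 + (2 + q) * (a\<^sup>2 * (1 - \<rho>\<^sup>2)) + a\<^sup>2 * \<rho>\<^sup>2 * (1 - q\<^sup>2))" if p: "0 < \<rho>"
    proof -
      have "(\<integral>x. (a * x - a * \<rho> * y) ^ 4 * ?k x \<partial>lborel)
        = (a ^ 4 * \<rho> ^ 4 * y ^ 4) * mom 0 \<rho> y + (- 4 * a ^ 4 * \<rho> ^ 3 * y ^ 3) * mom 1 \<rho> y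
          + (6 * a ^ 4 * \<rho>\<^sup>2 * y\<^sup>2) * mom 2 \<rho> y + (- 4 * a ^ 4 * \<rho> * y) * mom 3 \<rho> y + a ^ 4 * mom 4 \<rho> y"
        by (rule eq) algebra
      then show ?thesis unfolding m(1-3) m(4)[OF p] m(5)[OF p] by algebra
    qed
    show ?case unfolding Let_def y_def[symmetric] using 0 1 2 3 4 by blast
  qed
qed

end

context qw
begin

definition "incr_mom k \<sigma> \<tau> \<omega> = (\<integral>x. (sqrt \<tau> * x - X \<sigma> \<omega>) ^ k * kern q (\<sigma> / \<tau>) (X \<sigma> \<omega> / sqrt \<tau>) x \<partial>lborel)"

text \<open>The orders up to 2 include \<open>\<sigma> = 0\<close>, because the martingale
  properties and the variance of increments are used from time 0 on.\<close>

lemma incr_mom: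
  assumes t: "0 \<le> \<sigma>" "\<sigma> < \<tau>"
  shows "AE \<omega> in M. incr_mom 0 \<sigma> \<tau> \<omega> = 1 \<and> incr_mom 1 \<sigma> \<tau> \<omega> = 0 \<and> incr_mom 2 \<sigma> \<tau> \<omega> = \<tau> - \<sigma> \<and>
    (0 < \<sigma> \<longrightarrow> incr_mom 3 \<sigma> \<tau> \<omega> = - (1 - q) * (\<tau> - \<sigma>) * X \<sigma> \<omega> \<and>
    incr_mom 4 \<sigma> \<tau> \<omega> = (\<tau> - \<sigma>) * ((X \<sigma> \<omega>)\<^sup>2 * (1 - q)\<^sup>2 + (2 + q) * (\<tau> - \<sigma>) + \<sigma> * (1 - q\<^sup>2)))"
proof (cases "q = 1")
  case True
  have tau: "0 < \<tau>" using t by simp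
  show ?thesis
  proof (rule AE_I2)
    fix \<omega>
    define s sd where "s = X \<sigma> \<omega> / sqrt \<tau>" and "sd = sqrt (1 - \<sigma> / \<tau>)"
    have sd: "0 < sd" "sd\<^sup>2 = 1 - \<sigma> / \<tau>" using t by (auto simp: sd_def)
    have e: "incr_mom k \<sigma> \<tau> \<omega> = sqrt \<tau> ^ k * (\<integral>x. (x - s) ^ k * normal_density s sd x \<partial>lborel)" for k
    proof -
      have "sqrt \<tau> * x - X \<sigma> \<omega> = sqrt \<tau> * (x - s)" for x using tau by (simp add: s_def field_simps)
      then show ?thesis
        unfolding incr_mom_def using True by (simp add: kern_def s_def[symmetric] sd_def[symmetric] power_mult_distrib mult.assoc)
    qed
    have ts: "(sqrt \<tau>)\<^sup>2 * sd\<^sup>2 = \<tau> - \<sigma>" using tau sd(2) by (simp add: field_simps)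
    \<comment> \<open>For \<open>q = 1\<close> the claimed fourth moment reduces to the Gaussian
      value \<open>3 * (\<tau> - \<sigma>)\<^sup>2\<close>.\<close>
    have "sqrt \<tau> ^ 4 * (3 * sd ^ 4) = 3 * ((sqrt \<tau>)\<^sup>2 * sd\<^sup>2)\<^sup>2" by algebra
    then have 4: "sqrt \<tau> ^ 4 * (3 * sd ^ 4) = 3 * (\<tau> - \<sigma>)\<^sup>2" unfolding ts .
    show "incr_mom 0 \<sigma> \<tau> \<omega> = 1 \<and> incr_mom 1 \<sigma> \<tau> \<omega> = 0 \<and> incr_mom 2 \<sigma> \<tau> \<omega> = \<tau> - \<sigma> \<and>
      (0 < \<sigma> \<longrightarrow> incr_mom 3 \<sigma> \<tau> \<omega> = - (1 - q) * (\<tau> - \<sigma>) * X \<sigma> \<omega> \<and>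
      incr_mom 4 \<sigma> \<tau> \<omega> = (\<tau> - \<sigma>) * ((X \<sigma> \<omega>)\<^sup>2 * (1 - q)\<^sup>2 + (2 + q) * (\<tau> - \<sigma>) + \<sigma> * (1 - q\<^sup>2)))"
      unfolding e power_0 power_one_right normal_centered_moments[OF sd(1)] ts 4
      using True integral_normal_density[OF sd(1), of s] by (simp add: power2_eq_square)
  qed
next
  case False
  interpret l: ou_lt_1 M \<alpha> q Y by unfold_locales (use False q in auto)
  have tau: "0 < \<tau>" using t by simp
  define \<rho> where "\<rho> = sqrt (\<sigma> / \<tau>)"
  have r: "0 \<le> \<rho>" "\<rho> < 1" "0 < \<sigma> \<Longrightarrow> 0 < \<rho>" using t by (auto simp: \<rho>_def)
  have a: "(sqrt \<tau>)\<^sup>2 * (1 - \<rho>\<^sup>2) = \<tau> - \<sigma>" "(sqrt \<tau>)\<^sup>2 * \<rho>\<^sup>2 = \<sigma>" using t by (auto simp: \<rho>_def field_simps)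
  show ?thesis
    using l.increment_moments_lt_1[OF r(1,2), of "clock \<sigma>" "sqrt \<tau>"] AE_space
  proof eventually_elim
    case (elim \<omega>)
    have x: "sqrt \<tau> * \<rho> * Y (clock \<sigma>) \<omega> = X \<sigma> \<omega>" using X_Y[OF t(1) elim(2)] tau by (simp add: \<rho>_def real_sqrt_divide)
    have k: "kern q (\<rho>\<^sup>2) (\<rho> * Y (clock \<sigma>) \<omega>) = kern q (\<sigma> / \<tau>) (X \<sigma> \<omega> / sqrt \<tau>)"
      using X_kern[OF t elim(2)] by (simp add: fun_eq_iff \<rho>_def)
    show ?case using elim(1) r(3) unfolding Let_def x a k incr_mom_def by blast
  qed
qed

lemma Y_pow4: "integrable M (\<lambda>\<omega>. (Y t \<omega>) ^ 4)"
proof (cases "q = 1")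
  case True
  have "integrable lborel (\<lambda>x. normal_density 0 1 x * (x - 0) ^ 4)" by (rule integrable_normal_moment) simp
  then have "integrable lborel (\<lambda>x. f_N q x * x ^ 4)" using True by (simp add: f_N_def)
  then show ?thesis using Y_integral(2)[of "\<lambda>x. x ^ 4" t] by simp
next
  case False
  interpret l: ou_lt_1 M \<alpha> q Y by unfold_locales (use False q in auto)
  have "\<bar>(Y t \<omega>) ^ 4\<bar> \<le> l.rad ^ 4" if "\<omega> \<in> space M" for \<omega>
    unfolding power_abs by (rule power_mono[OF l.Y_rad[OF that]]) simp
  then show ?thesis by (intro integrable_const_bound[of _ "l.rad ^ 4"]) auto
qed

lemma X_pow4: "0 \<le> \<tau> \<Longrightarrow> integrable M (\<lambda>\<omega>. (X \<tau> \<omega>) ^ 4)"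
proof -
  assume t: "0 \<le> \<tau>"
  have "integrable M (\<lambda>\<omega>. sqrt \<tau> ^ 4 * (Y (clock \<tau>) \<omega>) ^ 4)" using Y_pow4 by simp
  moreover have "(X \<tau> \<omega>) ^ 4 = sqrt \<tau> ^ 4 * (Y (clock \<tau>) \<omega>) ^ 4" if "\<omega> \<in> space M" for \<omega>
    unfolding X_Y[OF t that] by (rule power_mult_distrib)
  ultimately show ?thesis by (simp cong: Bochner_Integration.integrable_cong)
qed

lemma pow_le_pow4: "\<bar>z ^ k\<bar> \<le> 1 + z ^ 4" if "k \<le> 4" for z :: real
proof (cases "\<bar>z\<bar> \<le> 1")
  case True
  then have "\<bar>z ^ k\<bar> \<le> 1" by (simp add: power_abs power_le_one)
  then show ?thesis by (smt (verit) zero_le_even_power even_numeral)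
next
  case False
  then have "\<bar>z\<bar> ^ k \<le> \<bar>z\<bar> ^ 4" using that by (intro power_increasing) auto
  then show ?thesis by (simp add: power_abs power_even_abs)
qed

text \<open>Equality holds at \<open>y = - x\<close>, which explains the factor
  \<open>(x + y)\<^sup>2\<close> of the difference; the other factor is a sum of squares.\<close>

lemma diff_pow4: "(x - y) ^ 4 \<le> 8 * (x ^ 4 + y ^ 4)" for x y :: real
proof -
  have "8 * (x ^ 4 + y ^ 4) - (x - y) ^ 4 = (x + y)\<^sup>2 * (7 * x\<^sup>2 - 10 * x * y + 7 * y\<^sup>2)" by algebra
  moreover have "7 * x\<^sup>2 - 10 * x * y + 7 * y\<^sup>2 = 5 * (x - y)\<^sup>2 + 2 * x\<^sup>2 + 2 * y\<^sup>2" by algebra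
  ultimately have "8 * (x ^ 4 + y ^ 4) - (x - y) ^ 4 = (x + y)\<^sup>2 * (5 * (x - y)\<^sup>2 + 2 * x\<^sup>2 + 2 * y\<^sup>2)" by simp
  moreover have "0 \<le> (x + y)\<^sup>2 * (5 * (x - y)\<^sup>2 + 2 * x\<^sup>2 + 2 * y\<^sup>2)" by simp
  ultimately show ?thesis by linarith
qed

lemma incr_integrable:
  assumes t: "0 \<le> \<sigma>" "0 \<le> \<tau>" "k \<le> 4"
  shows "integrable M (\<lambda>\<omega>. (X \<tau> \<omega> - X \<sigma> \<omega>) ^ k)"
proof (rule Bochner_Integration.integrable_bound)
  show "integrable M (\<lambda>\<omega>. 1 + 8 * ((X \<tau> \<omega>) ^ 4 + (X \<sigma> \<omega>) ^ 4))" using X_pow4 t by simp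
  show "(\<lambda>\<omega>. (X \<tau> \<omega> - X \<sigma> \<omega>) ^ k) \<in> borel_measurable M" using X_meas[OF t(1)] X_meas[OF t(2)] by simp
  show "AE \<omega> in M. norm ((X \<tau> \<omega> - X \<sigma> \<omega>) ^ k) \<le> norm (1 + 8 * ((X \<tau> \<omega>) ^ 4 + (X \<sigma> \<omega>) ^ 4))"
  proof (rule AE_I2)
    fix \<omega>
    have "\<bar>(X \<tau> \<omega> - X \<sigma> \<omega>) ^ k\<bar> \<le> 1 + 8 * ((X \<tau> \<omega>) ^ 4 + (X \<sigma> \<omega>) ^ 4)"
      using pow_le_pow4[OF t(3), of "X \<tau> \<omega> - X \<sigma> \<omega>"] diff_pow4[of "X \<tau> \<omega>" "X \<sigma> \<omega>"] by linarith
    then show "norm ((X \<tau> \<omega> - X \<sigma> \<omega>) ^ k) \<le> norm (1 + 8 * ((X \<tau> \<omega>) ^ 4 + (X \<sigma> \<omega>) ^ 4))"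
      unfolding real_norm_def by linarith
  qed
qed

lemma X_pow_integrable: "0 \<le> \<tau> \<Longrightarrow> k \<le> 4 \<Longrightarrow> integrable M (\<lambda>\<omega>. (X \<tau> \<omega>) ^ k)"
  using incr_integrable[of 0 \<tau> k] X_0 by (simp cong: Bochner_Integration.integrable_cong)

lemma incr_cond:
  assumes t: "0 \<le> \<sigma>" "\<sigma> < \<tau>" "k \<le> 4"
  shows "AE \<omega> in M. real_cond_exp M (F \<sigma>) (\<lambda>\<omega>. (X \<tau> \<omega> - X \<sigma> \<omega>) ^ k) \<omega> = incr_mom k \<sigma> \<tau> \<omega>"
    "B \<in> sets (F \<sigma>) \<Longrightarrow> (\<integral>\<omega>. indicator B \<omega> * (X \<tau> \<omega> - X \<sigma> \<omega>) ^ k \<partial>M) = (\<integral>\<omega>. indicator B \<omega> * incr_mom k \<sigma> \<tau> \<omega> \<partial>M)"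
    "incr_mom k \<sigma> \<tau> \<in> borel_measurable M"
proof -
  have tau: "0 < \<tau>" using t by simp
  interpret cd: cond_density M "F \<sigma>" "\<lambda>\<omega>. X \<tau> \<omega> / sqrt \<tau>" "\<lambda>z. kern q (\<sigma> / \<tau>) (X \<sigma> (fst z) / sqrt \<tau>) (snd z)"
    by (rule X_cond_density[OF t(1,2)])
  have [measurable]: "X \<sigma> \<in> borel_measurable (F \<sigma>)" using X_F t by simp
  define f where "f = (\<lambda>z. (sqrt \<tau> * snd z - X \<sigma> (fst z)) ^ k)"
  have fm: "f \<in> borel_measurable (F \<sigma> \<Otimes>\<^sub>M borel)" unfolding f_def by measurable
  have fe: "f (\<omega>, X \<tau> \<omega> / sqrt \<tau>) = (X \<tau> \<omega> - X \<sigma> \<omega>) ^ k" for \<omega> using tau by (simp add: f_def)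
  have me: "(\<integral>x. f (\<omega>, x) * kern q (\<sigma> / \<tau>) (X \<sigma> (fst (\<omega>, x)) / sqrt \<tau>) (snd (\<omega>, x)) \<partial>lborel) = incr_mom k \<sigma> \<tau> \<omega>" for \<omega>
    by (simp add: f_def incr_mom_def)
  have i: "integrable M (\<lambda>\<omega>. f (\<omega>, X \<tau> \<omega> / sqrt \<tau>))" unfolding fe using incr_integrable t by simp
  show "AE \<omega> in M. real_cond_exp M (F \<sigma>) (\<lambda>\<omega>. (X \<tau> \<omega> - X \<sigma> \<omega>) ^ k) \<omega> = incr_mom k \<sigma> \<tau> \<omega>"
    using cd.cond_exp_density(2)[OF fm i] unfolding fe me .
  show "B \<in> sets (F \<sigma>) \<Longrightarrow> (\<integral>\<omega>. indicator B \<omega> * (X \<tau> \<omega> - X \<sigma> \<omega>) ^ k \<partial>M) = (\<integral>\<omega>. indicator B \<omega> * incr_mom k \<sigma> \<tau> \<omega> \<partial>M)"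
    using cd.cond_exp_density(3)[OF fm i] unfolding fe me .
  show "incr_mom k \<sigma> \<tau> \<in> borel_measurable M"
    using borel_measurable_integrable[OF cd.cond_exp_density(1)[OF fm i]] unfolding me .
qed

lemma X_mart:
  assumes t: "0 \<le> \<sigma>" "\<sigma> < \<tau>" and B: "B \<in> sets (F \<sigma>)"
  shows "(\<integral>\<omega>. indicator B \<omega> * X \<tau> \<omega> \<partial>M) = (\<integral>\<omega>. indicator B \<omega> * X \<sigma> \<omega> \<partial>M)"
proof -
  have BM: "B \<in> sets M" using B F_subalgebra by (auto simp: subalgebra_def)
  have i: "integrable M (\<lambda>\<omega>. indicator B \<omega> * X u \<omega>)" if "0 \<le> u" for u
    using integrable_real_mult_indicator[OF BM X_pow_integrable[OF that, of 1]] by (simp add: mult.commute)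
  have "(\<integral>\<omega>. indicator B \<omega> * X \<tau> \<omega> \<partial>M) - (\<integral>\<omega>. indicator B \<omega> * X \<sigma> \<omega> \<partial>M)
    = (\<integral>\<omega>. indicator B \<omega> * (X \<tau> \<omega> - X \<sigma> \<omega>) ^ 1 \<partial>M)"
    using i t by (subst Bochner_Integration.integral_diff[symmetric]) (auto simp: right_diff_distrib)
  also have "\<dots> = (\<integral>\<omega>. indicator B \<omega> * incr_mom 1 \<sigma> \<tau> \<omega> \<partial>M)" by (rule incr_cond(2)[OF t _ B]) simp
  also have "\<dots> = (\<integral>\<omega>. 0 \<partial>M)"
    using incr_mom[OF t] incr_cond(3)[OF t, of 1] BM by (intro integral_cong_AE) auto
  finally show ?thesis by simp
qed

lemma X_L2: "0 \<le> \<sigma> \<Longrightarrow> \<sigma> < \<tau> \<Longrightarrow> (\<integral>\<omega>. (X \<tau> \<omega> - X \<sigma> \<omega>)\<^sup>2 \<partial>M) = \<tau> - \<sigma>"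
proof -
  assume t: "0 \<le> \<sigma>" "\<sigma> < \<tau>"
  have S: "space M \<in> sets (F \<sigma>)" using sets.top[of "F \<sigma>"] by (simp add: space_gen_sigma)
  have "(\<integral>\<omega>. (X \<tau> \<omega> - X \<sigma> \<omega>)\<^sup>2 \<partial>M) = (\<integral>\<omega>. indicator (space M) \<omega> * (X \<tau> \<omega> - X \<sigma> \<omega>)\<^sup>2 \<partial>M)"
    by (intro Bochner_Integration.integral_cong refl) simp
  also have "\<dots> = (\<integral>\<omega>. indicator (space M) \<omega> * incr_mom 2 \<sigma> \<tau> \<omega> \<partial>M)" by (rule incr_cond(2)[OF t _ S]) simp
  also have "\<dots> = (\<integral>\<omega>. \<tau> - \<sigma> \<partial>M)"
    using incr_mom[OF t] incr_cond(3)[OF t, of 2] AE_space by (intro integral_cong_AE) auto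
  finally show ?thesis by (simp add: prob_space)
qed

lemma X_null_start_martingale: "null_start_martingale M F X"
proof (intro null_start_martingale.intro null_start_martingale_axioms.intro prob_space_axioms)
  show "subalgebra M (F t)" for t by (rule F_subalgebra)
  show "sets (F s) \<subseteq> sets (F t)" if "0 \<le> s" "s \<le> t" for s t using that by (intro gen_sigma_mono) auto
  show "X t \<in> borel_measurable (F t)" if "0 \<le> t" for t using X_F that by simp
  show "integrable M (X t)" if "0 \<le> t" for t using X_pow_integrable[OF that, of 1] by simp
qed (auto intro: X_mart X_0)

lemma X_cadlag_modification: "\<exists>Z. modification M X Z \<and> (\<forall>\<omega>\<in>space M. cadlag (\<lambda>\<tau>. Z \<tau> \<omega>))"
  by (rule null_start_martingale.cadlag_modification[OF X_null_start_martingale])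
     (use incr_integrable X_L2 in auto)

lemma X_increment_moments:
  assumes t: "0 < \<sigma>" "\<sigma> < \<tau>"
  shows "has_cond_exp M (F \<sigma>) (\<lambda>\<omega>. (X \<tau> \<omega> - X \<sigma> \<omega>) ^ 2) (\<lambda>\<omega>. \<tau> - \<sigma>)"
    "has_cond_exp M (F \<sigma>) (\<lambda>\<omega>. (X \<tau> \<omega> - X \<sigma> \<omega>) ^ 3) (\<lambda>\<omega>. - (1 - q) * (\<tau> - \<sigma>) * X \<sigma> \<omega>)"
    "has_cond_exp M (F \<sigma>) (\<lambda>\<omega>. (X \<tau> \<omega> - X \<sigma> \<omega>) ^ 4)
      (\<lambda>\<omega>. (\<tau> - \<sigma>) * ((X \<sigma> \<omega>)\<^sup>2 * (1 - q)\<^sup>2 + (2 + q) * (\<tau> - \<sigma>) + \<sigma> * (1 - q\<^sup>2)))"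
proof -
  have t0: "0 \<le> \<sigma>" "0 \<le> \<tau>" using t by auto
  have main: "has_cond_exp M (F \<sigma>) (\<lambda>\<omega>. (X \<tau> \<omega> - X \<sigma> \<omega>) ^ k) W"
    if "k \<le> 4" "AE \<omega> in M. incr_mom k \<sigma> \<tau> \<omega> = W \<omega>" for k W
    unfolding has_cond_exp_def
    using incr_integrable[OF t0 that(1)] incr_cond(1)[OF t0(1) t(2) that(1)] that(2) by auto
  note i = incr_mom[OF t0(1) t(2)]
  show "has_cond_exp M (F \<sigma>) (\<lambda>\<omega>. (X \<tau> \<omega> - X \<sigma> \<omega>) ^ 2) (\<lambda>\<omega>. \<tau> - \<sigma>)"
    by (rule main, simp, rule eventually_mono[OF i], use t in blast)
  show "has_cond_exp M (F \<sigma>) (\<lambda>\<omega>. (X \<tau> \<omega> - X \<sigma> \<omega>) ^ 3) (\<lambda>\<omega>. - (1 - q) * (\<tau> - \<sigma>) * X \<sigma> \<omega>)"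
    by (rule main, simp, rule eventually_mono[OF i], use t in blast)
  show "has_cond_exp M (F \<sigma>) (\<lambda>\<omega>. (X \<tau> \<omega> - X \<sigma> \<omega>) ^ 4)
      (\<lambda>\<omega>. (\<tau> - \<sigma>) * ((X \<sigma> \<omega>)\<^sup>2 * (1 - q)\<^sup>2 + (2 + q) * (\<tau> - \<sigma>) + \<sigma> * (1 - q\<^sup>2)))"
    by (rule main, simp, rule eventually_mono[OF i], use t in blast)
qed

lemma X_square_martingale: "is_martingale M F (\<lambda>\<tau> \<omega>. (X \<tau> \<omega>)\<^sup>2 - \<tau>)"
  unfolding is_martingale_def
proof (intro conjI allI impI)
  fix t :: real assume t: "0 \<le> t"
  show "integrable M (\<lambda>\<omega>. (X t \<omega>)\<^sup>2 - t)" using X_pow_integrable[OF t, of 2] by simp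
  show "(\<lambda>\<omega>. (X t \<omega>)\<^sup>2 - t) \<in> borel_measurable (F t)" using X_F[OF t order_refl] by simp
next
  fix s t :: real assume "0 \<le> s \<and> s < t"
  then have t: "0 \<le> s" "s < t" "0 \<le> t" by auto
  interpret sf: sigma_finite_subalgebra M "F s" by (rule sigma_finite_subalgebraI[OF F_subalgebra])
  have Xs: "X s \<in> borel_measurable (F s)" using X_F t by simp
  have i1: "integrable M (\<lambda>\<omega>. (X t \<omega> - X s \<omega>) ^ 2)" using incr_integrable t by simp
  have ist: "integrable M (\<lambda>\<omega>. X s \<omega> * (X t \<omega> - X s \<omega>) ^ 1)"
  proof -
    have e1: "X s \<omega> * (X t \<omega> - X s \<omega>) ^ 1 = ((X t \<omega>)\<^sup>2 - (X s \<omega>)\<^sup>2 - (X t \<omega> - X s \<omega>)\<^sup>2) / 2" for \<omega>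
      by (simp add: power2_eq_square algebra_simps)
    show ?thesis
      unfolding e1 using i1 X_pow_integrable[OF t(1), of 2] X_pow_integrable[OF t(3), of 2] by simp
  qed
  have i3: "integrable M (\<lambda>\<omega>. (X s \<omega>)\<^sup>2 - t)" using X_pow_integrable[OF t(1), of 2] by simp
  have m1: "(\<lambda>\<omega>. (X t \<omega> - X s \<omega>) ^ 1) \<in> borel_measurable M" using X_meas[OF t(1)] X_meas[OF t(3)] by simp
  \<comment> \<open>The conditional expectations of the three summands are \<open>t - s\<close>, 0
    and the last summand itself.\<close>
  have e: "(X t \<omega>)\<^sup>2 - t = ((X t \<omega> - X s \<omega>) ^ 2 + 2 * (X s \<omega> * (X t \<omega> - X s \<omega>) ^ 1)) + ((X s \<omega>)\<^sup>2 - t)" for \<omega>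
    by (simp add: power2_eq_square algebra_simps)
  have c1: "AE \<omega> in M. real_cond_exp M (F s) (\<lambda>\<omega>. (X t \<omega> - X s \<omega>) ^ 2) \<omega> = t - s"
    using incr_cond(1)[OF t(1,2), of 2] incr_mom[OF t(1,2)] by auto
  have c2: "AE \<omega> in M. real_cond_exp M (F s) (\<lambda>\<omega>. X s \<omega> * (X t \<omega> - X s \<omega>) ^ 1) \<omega> = 0"
    using sf.real_cond_exp_mult[OF Xs m1 ist] incr_cond(1)[OF t(1,2), of 1] incr_mom[OF t(1,2)] by auto
  have c3: "AE \<omega> in M. real_cond_exp M (F s) (\<lambda>\<omega>. (X s \<omega>)\<^sup>2 - t) \<omega> = (X s \<omega>)\<^sup>2 - t"
    using Xs by (intro sf.real_cond_exp_F_meas i3) simp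
  have i2: "integrable M (\<lambda>\<omega>. 2 * (X s \<omega> * (X t \<omega> - X s \<omega>) ^ 1))" using ist by (rule integrable_mult_right)
  have "AE \<omega> in M. real_cond_exp M (F s) (\<lambda>\<omega>. (X t \<omega>)\<^sup>2 - t) \<omega> = (X s \<omega>)\<^sup>2 - s"
    unfolding e
    using sf.real_cond_exp_add[OF Bochner_Integration.integrable_add[OF i1 i2] i3] sf.real_cond_exp_add[OF i1 i2]
      sf.real_cond_exp_cmult[OF ist, of 2] c1 c2 c3
    by eventually_elim linarith
  then show "has_cond_exp M (F s) (\<lambda>\<omega>. (X t \<omega>)\<^sup>2 - t) (\<lambda>\<omega>. (X s \<omega>)\<^sup>2 - s)"
    unfolding has_cond_exp_def using X_pow_integrable[OF t(3), of 2] by simp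
qed

lemma X_not_independent:
  assumes q1: "\<bar>q\<bar> < 1"
  shows "\<not> independent_increments M X"
proof
  assume "independent_increments M X"
  moreover have "strict_mono_on {..2::nat} real" by (auto simp: strict_mono_on_def)
  ultimately have ind: "indep_vars (\<lambda>_. borel) (\<lambda>i \<omega>. X (real (Suc i)) \<omega> - X (real i) \<omega>) {..<2::nat}"
    unfolding independent_increments_def by (auto elim!: allE[of _ 2] allE[of _ real])
  \<comment> \<open>The increments over [0, 1] and [1, 2], the second one cubed: its conditional
    third moment is a multiple of the first increment.\<close>
  define Z where "Z i \<omega> = (if i = (0::nat) then (X (real (Suc i)) \<omega> - X (real i) \<omega>) ^ 1 else (X (real (Suc i)) \<omega> - X (real i) \<omega>) ^ 3)" for i \<omega>
  have Zi: "integrable M (Z i)" for i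
  proof -
    have "Z i = (\<lambda>\<omega>. (X (real (Suc i)) \<omega> - X (real i) \<omega>) ^ (if i = 0 then 1 else 3))" by (auto simp: Z_def)
    then show ?thesis by (simp only:) (rule incr_integrable, auto)
  qed
  have "indep_vars (\<lambda>_. borel) (\<lambda>i \<omega>. (if i = (0::nat) then (\<lambda>x::real. x ^ 1) else (\<lambda>x. x ^ 3)) (X (real (Suc i)) \<omega> - X (real i) \<omega>)) {..<2::nat}"
    by (rule indep_vars_compose2[OF ind]) auto
  moreover have "(\<lambda>i \<omega>. (if i = (0::nat) then (\<lambda>x::real. x ^ 1) else (\<lambda>x. x ^ 3)) (X (real (Suc i)) \<omega> - X (real i) \<omega>)) = Z"
    by (auto simp: Z_def fun_eq_iff)
  ultimately have indZ: "indep_vars (\<lambda>_. borel) Z {..<2}" by (simp only:)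
  have "(\<integral>\<omega>. (\<Prod>i\<in>{..<2}. Z i \<omega>) \<partial>M) = (\<Prod>i\<in>{..<2}. \<integral>\<omega>. Z i \<omega> \<partial>M)"
    by (rule indep_vars_lebesgue_integral[OF _ indZ Zi]) simp
  then have prod: "(\<integral>\<omega>. Z 0 \<omega> * Z 1 \<omega> \<partial>M) = (\<integral>\<omega>. Z 0 \<omega> \<partial>M) * (\<integral>\<omega>. Z 1 \<omega> \<partial>M)"
    by (simp add: numeral_2_eq_2)
  have Z0: "Z 0 \<omega> = X 1 \<omega>" if "\<omega> \<in> space M" for \<omega> using X_0[OF that] by (simp add: Z_def)
  have Z1: "Z 1 \<omega> = (X 2 \<omega> - X 1 \<omega>) ^ 3" for \<omega> by (simp add: Z_def)
  have S: "space M \<in> sets (F 0)" using sets.top[of "F 0"] by (simp add: space_gen_sigma)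
  have "(\<integral>\<omega>. Z 0 \<omega> \<partial>M) = (\<integral>\<omega>. indicator (space M) \<omega> * X 1 \<omega> \<partial>M)"
    by (intro Bochner_Integration.integral_cong refl) (simp add: Z0)
  also have "\<dots> = (\<integral>\<omega>. indicator (space M) \<omega> * X 0 \<omega> \<partial>M)" by (rule X_mart[OF _ _ S]) auto
  also have "\<dots> = (\<integral>\<omega>. 0 \<partial>M)" by (intro Bochner_Integration.integral_cong refl) (simp add: X_0)
  finally have "(\<integral>\<omega>. Z 0 \<omega> \<partial>M) = 0" by simp
  then have 0: "(\<integral>\<omega>. Z 0 \<omega> * Z 1 \<omega> \<partial>M) = 0" using prod by simp
  interpret l: ou_lt_1 M \<alpha> q Y by unfold_locales (rule q1)
  interpret sf: sigma_finite_subalgebra M "F 1" by (rule sigma_finite_subalgebraI[OF F_subalgebra])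
  have Xm: "X 1 \<in> borel_measurable (F 1)" "X 1 \<in> borel_measurable M" "X 2 \<in> borel_measurable M" using X_F X_meas by auto
  have X2: "(\<integral>\<omega>. (X 1 \<omega>)\<^sup>2 \<partial>M) = 1"
  proof -
    have "(\<integral>\<omega>. (X 1 \<omega>)\<^sup>2 \<partial>M) = (\<integral>\<omega>. (X 1 \<omega> - X 0 \<omega>)\<^sup>2 \<partial>M)"
      by (intro Bochner_Integration.integral_cong refl) (simp add: X_0)
    then show ?thesis using X_L2[of 0 1] by simp
  qed
  have X1b: "\<bar>X 1 \<omega>\<bar> \<le> l.rad" if "\<omega> \<in> space M" for \<omega>
    using l.Y_rad[OF that, of "clock 1"] X_Y[OF _ that, of 1] by simp
  have ip: "integrable M (\<lambda>\<omega>. X 1 \<omega> * (X 2 \<omega> - X 1 \<omega>) ^ 3)"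
  proof (rule Bochner_Integration.integrable_bound)
    show "integrable M (\<lambda>\<omega>. l.rad * \<bar>(X 2 \<omega> - X 1 \<omega>) ^ 3\<bar>)" using incr_integrable[of 1 2 3] by simp
    show "AE \<omega> in M. norm (X 1 \<omega> * (X 2 \<omega> - X 1 \<omega>) ^ 3) \<le> norm (l.rad * \<bar>(X 2 \<omega> - X 1 \<omega>) ^ 3\<bar>)"
      using l.rad_pos by (intro AE_I2) (simp add: abs_mult mult_right_mono X1b)
  qed (use Xm in simp)
  have "(\<integral>\<omega>. Z 0 \<omega> * Z 1 \<omega> \<partial>M) = (\<integral>\<omega>. X 1 \<omega> * (X 2 \<omega> - X 1 \<omega>) ^ 3 \<partial>M)"
    unfolding Z1 by (intro Bochner_Integration.integral_cong refl) (simp add: Z0)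
  also have "\<dots> = (\<integral>\<omega>. X 1 \<omega> * real_cond_exp M (F 1) (\<lambda>\<omega>. (X 2 \<omega> - X 1 \<omega>) ^ 3) \<omega> \<partial>M)"
    by (rule sf.real_cond_exp_intg(2)[OF ip Xm(1), symmetric]) (use Xm in simp)
  also have "\<dots> = (\<integral>\<omega>. - (1 - q) * (X 1 \<omega>)\<^sup>2 \<partial>M)"
  proof (rule integral_cong_AE)
    show "AE \<omega> in M. X 1 \<omega> * real_cond_exp M (F 1) (\<lambda>\<omega>. (X 2 \<omega> - X 1 \<omega>) ^ 3) \<omega> = - (1 - q) * (X 1 \<omega>)\<^sup>2"
      using X_increment_moments(2)[of 1 2] unfolding has_cond_exp_def by (auto simp: power2_eq_square)
  qed (use Xm in auto)
  also have "\<dots> = - (1 - q)" using X2 by simp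
  finally show False using 0 q1 by simp
qed

end

section \<open>The strong Markov property\<close>

text \<open>The natural filtrations of \<open>X\<close> and of a modification differ, since null
  sets are not added. Up to a null set, however, each event of one is an event of the other, because
  such events are closed under complements and countable unions.\<close>

lemma gen_sigma_modification:
  assumes ae: "\<And>i. i \<in> I \<Longrightarrow> AE \<omega> in M. Z i \<omega> = X i \<omega>"
    and B: "B \<in> sets (gen_sigma M Z I)"
  shows "\<exists>B'\<in>sets (gen_sigma M X I). AE \<omega> in M. \<omega> \<in> B \<longleftrightarrow> \<omega> \<in> B'"
  using B unfolding sets_gen_sigma[of M Z]
proof (induction rule: sigma_sets.induct)
  case (Basic a)
  then obtain i A where i: "i \<in> I" "A \<in> sets borel" "a = Z i -` A \<inter> space M" by blast
  have "X i -` A \<inter> space M \<in> sets (gen_sigma M X I)"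
    using measurable_sets[OF gen_sigma_measurable[OF i(1)] i(2)] by (simp add: space_gen_sigma)
  moreover have "AE \<omega> in M. \<omega> \<in> a \<longleftrightarrow> \<omega> \<in> X i -` A \<inter> space M"
    using ae[OF i(1)] by eventually_elim (simp add: i(3))
  ultimately show ?case by blast
next
  case Empty
  then show ?case by (intro bexI[of _ "{}"]) auto
next
  case (Compl a)
  then obtain B' where B': "B' \<in> sets (gen_sigma M X I)" "AE \<omega> in M. \<omega> \<in> a \<longleftrightarrow> \<omega> \<in> B'" by blast
  have "space M - B' \<in> sets (gen_sigma M X I)" using sets.compl_sets[OF B'(1)] by (simp add: space_gen_sigma)
  moreover have "AE \<omega> in M. \<omega> \<in> space M - a \<longleftrightarrow> \<omega> \<in> space M - B'" using B'(2) by eventually_elim simp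
  ultimately show ?case by blast
next
  case (Union a)
  then obtain B' where B': "\<And>i. B' i \<in> sets (gen_sigma M X I)" "\<And>i. AE \<omega> in M. \<omega> \<in> a i \<longleftrightarrow> \<omega> \<in> B' i" by metis
  have "AE \<omega> in M. \<forall>i. \<omega> \<in> a i \<longleftrightarrow> \<omega> \<in> B' i" unfolding AE_all_countable using B'(2) by blast
  then have "AE \<omega> in M. \<omega> \<in> \<Union>(range a) \<longleftrightarrow> \<omega> \<in> \<Union>(range B')" by eventually_elim auto
  moreover have "\<Union>(range B') \<in> sets (gen_sigma M X I)" using B'(1) by blast
  ultimately show ?case by blast
qed

text \<open>In this form membership is a closed condition on the pair of \<open>t\<close> and
  \<open>y\<close>, so it survives limits in which the time moves as well.\<close>

lemma state_space_iff:
  assumes q: "\<bar>q\<bar> < 1" and t: "0 \<le> t"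
  shows "y \<in> state_space q t \<longleftrightarrow> (1 - q) * y\<^sup>2 \<le> 4 * t"
proof (cases "t = 0")
  case True
  have "0 \<in> S_q q" using q by (simp add: S_q_iff)
  moreover have "0 < 1 - q" using q by simp
  then have "(1 - q) * y\<^sup>2 \<le> 0 \<longleftrightarrow> y = 0" by (auto simp: mult_le_0_iff)
  ultimately show ?thesis using True by (auto simp: state_space_def)
next
  case False
  then have tp: "0 < t" using t by simp
  have "y \<in> state_space q t \<longleftrightarrow> y / sqrt t \<in> S_q q"
    using tp unfolding state_space_def by (auto intro!: image_eqI[of _ _ "y / sqrt t"])
  also have "\<dots> \<longleftrightarrow> (1 - q) * (y / sqrt t)\<^sup>2 \<le> 4" using q by (intro S_q_iff) auto
  also have "\<dots> \<longleftrightarrow> (1 - q) * y\<^sup>2 \<le> 4 * t" using tp by (simp add: power_divide pos_divide_le_eq)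
  finally show ?thesis .
qed

lemma state_space_one: "0 < t \<Longrightarrow> y \<in> state_space 1 t"
  unfolding state_space_def S_q_def by (auto intro!: image_eqI[of _ _ "y / sqrt t"])

text \<open>Reduces an identity at a countably valued random index to identities at fixed indices,
  one on each piece of the partition.\<close>

lemma (in prob_space) integral_partition_sums:
  fixes f :: "nat \<Rightarrow> 'a \<Rightarrow> real"
  assumes f[measurable]: "\<And>k. f k \<in> borel_measurable M" and bd: "AE \<omega> in M. \<forall>k. \<bar>f k \<omega>\<bar> \<le> 1"
    and K[measurable]: "K \<in> M \<rightarrow>\<^sub>M count_space UNIV" and A[measurable]: "A \<in> sets M"
  shows "(\<lambda>k. \<integral>\<omega>. indicator (A \<inter> {\<omega>\<in>space M. K \<omega> = k}) \<omega> * f k \<omega> \<partial>M) sums (\<integral>\<omega>. indicator A \<omega> * f (K \<omega>) \<omega> \<partial>M)"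
proof -
  have m[measurable]: "{\<omega>\<in>space M. K \<omega> = k} \<in> sets M" for k by measurable
  have fK[measurable]: "(\<lambda>\<omega>. f (K \<omega>) \<omega>) \<in> borel_measurable M"
    by (rule measurable_compose_countable[OF f K])
  have i: "integrable M (\<lambda>\<omega>. indicator (A \<inter> {\<omega>\<in>space M. K \<omega> = k}) \<omega> * f k \<omega>)" for k
  proof (rule integrable_const_bound[of _ 1])
    show "AE \<omega> in M. norm (indicator (A \<inter> {\<omega>\<in>space M. K \<omega> = k}) \<omega> * f k \<omega>) \<le> 1"
      using bd by eventually_elim (simp add: indicator_def)
  qed measurable
  have part: "(\<Sum>k<n. indicator (A \<inter> {\<omega>\<in>space M. K \<omega> = k}) \<omega> * f k \<omega>)
      = (if K \<omega> < n then indicator A \<omega> * f (K \<omega>) \<omega> else 0)" if "\<omega> \<in> space M" for n \<omega>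
  proof -
    have "(\<Sum>k<n. indicator (A \<inter> {\<omega>\<in>space M. K \<omega> = k}) \<omega> * f k \<omega>)
      = (\<Sum>k<n. if k = K \<omega> then indicator A \<omega> * f (K \<omega>) \<omega> else 0)"
      using that by (intro sum.cong refl) (auto simp: indicator_def)
    then show ?thesis by (simp add: sum.delta)
  qed
  have "(\<lambda>n. \<integral>\<omega>. (\<Sum>k<n. indicator (A \<inter> {\<omega>\<in>space M. K \<omega> = k}) \<omega> * f k \<omega>) \<partial>M)
      \<longlonglongrightarrow> (\<integral>\<omega>. indicator A \<omega> * f (K \<omega>) \<omega> \<partial>M)"
  proof (rule integral_dominated_convergence[where w="\<lambda>_. 1"])
    show "AE \<omega> in M. (\<lambda>n. \<Sum>k<n. indicator (A \<inter> {\<omega>\<in>space M. K \<omega> = k}) \<omega> * f k \<omega>) \<longlonglongrightarrow> indicator A \<omega> * f (K \<omega>) \<omega>"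
    proof (rule AE_I2)
      fix \<omega> assume w: "\<omega> \<in> space M"
      have "\<forall>\<^sub>F n in sequentially. (\<Sum>k<n. indicator (A \<inter> {\<omega>\<in>space M. K \<omega> = k}) \<omega> * f k \<omega>) = indicator A \<omega> * f (K \<omega>) \<omega>"
        using eventually_gt_at_top[of "K \<omega>"] by eventually_elim (simp only: part[OF w] if_True)
      then show "(\<lambda>n. \<Sum>k<n. indicator (A \<inter> {\<omega>\<in>space M. K \<omega> = k}) \<omega> * f k \<omega>) \<longlonglongrightarrow> indicator A \<omega> * f (K \<omega>) \<omega>"
        by (rule tendsto_eventually)
    qed
    show "AE \<omega> in M. norm (\<Sum>k<n. indicator (A \<inter> {\<omega>\<in>space M. K \<omega> = k}) \<omega> * f k \<omega>) \<le> 1" for n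
      using bd AE_space by eventually_elim (simp only: part, simp add: indicator_def)
  qed measurable
  moreover have "(\<integral>\<omega>. (\<Sum>k<n. indicator (A \<inter> {\<omega>\<in>space M. K \<omega> = k}) \<omega> * f k \<omega>) \<partial>M)
     = (\<Sum>k<n. \<integral>\<omega>. indicator (A \<inter> {\<omega>\<in>space M. K \<omega> = k}) \<omega> * f k \<omega> \<partial>M)" for n
    by (rule Bochner_Integration.integral_sum) (rule i)
  ultimately show ?thesis unfolding sums_def by simp
qed

section \<open>Cadlag modifications: state space, Markov property at fixed times, evaluation at
  random times\<close>

locale qw_cadlag = qw +
  fixes Z :: "real \<Rightarrow> 'a \<Rightarrow> real"
  assumes mod: "modification M X Z" and cad: "\<And>\<omega>. \<omega> \<in> space M \<Longrightarrow> cadlag (\<lambda>t. Z t \<omega>)"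
begin

abbreviation "N \<equiv> nat_filtration M Z"

lemma Z_meas: "0 \<le> t \<Longrightarrow> Z t \<in> borel_measurable M" and Z_X: "0 \<le> t \<Longrightarrow> AE \<omega> in M. Z t \<omega> = X t \<omega>"
  using mod by (auto simp: modification_def)

lemma Z_right: "\<omega> \<in> space M \<Longrightarrow> 0 \<le> t \<Longrightarrow> ((\<lambda>s. Z s \<omega>) \<longlongrightarrow> Z t \<omega>) (at_right t)"
  using cad by (simp add: cadlag_def)

lemma N_real: "0 \<le> c \<Longrightarrow> N (ennreal c) = gen_sigma M Z {0..c}"
  unfolding nat_filtration_def by (rule arg_cong[where f="gen_sigma M Z"]) auto

lemma N_subalgebra: "subalgebra M (N t)"
  unfolding nat_filtration_def by (rule gen_sigma_subalgebra) (auto intro: Z_meas)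

lemma Z_N: "0 \<le> u \<Longrightarrow> ennreal u \<le> t \<Longrightarrow> Z u \<in> borel_measurable (N t)"
  unfolding nat_filtration_def by (rule gen_sigma_measurable) simp

lemma space_N: "space (N t) = space M"
  unfolding nat_filtration_def by (rule space_gen_sigma)

sublocale N: filtration "space M" N by (rule filtration_nat_filtration)

lemma kern_section_integrable:
  assumes "0 \<le> p" "p < 1" shows "integrable lborel (kern q p s)"
proof (cases "mehler_dom q p s")
  case False
  then have "q \<noteq> 1" using assms by (auto simp: mehler_dom_def)
  then have "kern q p s = (\<lambda>_. 0)" using False by (auto simp: kern_def)
  then show ?thesis by simp
qed (rule kern_dom_integrable)

lemma Z_dyadic_lim:
  assumes w: "\<omega> \<in> space M" and t: "0 \<le> t" and u: "0 \<le> u"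
  shows "(\<lambda>n. Z (dyadic_above n t + u) \<omega>) \<longlonglongrightarrow> Z (t + u) \<omega>"
proof -
  have "filterlim (\<lambda>n. dyadic_above n t + u) (at_right (t + u)) sequentially"
    unfolding filterlim_at using dyadic_above_lim[OF t] dyadic_above(1)[OF t]
    by (auto simp: order_less_imp_not_eq2 intro!: tendsto_add tendsto_const)
  from filterlim_compose[OF Z_right[OF w] this] show ?thesis using t u by simp
qed

text \<open>\<open>X\<close> lies in the state space at dyadic times, and right-continuity extends
  this to all times outside one null set. It is required simultaneously for all times, because the
  kernel is evaluated at a random time.\<close>

lemma AE_state: "AE \<omega> in M. \<forall>t\<ge>0. Z t \<omega> \<in> state_space q t"
proof -
  have "AE \<omega> in M. \<forall>d\<in>dyadics. Z d \<omega> = X d \<omega>"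
    using countable_dyadics Z_X dyadics_nonneg by (intro AE_ball_countable[THEN iffD2]) auto
  then show ?thesis using AE_space
  proof eventually_elim
    case (elim \<omega>)
    have d: "Z d \<omega> \<in> state_space q d" if "d \<in> dyadics" for d
      using elim that X_state[OF dyadics_nonneg[OF that] elim(2)] by simp
    show ?case
    proof (intro allI impI)
      fix t :: real assume t: "0 \<le> t"
      show "Z t \<omega> \<in> state_space q t"
      proof (cases "t = 0")
        case True then show ?thesis using d zero_dyadics by simp
      next
        case tn: False
        show ?thesis
        proof (cases "q = 1")
          case True then show ?thesis using state_space_one t tn by simp
        next
          case False
          then have q1: "\<bar>q\<bar> < 1" using q by auto
          let ?d = "\<lambda>n. dyadic_above n t"
          have nn: "0 \<le> ?d n" for n using dyadic_above(1)[OF t, of n] t by simp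
          have "(\<lambda>n. Z (?d n) \<omega>) \<longlonglongrightarrow> Z t \<omega>" using Z_dyadic_lim[OF elim(2) t, of 0] by simp
          then have l1: "(\<lambda>n. (1 - q) * (Z (?d n) \<omega>)\<^sup>2) \<longlonglongrightarrow> (1 - q) * (Z t \<omega>)\<^sup>2" by (intro tendsto_intros)
          have l2: "(\<lambda>n. 4 * ?d n) \<longlonglongrightarrow> 4 * t" by (intro tendsto_intros dyadic_above_lim t)
          have "(1 - q) * (Z (?d n) \<omega>)\<^sup>2 \<le> 4 * ?d n" for n
            using d[OF dyadic_above(3)[OF t]] state_space_iff[OF q1 nn] by blast
          then have "(1 - q) * (Z t \<omega>)\<^sup>2 \<le> 4 * t" by (intro LIMSEQ_le[OF l1 l2]) blast
          then show ?thesis using state_space_iff[OF q1 t] by blast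
        qed
      qed
    qed
  qed
qed

text \<open>The transition from \<open>c\<close> to \<open>c + u\<close> for the value at
  \<open>c + u\<close> divided by \<open>sqrt (c + u)\<close>. In contrast to \<open>q_trans\<close>
  there is no case distinction and no division by \<open>sqrt c\<close>, so it is jointly measurable
  in time and state.\<close>

definition "tr u \<phi> c y = (\<integral>x. \<phi> x * kern q (c / (c + u)) (y / sqrt (c + u)) x \<partial>lborel)"

lemma tr_measurable:
  assumes u: "0 < u" and [measurable]: "\<phi> \<in> borel_measurable borel" "S \<in> borel_measurable L" "V \<in> borel_measurable L"
  shows "(\<lambda>\<omega>. tr u \<phi> (S \<omega>) (V \<omega>)) \<in> borel_measurable L"
proof -
  have "(\<lambda>z. kern q (S (fst z) / (S (fst z) + u)) (V (fst z) / sqrt (S (fst z) + u)) (snd z)) \<in> borel_measurable (L \<Otimes>\<^sub>M lborel)"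
    by (rule kern_measurable[OF q]) measurable
  then have "(\<lambda>(\<omega>, x). \<phi> x * kern q (S \<omega> / (S \<omega> + u)) (V \<omega> / sqrt (S \<omega> + u)) x) \<in> borel_measurable (L \<Otimes>\<^sub>M lborel)"
    by (simp add: case_prod_beta')
  from lborel.borel_measurable_lebesgue_integral[OF this] show ?thesis unfolding tr_def .
qed

lemma Z_total:
  assumes u: "0 < u" and c: "0 \<le> c"
  shows "AE \<omega> in M. tr u (\<lambda>_. 1) c (Z c \<omega>) = 1"
  using incr_mom[of c "c + u"] Z_X[OF c] u c unfolding incr_mom_def tr_def by auto

text \<open>The upper bound is the total mass and not 1, since the mass is known to be 1 only almost
  surely while this bound is pointwise.\<close>

lemma tr_bounds:
  assumes \<phi>: "\<phi> \<in> borel_measurable borel" "\<And>x. 0 \<le> \<phi> x \<and> \<phi> x \<le> 1" and u: "0 < u" and c: "0 \<le> c"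
  shows "0 \<le> tr u \<phi> c y" "tr u \<phi> c y \<le> tr u (\<lambda>_. 1) c y"
proof -
  let ?k = "kern q (c / (c + u)) (y / sqrt (c + u))"
  have i: "integrable lborel ?k" using u c by (intro kern_section_integrable) auto
  show "0 \<le> tr u \<phi> c y" unfolding tr_def
    by (rule integral_nonneg_AE) (use \<phi>(2) kern_nonneg[OF q] in \<open>auto intro!: AE_I2 mult_nonneg_nonneg\<close>)
  have le: "\<phi> x * ?k x \<le> 1 * ?k x" for x by (rule mult_right_mono[OF _ kern_nonneg[OF q]]) (use \<phi>(2) in blast)
  show "tr u \<phi> c y \<le> tr u (\<lambda>_. 1) c y" unfolding tr_def
  proof (rule integral_mono[OF _ _ le])
    show "integrable lborel (\<lambda>x. 1 * ?k x)" using i by simp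
    show "integrable lborel (\<lambda>x. \<phi> x * ?k x)"
    proof (rule Bochner_Integration.integrable_bound[OF i])
      show "(\<lambda>x. \<phi> x * ?k x) \<in> borel_measurable lborel" using \<phi>(1) kern_section_measurable[OF q] by simp
      show "AE x in lborel. norm (\<phi> x * ?k x) \<le> norm (?k x)"
        using \<phi>(2) by (intro AE_I2) (simp add: abs_mult mult_left_le_one_le)
    qed
  qed
qed

text \<open>The event is replaced by an event of \<open>X\<close> with the same indicator almost
  surely; there the conditional density of \<open>X\<close> applies.\<close>

lemma Z_markov_fixed:
  assumes u: "0 < u" and c: "0 \<le> c" and \<phi>[measurable]: "\<phi> \<in> borel_measurable borel" and \<phi>1: "\<And>x. 0 \<le> \<phi> x \<and> \<phi> x \<le> 1"
    and B: "B \<in> sets (N (ennreal c))"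
  shows "(\<integral>\<omega>. indicator B \<omega> * \<phi> (Z (c + u) \<omega> / sqrt (c + u)) \<partial>M) = (\<integral>\<omega>. indicator B \<omega> * tr u \<phi> c (Z c \<omega>) \<partial>M)"
proof -
  have BM[measurable]: "B \<in> sets M" using B N_subalgebra by (auto simp: subalgebra_def)
  have cu: "c < c + u" "0 \<le> c + u" using u c by auto
  obtain B' where B': "B' \<in> sets (F c)" "AE \<omega> in M. \<omega> \<in> B \<longleftrightarrow> \<omega> \<in> B'"
    using gen_sigma_modification[where I="{0..c}" and M=M and Z=Z and X=X and B=B] Z_X B unfolding N_real[OF c] by auto
  have B'M[measurable]: "B' \<in> sets M" using B'(1) F_subalgebra by (auto simp: subalgebra_def)
  interpret cd: cond_density M "F c" "\<lambda>\<omega>. X (c + u) \<omega> / sqrt (c + u)" "\<lambda>z. kern q (c / (c + u)) (X c (fst z) / sqrt (c + u)) (snd z)"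
    by (rule X_cond_density[OF c cu(1)])
  note [measurable] = X_meas[OF c] X_meas[OF cu(2)] Z_meas[OF c] Z_meas[OF cu(2)]
  have fm: "(\<lambda>z. \<phi> (snd z)) \<in> borel_measurable (F c \<Otimes>\<^sub>M borel)" by measurable
  have i: "integrable M (\<lambda>\<omega>. \<phi> (snd (\<omega>, X (c + u) \<omega> / sqrt (c + u))))"
    by (rule integrable_const_bound[of _ 1]) (use \<phi>1 in auto)
  have "(\<integral>\<omega>. indicator B \<omega> * \<phi> (Z (c + u) \<omega> / sqrt (c + u)) \<partial>M) = (\<integral>\<omega>. indicator B' \<omega> * \<phi> (X (c + u) \<omega> / sqrt (c + u)) \<partial>M)"
    using B'(2) Z_X[OF cu(2)] by (intro integral_cong_AE) (auto simp: indicator_def)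
  also have "\<dots> = (\<integral>\<omega>. indicator B' \<omega> * tr u \<phi> c (X c \<omega>) \<partial>M)"
    using cd.cond_exp_density(3)[OF fm i B'(1)] by (simp add: tr_def)
  also have "\<dots> = (\<integral>\<omega>. indicator B \<omega> * tr u \<phi> c (Z c \<omega>) \<partial>M)"
  proof (rule integral_cong_AE)
    show "AE \<omega> in M. indicator B' \<omega> * tr u \<phi> c (X c \<omega>) = indicator B \<omega> * tr u \<phi> c (Z c \<omega>)"
      using B'(2) Z_X[OF c] by eventually_elim (auto simp: indicator_def)
    show "(\<lambda>\<omega>. indicator B' \<omega> * tr u \<phi> c (X c \<omega>)) \<in> borel_measurable M"
      using tr_measurable[OF u \<phi>, of "\<lambda>_. c" M "X c"] by simp
    show "(\<lambda>\<omega>. indicator B \<omega> * tr u \<phi> c (Z c \<omega>)) \<in> borel_measurable M"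
      using tr_measurable[OF u \<phi>, of "\<lambda>_. c" M "Z c"] by simp
  qed
  finally show ?thesis .
qed

text \<open>Progressive measurability. The random time is approximated from the right by dyadic
  values, and truncation at \<open>c\<close> keeps these approximations within the information
  available at \<open>c\<close>.\<close>

lemma Z_eval_bounded:
  assumes L: "space L = space M" "\<And>r. 0 \<le> r \<Longrightarrow> r \<le> c \<Longrightarrow> Z r \<in> borel_measurable L"
    and R[measurable]: "R \<in> borel_measurable L" and Rc: "\<And>\<omega>. \<omega> \<in> space M \<Longrightarrow> 0 \<le> R \<omega> \<and> R \<omega> \<le> c"
    and c: "0 \<le> c"
  shows "(\<lambda>\<omega>. Z (R \<omega>) \<omega>) \<in> borel_measurable L"
proof (rule borel_measurable_LIMSEQ_real)
  fix n
  have nn: "(0::real) \<le> real (k + 1) / 2 ^ n" for k by simp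
  have "(\<lambda>\<omega>. Z (min c (real (nat \<lfloor>2 ^ n * R \<omega>\<rfloor> + 1) / 2 ^ n)) \<omega>) \<in> borel_measurable L"
  proof (rule measurable_compose_countable[where g="\<lambda>\<omega>. nat \<lfloor>2 ^ n * R \<omega>\<rfloor>"])
    show "Z (min c (real (k + 1) / 2 ^ n)) \<in> borel_measurable L" for k
      using nn[of k] c by (intro L(2)) auto
  qed measurable
  then show "(\<lambda>\<omega>. Z (min c (dyadic_above n (R \<omega>))) \<omega>) \<in> borel_measurable L" unfolding dyadic_above_def .
next
  fix \<omega> assume "\<omega> \<in> space L"
  then have w: "\<omega> \<in> space M" using L by simp
  note r = Rc[OF w]
  show "(\<lambda>n. Z (min c (dyadic_above n (R \<omega>))) \<omega>) \<longlonglongrightarrow> Z (R \<omega>) \<omega>"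
  proof (cases "R \<omega> = c")
    case True
    then have "min c (dyadic_above n (R \<omega>)) = R \<omega>" for n using dyadic_above(1)[of "R \<omega>" n] r by simp
    then show ?thesis by simp
  next
    case False
    then have "R \<omega> < c" using r by simp
    then have "\<forall>\<^sub>F n in sequentially. dyadic_above n (R \<omega>) < c"
      using order_tendstoD(2)[OF dyadic_above_lim] r by blast
    then have "\<forall>\<^sub>F n in sequentially. Z (dyadic_above n (R \<omega>)) \<omega> = Z (min c (dyadic_above n (R \<omega>))) \<omega>"
      by eventually_elim (simp add: min_absorb2)
    moreover have "(\<lambda>n. Z (dyadic_above n (R \<omega>)) \<omega>) \<longlonglongrightarrow> Z (R \<omega>) \<omega>"
      using Z_dyadic_lim[OF w, of "R \<omega>" 0] r by simp
    ultimately show ?thesis by (rule Lim_transform_eventually[rotated])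
  qed
qed

lemma Z_eval:
  assumes L: "space L = space M" "\<And>r. 0 \<le> r \<Longrightarrow> Z r \<in> borel_measurable L"
    and R[measurable]: "R \<in> borel_measurable L" and R0: "\<And>\<omega>. \<omega> \<in> space M \<Longrightarrow> 0 \<le> R \<omega>"
  shows "(\<lambda>\<omega>. Z (R \<omega>) \<omega>) \<in> borel_measurable L"
proof (rule borel_measurable_LIMSEQ_real)
  show "(\<lambda>\<omega>. Z (min (real k) (R \<omega>)) \<omega>) \<in> borel_measurable L" for k
    by (rule Z_eval_bounded[where c="real k"]) (use L R0 in auto)
  show "(\<lambda>k. Z (min (real k) (R \<omega>)) \<omega>) \<longlonglongrightarrow> Z (R \<omega>) \<omega>" for \<omega>
  proof (rule tendsto_eventually)
    show "\<forall>\<^sub>F k in sequentially. Z (min (real k) (R \<omega>)) \<omega> = Z (R \<omega>) \<omega>"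
      using eventually_ge_at_top[of "nat \<lceil>R \<omega>\<rceil>"]
    proof eventually_elim
      case (elim k)
      then have "R \<omega> \<le> real k" by linarith
      then show ?case by (simp add: min_absorb2)
    qed
  qed
qed

end

section \<open>The process after a stopping time\<close>

locale qw_stopped = qw_cadlag +
  fixes T :: "'a \<Rightarrow> ennreal" and u :: real
  assumes stop: "stopping_time N T" and fin: "AE \<omega> in M. T \<omega> < \<infinity>" and u: "0 < u"
begin

text \<open>\<open>S\<close> is \<open>0\<close> on the null set where \<open>T\<close> is infinite.\<close>

definition "S \<omega> = enn2real (T \<omega>)"
abbreviation "past_T \<equiv> N.pre_sigma T"
abbreviation "step n \<omega> \<equiv> nat \<lfloor>2 ^ n * S \<omega>\<rfloor>"
abbreviation "grid n k \<equiv> real (k + 1) / 2 ^ n"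

lemma S_nonneg: "0 \<le> S \<omega>" by (simp add: S_def)

lemma T_N: "T \<in> borel_measurable (N top)"
  using N.sets_F_mono[of _ top] by (intro measurable_stopping_time[OF stop]) (auto simp: space_N)

lemma N_M: "h \<in> borel_measurable (N t) \<Longrightarrow> h \<in> borel_measurable M"
  by (rule measurable_from_subalg[OF N_subalgebra])

lemma S_N: "S \<in> borel_measurable (N top)" unfolding S_def[abs_def] using T_N by measurable
lemma S_M [measurable]: "S \<in> borel_measurable M" by (rule N_M[OF S_N])
lemma T_M [measurable]: "T \<in> borel_measurable M" by (rule N_M[OF T_N])

lemma past_T_subalgebra: "subalgebra M past_T"
  unfolding subalgebra_def
proof
  show "space past_T = space M" by (rule N.space_pre_sigma)
  show "sets past_T \<subseteq> sets M"
  proof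
    fix A assume "A \<in> sets past_T"
    from N.sets_pre_sigmaD[OF stop this, of top] have "A \<in> sets (N top)" by simp
    then show "A \<in> sets M" using N_subalgebra[of top] by (auto simp: subalgebra_def)
  qed
qed

lemma S_past: "S \<in> borel_measurable past_T"
  unfolding S_def[abs_def] using N.measurable_stopping_time_pre_sigma[OF stop] by measurable

text \<open>On the event \<open>T \<le> t\<close> the time equals \<open>min T t\<close>, which is
  known at time \<open>t\<close>, so \<open>Z_eval_bounded\<close> applies with the bound
  \<open>t\<close>.\<close>

lemma Z_S_past: "(\<lambda>\<omega>. Z (S \<omega>) \<omega>) \<in> borel_measurable past_T"
proof (rule measurableI)
  fix B :: "real set" assume B: "B \<in> sets borel"
  show "(\<lambda>\<omega>. Z (S \<omega>) \<omega>) -` B \<inter> space past_T \<in> sets past_T"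
  proof (rule N.sets_pre_sigmaI[OF stop])
    fix t
    show "{\<omega> \<in> (\<lambda>\<omega>. Z (S \<omega>) \<omega>) -` B \<inter> space past_T. T \<omega> \<le> t} \<in> sets (N t)"
    proof (cases "t = top")
      case True
      have "(\<lambda>\<omega>. Z (S \<omega>) \<omega>) \<in> borel_measurable (N top)"
        by (rule Z_eval[OF space_N _ S_N S_nonneg]) (rule Z_N, simp_all)
      from measurable_sets[OF this B] show ?thesis using True by (simp add: space_N N.space_pre_sigma vimage_def Int_def)
    next
      case False
      then obtain c where c: "0 \<le> c" "t = ennreal c" by (cases t) auto
      have le: "{\<omega> \<in> space (N t). T \<omega> \<le> s} \<in> sets (N t)" if "s \<le> t" for s
        using N.stopping_time_le_const[OF stop that] by (simp add: pred_def)
      have "(\<lambda>\<omega>. min (T \<omega>) t) \<in> borel_measurable (N t)"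
      proof (rule borel_measurableI_le)
        fix s show "{\<omega> \<in> space (N t). min (T \<omega>) t \<le> s} \<in> sets (N t)"
        proof (cases "t \<le> s")
          case True
          then have "{\<omega> \<in> space (N t). min (T \<omega>) t \<le> s} = space (N t)" by (auto simp: min_le_iff_disj)
          then show ?thesis by simp
        next
          case False
          then have "{\<omega> \<in> space (N t). min (T \<omega>) t \<le> s} = {\<omega> \<in> space (N t). T \<omega> \<le> s}" by (auto simp: min_le_iff_disj)
          then show ?thesis using le[of s] False by simp
        qed
      qed
      then have m: "(\<lambda>\<omega>. enn2real (min (T \<omega>) t)) \<in> borel_measurable (N t)" by measurable
      have "(\<lambda>\<omega>. Z (enn2real (min (T \<omega>) t)) \<omega>) \<in> borel_measurable (N t)"
      proof (rule Z_eval_bounded[OF space_N _ m _ c(1)])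
        show "Z r \<in> borel_measurable (N t)" if "0 \<le> r" "r \<le> c" for r using that c by (intro Z_N) auto
        show "0 \<le> enn2real (min (T \<omega>) t) \<and> enn2real (min (T \<omega>) t) \<le> c" for \<omega>
          using c by (auto intro!: enn2real_leI)
      qed
      from sets.Int[OF measurable_sets[OF this B] le[OF order_refl]]
      have "((\<lambda>\<omega>. Z (enn2real (min (T \<omega>) t)) \<omega>) -` B \<inter> space (N t)) \<inter> {\<omega> \<in> space (N t). T \<omega> \<le> t} \<in> sets (N t)" .
      also have "((\<lambda>\<omega>. Z (enn2real (min (T \<omega>) t)) \<omega>) -` B \<inter> space (N t)) \<inter> {\<omega> \<in> space (N t). T \<omega> \<le> t}
        = {\<omega> \<in> (\<lambda>\<omega>. Z (S \<omega>) \<omega>) -` B \<inter> space past_T. T \<omega> \<le> t}"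
        by (auto simp: space_N N.space_pre_sigma S_def min_absorb1)
      finally show ?thesis .
    qed
  qed
qed simp

lemma Z_S_M: "0 \<le> v \<Longrightarrow> (\<lambda>\<omega>. Z (S \<omega> + v) \<omega>) \<in> borel_measurable M"
  by (rule Z_eval) (auto intro!: Z_meas add_nonneg_nonneg S_nonneg)

text \<open>The cell is given by strict inequalities of the form \<open>T < c\<close>, so the event
  is known at its right end point \<open>grid n k\<close>, which is also the value of
  \<open>dyadic_above n\<close> there. Finiteness of \<open>T\<close> is intersected because
  \<open>S = 0\<close> at infinity would put these points into the cell with index 0.\<close>

lemma stopped_on_grid:
  assumes A: "A \<in> sets past_T"
  shows "(A \<inter> {\<omega>\<in>space M. T \<omega> < \<infinity>}) \<inter> {\<omega>\<in>space M. step n \<omega> = k} \<in> sets (N (ennreal (grid n k)))"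
proof -
  let ?c = "ennreal (grid n k)" and ?b = "ennreal (real k / 2 ^ n)"
  have iff: "T \<omega> < \<infinity> \<and> step n \<omega> = k \<longleftrightarrow> T \<omega> < ?c \<and> \<not> T \<omega> < ?b" for \<omega>
  proof (cases "T \<omega>")
    case (real r)
    have "step n \<omega> = k \<longleftrightarrow> real k \<le> 2 ^ n * r \<and> 2 ^ n * r < real k + 1"
    proof -
      have "0 \<le> 2 ^ n * r" using real by simp
      moreover have "S \<omega> = r" using real by (simp add: S_def)
      ultimately show ?thesis by (simp add: nat_eq_iff floor_eq_iff)
    qed
    also have "\<dots> \<longleftrightarrow> real k / 2 ^ n \<le> r \<and> r < grid n k"
      by (simp add: field_simps)
    finally show ?thesis using real by (auto simp: ennreal_less_iff not_less ennreal_le_iff2)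
  qed (simp add: top.not_eq_extremum)
  have "?b \<le> ?c" by (intro ennreal_leI divide_right_mono) auto
  then have "{\<omega> \<in> space (N ?c). T \<omega> < ?b} \<in> sets (N ?c)"
    using N.stopping_time_less_const[OF stop, of ?b] N.sets_F_mono[of ?b ?c] by (auto simp: pred_def space_N)
  moreover have "{\<omega> \<in> space (N ?c). T \<omega> < ?c} \<in> sets (N ?c)"
    using N.stopping_time_less_const[OF stop, of ?c] by (simp add: pred_def)
  moreover have "{\<omega> \<in> A. T \<omega> \<le> ?c} \<in> sets (N ?c)" by (rule N.sets_pre_sigmaD[OF stop A])
  ultimately have "{\<omega> \<in> A. T \<omega> \<le> ?c} \<inter> {\<omega> \<in> space (N ?c). T \<omega> < ?c} - {\<omega> \<in> space (N ?c). T \<omega> < ?b} \<in> sets (N ?c)" by blast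
  also have "{\<omega> \<in> A. T \<omega> \<le> ?c} \<inter> {\<omega> \<in> space (N ?c). T \<omega> < ?c} - {\<omega> \<in> space (N ?c). T \<omega> < ?b}
    = (A \<inter> {\<omega>\<in>space M. T \<omega> < \<infinity>}) \<inter> {\<omega>\<in>space M. step n \<omega> = k}"
    using iff by (auto simp: space_N intro: less_imp_le)
  finally show ?thesis .
qed

lemma AE_grid_total: "AE \<omega> in M. \<forall>n k. tr u (\<lambda>_. 1) (grid n k) (Z (grid n k) \<omega>) = 1"
  unfolding AE_all_countable by (intro allI Z_total u) simp

text \<open>On each cell the discretised time is the constant \<open>grid n k\<close>, so the Markov
  property at a fixed time applies; summing over the cells gives the claim.\<close>

lemma grid_markov:
  assumes A: "A \<in> sets past_T" and \<phi>[measurable]: "\<phi> \<in> borel_measurable borel" and \<phi>1: "\<And>x. 0 \<le> \<phi> x \<and> \<phi> x \<le> 1"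
  shows "(\<integral>\<omega>. indicator A \<omega> * \<phi> (Z (dyadic_above n (S \<omega>) + u) \<omega> / sqrt (dyadic_above n (S \<omega>) + u)) \<partial>M)
    = (\<integral>\<omega>. indicator A \<omega> * tr u \<phi> (dyadic_above n (S \<omega>)) (Z (dyadic_above n (S \<omega>)) \<omega>) \<partial>M)"
proof -
  let ?A = "A \<inter> {\<omega>\<in>space M. T \<omega> < \<infinity>}"
  let ?f = "\<lambda>k \<omega>. \<phi> (Z (grid n k + u) \<omega> / sqrt (grid n k + u))" and ?h = "\<lambda>k \<omega>. tr u \<phi> (grid n k) (Z (grid n k) \<omega>)"
  have AM: "A \<in> sets M" using A past_T_subalgebra by (auto simp: subalgebra_def)
  then have A'M: "?A \<in> sets M" by measurable
  have g0: "0 \<le> grid n k" for k by simp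
  have [measurable]: "Z (grid n k) \<in> borel_measurable M" "Z (grid n k + u) \<in> borel_measurable M" for k
    using g0[of k] u by (auto intro!: Z_meas)
  have step: "step n \<in> M \<rightarrow>\<^sub>M count_space UNIV" by measurable
  have fm: "?f k \<in> borel_measurable M" for k by measurable
  have hm: "?h k \<in> borel_measurable M" for k
    by (rule tr_measurable[OF u \<phi>]) measurable
  have "(\<lambda>k. \<integral>\<omega>. indicator (?A \<inter> {\<omega>\<in>space M. step n \<omega> = k}) \<omega> * ?f k \<omega> \<partial>M) sums (\<integral>\<omega>. indicator ?A \<omega> * ?f (step n \<omega>) \<omega> \<partial>M)"
    by (rule integral_partition_sums[OF fm _ step A'M]) (use \<phi>1 in simp)
  moreover have "(\<lambda>k. \<integral>\<omega>. indicator (?A \<inter> {\<omega>\<in>space M. step n \<omega> = k}) \<omega> * ?h k \<omega> \<partial>M) sums (\<integral>\<omega>. indicator ?A \<omega> * ?h (step n \<omega>) \<omega> \<partial>M)"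
  proof (rule integral_partition_sums[OF hm _ step A'M])
    show "AE \<omega> in M. \<forall>k. \<bar>?h k \<omega>\<bar> \<le> 1"
      using AE_grid_total
    proof eventually_elim
      case (elim \<omega>)
      show ?case
      proof
        fix k
        have "tr u (\<lambda>_. 1) (grid n k) (Z (grid n k) \<omega>) = 1" using elim by blast
        then show "\<bar>?h k \<omega>\<bar> \<le> 1" using tr_bounds[OF \<phi> \<phi>1 u g0[of k], of "Z (grid n k) \<omega>"] by simp
      qed
    qed
  qed
  moreover have "(\<integral>\<omega>. indicator (?A \<inter> {\<omega>\<in>space M. step n \<omega> = k}) \<omega> * ?f k \<omega> \<partial>M)
      = (\<integral>\<omega>. indicator (?A \<inter> {\<omega>\<in>space M. step n \<omega> = k}) \<omega> * ?h k \<omega> \<partial>M)" for k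
    by (rule Z_markov_fixed[OF u g0 \<phi> \<phi>1 stopped_on_grid[OF A]])
  ultimately have eq: "(\<integral>\<omega>. indicator ?A \<omega> * ?f (step n \<omega>) \<omega> \<partial>M) = (\<integral>\<omega>. indicator ?A \<omega> * ?h (step n \<omega>) \<omega> \<partial>M)"
    by (simp only: sums_unique2)
  \<comment> \<open>The points with infinite \<open>T\<close> form a null set, so they can be put
    back.\<close>
  have ae: "AE \<omega> in M. (indicator ?A \<omega> :: real) = indicator A \<omega>"
    using fin AE_space by eventually_elim (simp add: indicator_def)
  have fs[measurable]: "(\<lambda>\<omega>. ?f (step n \<omega>) \<omega>) \<in> borel_measurable M" by (rule measurable_compose_countable[OF fm step])
  have hs[measurable]: "(\<lambda>\<omega>. ?h (step n \<omega>) \<omega>) \<in> borel_measurable M" by (rule measurable_compose_countable[OF hm step])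
  note [measurable] = AM
  have "(\<integral>\<omega>. indicator A \<omega> * ?f (step n \<omega>) \<omega> \<partial>M) = (\<integral>\<omega>. indicator ?A \<omega> * ?f (step n \<omega>) \<omega> \<partial>M)"
  proof (rule integral_cong_AE)
    show "AE \<omega> in M. indicator A \<omega> * ?f (step n \<omega>) \<omega> = indicator ?A \<omega> * ?f (step n \<omega>) \<omega>"
      using ae by eventually_elim (simp only:)
  qed measurable
  also have "\<dots> = (\<integral>\<omega>. indicator ?A \<omega> * ?h (step n \<omega>) \<omega> \<partial>M)" by (rule eq)
  also have "\<dots> = (\<integral>\<omega>. indicator A \<omega> * ?h (step n \<omega>) \<omega> \<partial>M)"
  proof (rule integral_cong_AE)
    show "AE \<omega> in M. indicator ?A \<omega> * ?h (step n \<omega>) \<omega> = indicator A \<omega> * ?h (step n \<omega>) \<omega>"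
      using ae by eventually_elim (simp only:)
  qed measurable
  finally show ?thesis unfolding dyadic_above_def .
qed

lemma tr_dyadic_lim:
  assumes w: "\<omega> \<in> space M" "\<forall>t\<ge>0. Z t \<omega> \<in> state_space q t"
    and \<phi>: "\<phi> \<in> borel_measurable borel" "\<And>x. 0 \<le> \<phi> x \<and> \<phi> x \<le> 1" "continuous_on UNIV \<phi>"
  shows "(\<lambda>n. tr u \<phi> (dyadic_above n (S \<omega>)) (Z (dyadic_above n (S \<omega>)) \<omega>)) \<longlonglongrightarrow> tr u \<phi> (S \<omega>) (Z (S \<omega>) \<omega>)"
proof -
  let ?d = "\<lambda>n. dyadic_above n (S \<omega>)"
  have d0: "0 \<le> ?d n" for n using dyadic_above(1)[OF S_nonneg, of \<omega> n] S_nonneg[of \<omega>] by simp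
  have lim: "?d \<longlonglongrightarrow> S \<omega>" by (rule dyadic_above_lim[OF S_nonneg])
  have nz: "S \<omega> + u \<noteq> 0" using S_nonneg[of \<omega>] u by simp
  have dom: "mehler_dom q (c / (c + u)) (Z c \<omega> / sqrt (c + u))" if "0 \<le> c" for c
    by (rule state_space_dom(1)[OF q that]) (use u w that in auto)
  show ?thesis unfolding tr_def
  proof (rule kern_tendsto[OF q fN_integrable dom[OF d0] dom[OF S_nonneg] _ _ \<phi>(1), where B=1])
    show "(\<lambda>n. ?d n / (?d n + u)) \<longlonglongrightarrow> S \<omega> / (S \<omega> + u)"
      by (intro tendsto_intros lim nz)
    show "(\<lambda>n. Z (?d n) \<omega> / sqrt (?d n + u)) \<longlonglongrightarrow> Z (S \<omega>) \<omega> / sqrt (S \<omega> + u)"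
      using Z_dyadic_lim[OF w(1) S_nonneg, of 0] nz by (intro tendsto_intros lim) auto
    show "\<bar>\<phi> x\<bar> \<le> 1" for x using \<phi>(2)[of x] by simp
    show "continuous_on UNIV \<phi>" by (rule \<phi>(3))
  qed
qed

text \<open>Total mass 1 holds at all grid times at once, outside one null set, and continuity of
  the kernel carries it to the random time \<open>S\<close>. The uncountably many fixed-time null
  sets of \<open>Z_total\<close> could not be united.\<close>

lemma stopped_total: "AE \<omega> in M. tr u (\<lambda>_. 1) (S \<omega>) (Z (S \<omega>) \<omega>) = 1"
  using AE_grid_total AE_state AE_space
proof eventually_elim
  case (elim \<omega>)
  have "tr u (\<lambda>_. 1) (dyadic_above n (S \<omega>)) (Z (dyadic_above n (S \<omega>)) \<omega>) = 1" for n
    using elim(1) unfolding dyadic_above_def by blast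
  with tr_dyadic_lim[OF elim(3,2), of "\<lambda>_. 1"] show ?case by (simp add: LIMSEQ_const_iff)
qed

text \<open>Both sides of \<open>grid_markov\<close> converge: the left one by right-continuity of
  the paths and continuity of \<open>\<phi>\<close>, the right one by continuity of the kernel in
  time and state.\<close>

lemma stopped_markov:
  assumes A: "A \<in> sets past_T" and c: "continuous_on UNIV \<phi>" and \<phi>1: "\<And>x. 0 \<le> \<phi> x \<and> \<phi> x \<le> 1"
  shows "(\<integral>\<omega>. indicator A \<omega> * \<phi> (Z (S \<omega> + u) \<omega> / sqrt (S \<omega> + u)) \<partial>M)
    = (\<integral>\<omega>. indicator A \<omega> * tr u \<phi> (S \<omega>) (Z (S \<omega>) \<omega>) \<partial>M)"
proof (rule LIMSEQ_unique)
  have \<phi>[measurable]: "\<phi> \<in> borel_measurable borel" by (rule borel_measurable_continuous_onI[OF c])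
  have AM[measurable]: "A \<in> sets M" using A past_T_subalgebra by (auto simp: subalgebra_def)
  let ?d = "\<lambda>n \<omega>. dyadic_above n (S \<omega>)"
  have d0: "0 \<le> ?d n \<omega>" for n \<omega> using dyadic_above(1)[OF S_nonneg, of \<omega> n] S_nonneg[of \<omega>] by simp
  have dm[measurable]: "?d n \<in> borel_measurable M" for n unfolding dyadic_above_def by measurable
  have Zm[measurable]: "(\<lambda>\<omega>. Z (?d n \<omega> + v) \<omega>) \<in> borel_measurable M" if "0 \<le> v" for n v
    by (rule Z_eval) (use that in \<open>auto intro!: Z_meas add_nonneg_nonneg d0\<close>)
  note [measurable] = Zm[OF less_imp_le[OF u]] Zm[of 0, simplified] Z_S_M[OF less_imp_le[OF u]] Z_S_M[of 0, simplified]
  show "(\<lambda>n. \<integral>\<omega>. indicator A \<omega> * \<phi> (Z (?d n \<omega> + u) \<omega> / sqrt (?d n \<omega> + u)) \<partial>M)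
      \<longlonglongrightarrow> (\<integral>\<omega>. indicator A \<omega> * \<phi> (Z (S \<omega> + u) \<omega> / sqrt (S \<omega> + u)) \<partial>M)"
  proof (rule integral_dominated_convergence[where w="\<lambda>_. 1"])
    show "AE \<omega> in M. (\<lambda>n. indicator A \<omega> * \<phi> (Z (?d n \<omega> + u) \<omega> / sqrt (?d n \<omega> + u)))
      \<longlonglongrightarrow> indicator A \<omega> * \<phi> (Z (S \<omega> + u) \<omega> / sqrt (S \<omega> + u))"
    proof (rule AE_I2)
      fix \<omega> assume w: "\<omega> \<in> space M"
      have nz: "S \<omega> + u \<noteq> 0" using S_nonneg[of \<omega>] u by simp
      have "(\<lambda>n. Z (?d n \<omega> + u) \<omega> / sqrt (?d n \<omega> + u)) \<longlonglongrightarrow> Z (S \<omega> + u) \<omega> / sqrt (S \<omega> + u)"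
        using nz u by (intro tendsto_intros dyadic_above_lim[OF S_nonneg] Z_dyadic_lim[OF w S_nonneg]) auto
      then have "(\<lambda>n. \<phi> (Z (?d n \<omega> + u) \<omega> / sqrt (?d n \<omega> + u))) \<longlonglongrightarrow> \<phi> (Z (S \<omega> + u) \<omega> / sqrt (S \<omega> + u))"
        by (rule continuous_on_tendsto_compose[OF c]) auto
      then show "(\<lambda>n. indicator A \<omega> * \<phi> (Z (?d n \<omega> + u) \<omega> / sqrt (?d n \<omega> + u)))
        \<longlonglongrightarrow> indicator A \<omega> * \<phi> (Z (S \<omega> + u) \<omega> / sqrt (S \<omega> + u))" by (intro tendsto_mult tendsto_const)
    qed
    show "AE \<omega> in M. norm (indicator A \<omega> * \<phi> (Z (?d n \<omega> + u) \<omega> / sqrt (?d n \<omega> + u))) \<le> 1" for n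
      using \<phi>1 by (intro AE_I2) (simp add: indicator_def)
  qed measurable
  have trm: "(\<lambda>\<omega>. tr u \<phi> (?d n \<omega>) (Z (?d n \<omega>) \<omega>)) \<in> borel_measurable M" for n
    by (rule tr_measurable[OF u \<phi>]) measurable
  have trm0: "(\<lambda>\<omega>. tr u \<phi> (S \<omega>) (Z (S \<omega>) \<omega>)) \<in> borel_measurable M"
    by (rule tr_measurable[OF u \<phi>]) measurable
  note [measurable] = trm trm0
  show "(\<lambda>n. \<integral>\<omega>. indicator A \<omega> * \<phi> (Z (?d n \<omega> + u) \<omega> / sqrt (?d n \<omega> + u)) \<partial>M)
      \<longlonglongrightarrow> (\<integral>\<omega>. indicator A \<omega> * tr u \<phi> (S \<omega>) (Z (S \<omega>) \<omega>) \<partial>M)"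
    unfolding grid_markov[OF A \<phi> \<phi>1]
  proof (rule integral_dominated_convergence[where w="\<lambda>_. 1"])
    show "AE \<omega> in M. (\<lambda>n. indicator A \<omega> * tr u \<phi> (?d n \<omega>) (Z (?d n \<omega>) \<omega>)) \<longlonglongrightarrow> indicator A \<omega> * tr u \<phi> (S \<omega>) (Z (S \<omega>) \<omega>)"
      using AE_state AE_space by eventually_elim (intro tendsto_mult tendsto_const tr_dyadic_lim \<phi> \<phi>1 c)
    show "AE \<omega> in M. norm (indicator A \<omega> * tr u \<phi> (?d n \<omega>) (Z (?d n \<omega>) \<omega>)) \<le> 1" for n
      using AE_grid_total
    proof eventually_elim
      case (elim \<omega>)
      have "tr u (\<lambda>_. 1) (?d n \<omega>) (Z (?d n \<omega>) \<omega>) = 1" using elim unfolding dyadic_above_def by blast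
      then show ?case using tr_bounds[OF \<phi> \<phi>1 u d0[of n \<omega>], of "Z (?d n \<omega>) \<omega>"] by (simp add: indicator_def)
    qed
  qed measurable
qed

lemma stopped_cond_density:
  "cond_density M past_T (\<lambda>\<omega>. Z (S \<omega> + u) \<omega> / sqrt (S \<omega> + u))
    (\<lambda>z. kern q (S (fst z) / (S (fst z) + u)) (Z (S (fst z)) (fst z) / sqrt (S (fst z) + u)) (snd z))"
proof (rule cond_density_from_continuous[OF past_T_subalgebra])
  note [measurable] = Z_S_M[OF less_imp_le[OF u]]
  show "(\<lambda>\<omega>. Z (S \<omega> + u) \<omega> / sqrt (S \<omega> + u)) \<in> borel_measurable M" by measurable
  have [measurable]: "(\<lambda>z. S (fst z)) \<in> borel_measurable (past_T \<Otimes>\<^sub>M borel)"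
    "(\<lambda>z. Z (S (fst z)) (fst z)) \<in> borel_measurable (past_T \<Otimes>\<^sub>M borel)"
    by (rule measurable_compose[OF measurable_fst S_past], rule measurable_compose[OF measurable_fst Z_S_past])
  show "(\<lambda>z. kern q (S (fst z) / (S (fst z) + u)) (Z (S (fst z)) (fst z) / sqrt (S (fst z) + u)) (snd z))
    \<in> borel_measurable (past_T \<Otimes>\<^sub>M borel)"
    by (rule kern_measurable[OF q]) measurable
  show "0 \<le> kern q (S (fst z) / (S (fst z) + u)) (Z (S (fst z)) (fst z) / sqrt (S (fst z) + u)) (snd z)" for z
    by (rule kern_nonneg[OF q])
  have p: "0 \<le> S \<omega> / (S \<omega> + u)" "S \<omega> / (S \<omega> + u) < 1" for \<omega>
    using S_nonneg[of \<omega>] u by auto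
  show "integrable lborel (\<lambda>x. kern q (S (fst (\<omega>, x)) / (S (fst (\<omega>, x)) + u))
      (Z (S (fst (\<omega>, x))) (fst (\<omega>, x)) / sqrt (S (fst (\<omega>, x)) + u)) (snd (\<omega>, x)))" for \<omega>
    unfolding fst_conv snd_conv by (rule kern_section_integrable[OF p])
  show "AE \<omega> in M. (\<integral>x. kern q (S (fst (\<omega>, x)) / (S (fst (\<omega>, x)) + u))
      (Z (S (fst (\<omega>, x))) (fst (\<omega>, x)) / sqrt (S (fst (\<omega>, x)) + u)) (snd (\<omega>, x)) \<partial>lborel) \<le> 1"
    using stopped_total by eventually_elim (simp add: tr_def)
  fix A and \<phi> :: "real \<Rightarrow> real"
  assume "A \<in> sets past_T" "continuous_on UNIV \<phi>" "\<And>x. 0 \<le> \<phi> x \<and> \<phi> x \<le> 1"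
  from stopped_markov[OF this]
  show "(\<integral>\<omega>. indicator A \<omega> * \<phi> (Z (S \<omega> + u) \<omega> / sqrt (S \<omega> + u)) \<partial>M)
    = (\<integral>\<omega>. indicator A \<omega> * (\<integral>x. \<phi> x * kern q (S (fst (\<omega>, x)) / (S (fst (\<omega>, x)) + u))
      (Z (S (fst (\<omega>, x))) (fst (\<omega>, x)) / sqrt (S (fst (\<omega>, x)) + u)) (snd (\<omega>, x)) \<partial>lborel) \<partial>M)"
    by (simp only: tr_def fst_conv snd_conv)
qed

lemma stopped_cond_exp:
  assumes f[measurable]: "f \<in> borel_measurable borel" and b: "bounded (range f)"
  shows "has_cond_exp M past_T (\<lambda>\<omega>. f (Z (S \<omega> + u) \<omega>)) (\<lambda>\<omega>. q_trans q (S \<omega>) (S \<omega> + u) f (Z (S \<omega>) \<omega>))"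
  unfolding has_cond_exp_def
proof
  interpret cd: cond_density M past_T "\<lambda>\<omega>. Z (S \<omega> + u) \<omega> / sqrt (S \<omega> + u)"
    "\<lambda>z. kern q (S (fst z) / (S (fst z) + u)) (Z (S (fst z)) (fst z) / sqrt (S (fst z) + u)) (snd z)"
    by (rule stopped_cond_density)
  obtain B where B: "\<And>x. \<bar>f x\<bar> \<le> B" using b by (auto simp: bounded_iff)
  note [measurable] = Z_S_M[OF less_imp_le[OF u]]
  show i: "integrable M (\<lambda>\<omega>. f (Z (S \<omega> + u) \<omega>))" by (rule integrable_const_bound[of _ B]) (use B in auto)
  have eq: "f (sqrt (S (fst (\<omega>, v)) + u) * snd (\<omega>, Z (S \<omega> + u) \<omega> / sqrt (S \<omega> + u))) = f (Z (S \<omega> + u) \<omega>)" for \<omega> and v :: real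
    using S_nonneg[of \<omega>] u by simp
  have [measurable]: "(\<lambda>z. S (fst z)) \<in> borel_measurable (past_T \<Otimes>\<^sub>M borel)"
    by (rule measurable_compose[OF measurable_fst S_past])
  have fm: "(\<lambda>z. f (sqrt (S (fst z) + u) * snd z)) \<in> borel_measurable (past_T \<Otimes>\<^sub>M borel)" by measurable
  have "AE \<omega> in M. real_cond_exp M past_T (\<lambda>\<omega>. f (Z (S \<omega> + u) \<omega>)) \<omega>
    = (\<integral>x. f (sqrt (S (fst (\<omega>, x)) + u) * snd (\<omega>, x)) * kern q (S (fst (\<omega>, x)) / (S (fst (\<omega>, x)) + u))
      (Z (S (fst (\<omega>, x))) (fst (\<omega>, x)) / sqrt (S (fst (\<omega>, x)) + u)) (snd (\<omega>, x)) \<partial>lborel)"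
    using cd.cond_exp_density(2)[OF fm] i unfolding eq by blast
  then show "AE \<omega> in M. real_cond_exp M past_T (\<lambda>\<omega>. f (Z (S \<omega> + u) \<omega>)) \<omega> = q_trans q (S \<omega>) (S \<omega> + u) f (Z (S \<omega>) \<omega>)"
    using AE_state
  proof eventually_elim
    case (elim \<omega>)
    have "q_trans q (S \<omega>) (S \<omega> + u) f (Z (S \<omega>) \<omega>)
      = (\<integral>x. f (sqrt (S \<omega> + u) * x) * kern q (S \<omega> / (S \<omega> + u)) (Z (S \<omega>) \<omega> / sqrt (S \<omega> + u)) x \<partial>lborel)"
      by (rule state_space_dom(2)[OF q S_nonneg]) (use u elim(2) S_nonneg in auto)
    then show ?case using elim(1) by (simp only: fst_conv snd_conv)
  qed
qed

end

lemma (in qw_cadlag) Z_strong_markov: "strong_markov M Z (q_trans q)"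
  unfolding strong_markov_def
proof (intro allI impI, elim conjE)
  fix T and u :: real and f :: "real \<Rightarrow> real"
  assume "stopping_time N T" "AE \<omega> in M. T \<omega> < \<infinity>" "0 < u"
    and f: "f \<in> borel_measurable borel" "bounded (range f)"
  then interpret s: qw_stopped M \<alpha> q Y X Z T u by unfold_locales
  show "has_cond_exp M (N.pre_sigma T) (\<lambda>\<omega>. f (Z (enn2real (T \<omega>) + u) \<omega>))
      (\<lambda>\<omega>. q_trans q (enn2real (T \<omega>)) (enn2real (T \<omega>) + u) f (Z (enn2real (T \<omega>)) \<omega>))"
    using s.stopped_cond_exp[OF f] unfolding s.S_def .
qed


theorem corollary2:
  fixes M :: "'a measure" and q :: real and X :: "real \<Rightarrow> 'a \<Rightarrow> real"
  assumes "prob_space M"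
    and "-1 < q" and "q \<le> 1"
    and "q_wiener M q X"
  shows
    "((\<forall>\<sigma> \<tau>. 0 < \<sigma> \<and> \<sigma> < \<tau> \<longrightarrow>
         has_cond_exp M (gen_sigma M X {0..\<sigma>}) (\<lambda>\<omega>. (X \<tau> \<omega> - X \<sigma> \<omega>) ^ 2)
           (\<lambda>\<omega>. \<tau> - \<sigma>) \<and>
         has_cond_exp M (gen_sigma M X {0..\<sigma>}) (\<lambda>\<omega>. (X \<tau> \<omega> - X \<sigma> \<omega>) ^ 3)
           (\<lambda>\<omega>. - (1 - q) * (\<tau> - \<sigma>) * X \<sigma> \<omega>) \<and>
         has_cond_exp M (gen_sigma M X {0..\<sigma>}) (\<lambda>\<omega>. (X \<tau> \<omega> - X \<sigma> \<omega>) ^ 4)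
           (\<lambda>\<omega>. (\<tau> - \<sigma>) * ((X \<sigma> \<omega>)\<^sup>2 * (1 - q)\<^sup>2 + (2 + q) * (\<tau> - \<sigma>) + \<sigma> * (1 - q\<^sup>2)))) \<and>
      is_martingale M (\<lambda>\<tau>. gen_sigma M X {0..\<tau>}) (\<lambda>\<tau> \<omega>. (X \<tau> \<omega>)\<^sup>2 - \<tau>) \<and>
      (\<bar>q\<bar> < 1 \<longrightarrow> \<not> independent_increments M X))
     \<and>
     ((\<exists>Z. modification M X Z \<and> separable_process M Z) \<and>
      (\<forall>Z. modification M X Z \<and> separable_process M Z \<longrightarrow>
         (AE \<omega> in M. has_one_sided_limits (\<lambda>\<tau>. Z \<tau> \<omega>))) \<and>
      (\<exists>Z. modification M X Z \<and> (\<forall>\<omega>\<in>space M. cadlag (\<lambda>\<tau>. Z \<tau> \<omega>))))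
     \<and>
     (markov_with_transitions M X (q_trans q) \<and>
      feller_continuous (state_space q) (q_trans q) \<and>
      (\<forall>Z. modification M X Z \<and> (\<forall>\<omega>\<in>space M. cadlag (\<lambda>\<tau>. Z \<tau> \<omega>)) \<longrightarrow>
         strong_markov M Z (q_trans q)))"
proof -
  obtain \<alpha> Y where Y: "0 < \<alpha>" "ou_process M \<alpha> q Y" "\<forall>\<omega>\<in>space M. X 0 \<omega> = 0"
    "\<forall>\<tau>>0. \<forall>\<omega>\<in>space M. X \<tau> \<omega> = sqrt \<tau> * Y (ln \<tau> / (2 * \<alpha>)) \<omega>"
    using assms(4) unfolding q_wiener_def by blast
  have "qw M \<alpha> q Y X"
    by (intro qw.intro ou.intro ou_axioms.intro qw_axioms.intro) (use assms(1-3) Y in blast)+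
  then interpret qw M \<alpha> q Y X .
  obtain Z where Z: "modification M X Z" "\<forall>\<omega>\<in>space M. cadlag (\<lambda>\<tau>. Z \<tau> \<omega>)"
    using X_cadlag_modification by blast
  have sep: "separable_process M Z" by (rule cadlag_separable) (use Z(2) in blast)
  \<comment> \<open>All modifications of \<open>X\<close> agree almost surely at each fixed time, so
    the one cadlag \<open>Z\<close> controls every separable \<open>V\<close>.\<close>
  have lim: "AE \<omega> in M. has_one_sided_limits (\<lambda>\<tau>. V \<tau> \<omega>)" if V: "modification M X V" "separable_process M V" for V
  proof (rule separable_limits[OF _ V(2)])
    show "cadlag (\<lambda>\<tau>. Z \<tau> \<omega>)" if "\<omega> \<in> space M" for \<omega> using Z(2) that by blast
    show "AE \<omega> in M. V t \<omega> = Z t \<omega>" if "0 \<le> t" for t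
    proof -
      have "AE \<omega> in M. V t \<omega> = X t \<omega>" "AE \<omega> in M. Z t \<omega> = X t \<omega>"
        using V(1) Z(1) that unfolding modification_def by blast+
      then show ?thesis by eventually_elim simp
    qed
  qed
  have strong: "strong_markov M V (q_trans q)" if "modification M X V" "\<forall>\<omega>\<in>space M. cadlag (\<lambda>\<tau>. V \<tau> \<omega>)" for V
  proof -
    interpret c: qw_cadlag M \<alpha> q Y X V by unfold_locales (use that in blast)+
    show ?thesis by (rule c.Z_strong_markov)
  qed
  show ?thesis
  proof (intro conjI allI impI)
    show "\<not> independent_increments M X" if "\<bar>q\<bar> < 1" by (rule X_not_independent[OF that])
    show "\<exists>Z. modification M X Z \<and> separable_process M Z" using Z(1) sep by blast
    show "AE \<omega> in M. has_one_sided_limits (\<lambda>\<tau>. V \<tau> \<omega>)" if "modification M X V \<and> separable_process M V" for V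
      using that lim by blast
    show "strong_markov M V (q_trans q)" if "modification M X V \<and> (\<forall>\<omega>\<in>space M. cadlag (\<lambda>\<tau>. V \<tau> \<omega>))" for V
      using that strong by blast
  qed (rule X_cadlag_modification X_markov X_feller X_square_martingale | (elim conjE, rule X_increment_moments, assumption, assumption))+
qed

end
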